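(* Let $1\le r\le m_2$, $A\in\mathbb{R}^{n\times n}$, $B_1\in\mathbb{R}^{n\times m_1}$, $C_1\in\mathbb{R}^{p_1\times n}$, $D_{11}\in\mathbb{R}^{p_1\times m_1}$, $D_{12}=(O_{p_1\times r},\ \hat D_{12})$ with $\hat D_{12}\in\mathbb{R}^{p_1\times(m_2-r)}$ of full column rank, and $B_2=(B_{21},\ B_{22})$ with $B_{21}\in\mathbb{R}^{n\times r}$ of full column rank and $B_{22}\in\mathbb{R}^{n\times(m_2-r)}$. Let $\alpha>0$. Then the optimal performance index under static state feedback of the system $$\dot x=Ax+B_1w+B_{21}u_1+B_{22}u_2,\qquad z=C_1x+D_{11}w+\hat D_{12}u_2$$ (with inputs $(u_1,u_2)\in\mathbb{R}^r\times\mathbb{R}^{m_2-r}$ and feedback $(u_1^T,u_2^T)^T=Kx$, $K\in\mathbb{R}^{m_2\times n}$) is equal to the optimal performance index under static state feedback of the system with an added differentiator $$\dot x=Ax+B_1w+(A+\alpha I_n)B_{21}\tilde u_1+B_{22}u_2,\qquad z=C_1x+D_{11}w+C_1B_{21}\tilde u_1+\hat D_{12}u_2$$ (with inputs $(\tilde u_1,u_2)\in\mathbb{R}^r\times\mathbb{R}^{m_2-r}$ and feedback $(\tilde u_1^T,u_2^T)^T=K_dx$, $K_d\in\mathbb{R}^{m_2\times n}$).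
   Context: $O_{k\times\ell}$ is the $k\times\ell$ zero matrix. For a system $\dot x=\mathcal{A}x+\mathcal{B}_1w+\mathcal{B}_2u$, $z=\mathcal{C}x+\mathcal{D}_1w+\mathcal{D}_2u$ and a gain $\mathcal{K}$ (state feedback $u=\mathcal{K}x$), the closed loop transfer function is $G_{\mathcal{K}}(s)=(\mathcal{C}+\mathcal{D}_2\mathcal{K})(sI-\mathcal{A}-\mathcal{B}_2\mathcal{K})^{-1}\mathcal{B}_1+\mathcal{D}_1$. The optimal performance index under static state feedback is the infimum of $\|G_{\mathcal{K}}\|_\infty=\sup_{\omega\in\mathbb{R}}\sigma_{\max}(G_{\mathcal{K}}(i\omega))$ over all real matrices $\mathcal{K}$ such that $\mathcal{A}+\mathcal{B}_2\mathcal{K}$ is Hurwitz stable (all eigenvalues have negative real part), with the infimum over the empty set being $+\infty$. *)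

theory Defs
  imports
    "HOL-Library.Extended_Real"
    "Jordan_Normal_Form.DL_Rank"
    "Jordan_Normal_Form.Schur_Decomposition"
    "Jordan_Normal_Form.Gauss_Jordan_Elimination"
begin

definition append_cols :: "'a :: zero mat \<Rightarrow> 'a mat \<Rightarrow> 'a mat" where
  "append_cols A B = four_block_mat A B (0\<^sub>m 0 (dim_col A)) (0\<^sub>m 0 (dim_col B))"

definition full_column_rank :: "real mat \<Rightarrow> bool" where
  "full_column_rank M \<longleftrightarrow> vec_space.rank (dim_row M) M = dim_col M"

abbreviation cmat :: "real mat \<Rightarrow> complex mat" where
  "cmat \<equiv> map_mat complex_of_real"

definition hurwitz_stable :: "real mat \<Rightarrow> bool" where
  "hurwitz_stable M \<longleftrightarrow> (\<forall>s. eigenvalue (cmat M) s \<longrightarrow> Re s < 0)"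

(* The eigenvalues of M^* M are real and nonnegative, so Re loses nothing.
   Inserting 0 changes the maximum only when M has no columns (there are then no
   singular values, and the norm of the empty matrix is taken to be 0). *)
definition sigma_max :: "complex mat \<Rightarrow> real" where
  "sigma_max M = Max (insert 0 {sqrt (Re k) | k. eigenvalue (mat_adjoint M * M) k})"

(* (C + D2 K) (s I - A - B2 K)^(-1) B1 + D1.  The inverse exists whenever s is not an
   eigenvalue of A + B2 K, in particular on the imaginary axis when A + B2 K is Hurwitz
   stable; elsewhere the value is irrelevant. *)
definition closed_loop_tf ::
  "real mat \<Rightarrow> real mat \<Rightarrow> real mat \<Rightarrow> real mat \<Rightarrow> real mat \<Rightarrow> real mat \<Rightarrow> real mat
    \<Rightarrow> complex \<Rightarrow> complex mat" where
  "closed_loop_tf A B1 B2 C D1 D2 K s =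
     cmat (C + D2 * K)
       * the (mat_inverse (s \<cdot>\<^sub>m 1\<^sub>m (dim_row A) - cmat A - cmat (B2 * K)))
       * cmat B1
     + cmat D1"

definition hinf_norm :: "(complex \<Rightarrow> complex mat) \<Rightarrow> ereal" where
  "hinf_norm G = (SUP \<omega> :: real. ereal (sigma_max (G (\<i> * complex_of_real \<omega>))))"

(* In ereal the infimum over the empty set is \<infinity>. *)
definition opt_perf_index ::
  "real mat \<Rightarrow> real mat \<Rightarrow> real mat \<Rightarrow> real mat \<Rightarrow> real mat \<Rightarrow> real mat \<Rightarrow> ereal" where
  "opt_perf_index A B1 B2 C D1 D2 =
     (INF K \<in> {K \<in> carrier_mat (dim_col B2) (dim_row A). hurwitz_stable (A + B2 * K)}.
        hinf_norm (closed_loop_tf A B1 B2 C D1 D2 K))"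

end

theory Submission
  imports Defs
begin

text \<open>
  By the strict bounded real lemma, a gain \<open>K\<close> with performance below \<open>g\<close> exists iff the matrix inequality
  \<open>2 \<xi>\<^sup>T((A X + B\<^sub>2 Y) \<xi> + B\<^sub>1 w) + |(C X + D\<^sub>2 Y) \<xi> + D\<^sub>1 w|\<^sup>2 < g\<^sup>2 |w|\<^sup>2\<close> has a solution \<open>X > 0\<close>, \<open>Y = K X\<close>.
  Because \<open>u\<^sub>1\<close> does not enter \<open>z\<close>, Finsler's lemma eliminates \<open>Y\<^sub>1\<close>: only vectors with \<open>B\<^sub>2\<^sub>1\<^sup>T \<xi> = 0\<close> matter, where \<open>Y\<^sub>1\<close>
  drops out (large \<open>\<rho>\<close> in \<open>Y\<^sub>1 = - \<rho> B\<^sub>2\<^sub>1\<^sup>T\<close> does the rest). With differentiator, \<open>X + B\<^sub>2\<^sub>1 V\<^sub>1\<close> takes the place of \<open>X\<close>, up to the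
  term \<open>\<alpha> B\<^sub>2\<^sub>1 V\<^sub>1\<close>, which vanishes on the same vectors. So both problems reduce to the same inequality on
  \<open>B\<^sub>2\<^sub>1\<^sup>T \<xi> = 0\<close>.

  The hard direction of the bounded real lemma is obtained from the Riccati equation, whose solution is read off
  the stable invariant subspace of the Hamiltonian matrix (Schur decomposition with the stable eigenvalues first).
\<close>

subsection \<open>Adjoints and inner products\<close>

text \<open>The differentiator is the substitution \<open>x = x' + B21 v\<close> with
  \<open>u1 = dv/dt + \<alpha> v\<close>: in the coordinate \<open>x'\<close> the input
  \<open>v\<close> acts through \<open>(A + \<alpha> I) B21\<close> on the state and through
  \<open>C1 B21\<close> on \<open>z\<close>. This correspondence is dynamic and does not by itself
  carry static gains to static gains, so the proof compares the matrix inequalities at each level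
  instead. With \<open>x' = X \<xi>\<close> and \<open>v = V1 \<xi>\<close> one has
  \<open>x = (X + B21 V1) \<xi>\<close>, which is why this matrix replaces \<open>X\<close>.

  The obstacle is to get a strict inequality with positive definite \<open>P\<close> from a bound on
  the imaginary axis alone. Part of the margin between gain and level keeps the Hamiltonian spectrum
  off the axis and gives a Hermitian \<open>P\<close> with the nonstrict inequality; the rest pays
  for a small multiple of a Lyapunov solution, which makes it strict; positivity then follows from
  stability of the closed loop. All this is complex, because eigenvectors are; restricted to real
  vectors, the inequality only sees \<open>Re P\<close>. The equivalence loses the difference
  between \<open><\<close> and \<open>\<le>\<close>, which the infimum does not notice.\<close>

definition ip :: "'a :: conjugatable_field vec \<Rightarrow> 'a vec \<Rightarrow> 'a" where
  "ip u v = (\<Sum>i<dim_vec v. u $ i * conjugate (v $ i))"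

lemma mat_adjoint_dim [simp]:
  "dim_row (mat_adjoint A) = dim_col A" "dim_col (mat_adjoint A) = dim_row A"
  by (auto simp: mat_adjoint_def)

lemma mat_adjoint_carrier [simp]: "A \<in> carrier_mat n m \<Longrightarrow> mat_adjoint A \<in> carrier_mat m n"
  by auto

lemma mat_adjoint_index [simp]:
  "i < dim_col A \<Longrightarrow> j < dim_row A \<Longrightarrow> mat_adjoint A $$ (i,j) = conjugate (A $$ (j,i))"
  by (auto simp: mat_adjoint_def mat_of_rows_index)

lemma mat_adjoint_adjoint [simp]: "mat_adjoint (mat_adjoint A) = A"
  by (rule eq_matI) auto

lemma mat_adjoint_add: 
  "dim_row A = dim_row B \<Longrightarrow> dim_col A = dim_col B \<Longrightarrow> mat_adjoint (A + B) = mat_adjoint A + mat_adjoint B"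
  by (rule eq_matI) (auto simp: conjugate_dist_add)

lemma mat_adjoint_mult:
  fixes A B :: "'a :: conjugatable_field mat"
  shows "dim_col A = dim_row B \<Longrightarrow> mat_adjoint (A * B) = mat_adjoint B * mat_adjoint A"
  by (rule eq_matI)
     (auto simp: scalar_prod_def sum_conjugate conjugate_dist_mul mult.commute intro!: sum.cong)

lemma mat_adjoint_one [simp]: "mat_adjoint (1\<^sub>m n :: complex mat) = 1\<^sub>m n"
  by (rule eq_matI) auto

lemma mat_adjoint_smult: "mat_adjoint (a \<cdot>\<^sub>m A) = conjugate a \<cdot>\<^sub>m mat_adjoint A"
  by (rule eq_matI) (auto simp: conjugate_dist_mul)

lemma mult_vec_index: "i < dim_row A \<Longrightarrow> dim_col A = dim_vec v \<Longrightarrow> (A *\<^sub>v v) $ i = (\<Sum>j<dim_vec v. A $$ (i,j) * v $ j)"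
  by (simp add: scalar_prod_def atLeast0LessThan)

lemma vec_distribs:
  fixes A B :: "'a :: field mat"
  shows "dim_row A = dim_row B \<Longrightarrow> dim_col A = dim_vec v \<Longrightarrow> dim_col B = dim_vec v \<Longrightarrow> (A + B) *\<^sub>v v = A *\<^sub>v v + B *\<^sub>v v"
    "dim_row A = dim_row B \<Longrightarrow> dim_col A = dim_vec v \<Longrightarrow> dim_col B = dim_vec v \<Longrightarrow> (A - B) *\<^sub>v v = A *\<^sub>v v - B *\<^sub>v v"
    "dim_col A = dim_vec v \<Longrightarrow> (- A) *\<^sub>v v = - (A *\<^sub>v v)"
    "dim_col A = dim_vec v \<Longrightarrow> (c \<cdot>\<^sub>m A) *\<^sub>v v = c \<cdot>\<^sub>v (A *\<^sub>v v)"
    "dim_col A = dim_vec v \<Longrightarrow> dim_vec v = dim_vec w \<Longrightarrow> A *\<^sub>v (v + w) = A *\<^sub>v v + A *\<^sub>v w"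
    "dim_col A = dim_vec v \<Longrightarrow> dim_vec v = dim_vec w \<Longrightarrow> A *\<^sub>v (v - w) = A *\<^sub>v v - A *\<^sub>v w"
    "dim_col A = dim_vec v \<Longrightarrow> A *\<^sub>v (- v) = - (A *\<^sub>v v)"
    "dim_col A = dim_vec v \<Longrightarrow> A *\<^sub>v (c \<cdot>\<^sub>v v) = c \<cdot>\<^sub>v (A *\<^sub>v v)"
    "dim_col A = dim_row B \<Longrightarrow> dim_col B = dim_vec v \<Longrightarrow> (A * B) *\<^sub>v v = A *\<^sub>v (B *\<^sub>v v)"
    "dim_vec v = n \<Longrightarrow> 1\<^sub>m n *\<^sub>v v = v"
    "dim_vec v = n \<Longrightarrow> 0\<^sub>m m n *\<^sub>v v = 0\<^sub>v m"
    "dim_col A = n \<Longrightarrow> A *\<^sub>v 0\<^sub>v n = 0\<^sub>v (dim_row A)"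
  subgoal by (rule eq_vecI) (auto simp: mult_vec_index sum.distrib algebra_simps simp del: index_mult_mat_vec)
  subgoal by (rule eq_vecI) (auto simp: mult_vec_index sum_subtractf algebra_simps simp del: index_mult_mat_vec)
  subgoal by (rule eq_vecI) (auto simp: mult_vec_index sum_negf simp del: index_mult_mat_vec)
  subgoal by (rule eq_vecI) (auto simp: mult_vec_index sum_distrib_left algebra_simps simp del: index_mult_mat_vec)
  subgoal by (rule eq_vecI) (auto simp: mult_vec_index sum.distrib algebra_simps simp del: index_mult_mat_vec)
  subgoal by (rule eq_vecI) (auto simp: mult_vec_index sum_subtractf algebra_simps simp del: index_mult_mat_vec)
  subgoal by (rule eq_vecI) (auto simp: mult_vec_index sum_negf simp del: index_mult_mat_vec)
  subgoal by (rule eq_vecI) (auto simp: mult_vec_index sum_distrib_left algebra_simps simp del: index_mult_mat_vec)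
  subgoal by (rule assoc_mult_mat_vec) auto
  subgoal by (rule one_mult_mat_vec) auto
  subgoal by (rule eq_vecI) (auto simp: mult_vec_index simp del: index_mult_mat_vec)
  subgoal by (rule eq_vecI) (auto simp: mult_vec_index simp del: index_mult_mat_vec)
  done

lemma ip_simps:
  "dim_vec u = dim_vec w \<Longrightarrow> dim_vec v = dim_vec w \<Longrightarrow> ip (u + v) w = ip u w + ip v w"
  "dim_vec u = dim_vec w \<Longrightarrow> dim_vec v = dim_vec w \<Longrightarrow> ip (u - v) w = ip u w - ip v w"
  "dim_vec u = dim_vec w \<Longrightarrow> ip (- u) w = - ip u w"
  "dim_vec u = dim_vec w \<Longrightarrow> ip (c \<cdot>\<^sub>v u) w = c * ip u w"
  "dim_vec u = dim_vec v \<Longrightarrow> dim_vec u = dim_vec w \<Longrightarrow> ip u (v + w) = ip u v + ip u w"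
  "dim_vec u = dim_vec v \<Longrightarrow> dim_vec u = dim_vec w \<Longrightarrow> ip u (v - w) = ip u v - ip u w"
  "dim_vec u = dim_vec w \<Longrightarrow> ip u (- w) = - ip u w"
  "dim_vec u = dim_vec w \<Longrightarrow> ip u (c \<cdot>\<^sub>v w) = conjugate c * ip u w"
  "dim_vec w = n \<Longrightarrow> ip (0\<^sub>v n) w = 0"
  "ip u (0\<^sub>v n) = 0"
  by (auto simp: ip_def sum.distrib sum_subtractf sum_negf sum_distrib_left conjugate_dist_add
      conjugate_dist_mul conjugate_neg algebra_simps diff_conv_add_uminus
      simp del: add_uminus_conv_diff intro!: sum.cong)

lemma ip_commute: "dim_vec u = dim_vec v \<Longrightarrow> ip v u = conjugate (ip u v)"
  by (auto simp: ip_def sum_conjugate conjugate_dist_mul mult.commute intro!: sum.cong)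

lemma ip_adjoint:
  fixes A :: "'a :: conjugatable_field mat"
  assumes "dim_row A = dim_vec y" "dim_col A = dim_vec x"
  shows "ip (A *\<^sub>v x) y = ip x (mat_adjoint A *\<^sub>v y)"
  unfolding ip_def using assms
  by (simp add: mult_vec_index sum_distrib_left sum_distrib_right sum_conjugate conjugate_dist_mul 
      sum.swap[of _ "{..<dim_vec x}"] mult_ac del: index_mult_mat_vec)

lemma ip_adjoint_right:
  fixes A :: "'a :: conjugatable_field mat"
  assumes "dim_row A = dim_vec y" "dim_col A = dim_vec x"
  shows "ip y (A *\<^sub>v x) = ip (mat_adjoint A *\<^sub>v y) x"
  using ip_adjoint[of "mat_adjoint A" x y] assms by simp

lemma ip_unit_right: "i < n \<Longrightarrow> dim_vec u = n \<Longrightarrow> ip u (unit_vec n i :: complex vec) = u $ i"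
  by (simp add: ip_def if_distrib sum.If_cases cong: if_cong)

lemma ip_self: "ip (v :: complex vec) v = of_real (\<Sum>i<dim_vec v. (cmod (v $ i))\<^sup>2)"
  by (simp add: ip_def complex_norm_square[symmetric])

definition nsq :: "complex vec \<Rightarrow> real" where "nsq v = (\<Sum>i<dim_vec v. (cmod (v $ i))\<^sup>2)"

lemma ip_self_nsq: "ip v v = of_real (nsq v)"
  by (simp add: ip_self nsq_def)

lemma nsq_ge0 [simp]: "nsq v \<ge> 0"
  by (auto simp: nsq_def intro: sum_nonneg)

lemma nsq_eq0: "nsq v = 0 \<longleftrightarrow> v = 0\<^sub>v (dim_vec v)"
  by (auto simp: nsq_def sum_nonneg_eq_0_iff vec_eq_iff)

lemma nsq_pos: "v \<noteq> 0\<^sub>v (dim_vec v) \<Longrightarrow> nsq v > 0"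
  using nsq_eq0[of v] nsq_ge0[of v] by linarith

lemma ip_ext:
  fixes u :: "complex vec"
  assumes "u \<in> carrier_vec n" "\<And>y. y \<in> carrier_vec n \<Longrightarrow> ip u y = 0"
  shows "u = 0\<^sub>v n"
  using assms(2)[OF assms(1)] assms(1) nsq_eq0[of u] by (auto simp: ip_self_nsq)

lemma mult_unit_vec: "j < dim_col A \<Longrightarrow> dim_col A = n \<Longrightarrow> (A::'a::field mat) *\<^sub>v unit_vec n j = col A j"
  by (rule eq_vecI) auto

lemma mat_eq_0I:
  assumes "A \<in> carrier_mat n m" "\<And>v. v \<in> carrier_vec m \<Longrightarrow> (A :: complex mat) *\<^sub>v v = 0\<^sub>v n"
  shows "A = 0\<^sub>m n m"
proof (rule eq_matI)
  fix i j assume "i < dim_row (0\<^sub>m n m)" "j < dim_col (0\<^sub>m n m)"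
  then show "A $$ (i,j) = 0\<^sub>m n m $$ (i,j)"
    using assms(2)[of "unit_vec m j"] assms(1) mult_unit_vec[of j A m]
    by (auto simp: vec_eq_iff)
qed (use assms in auto)

lemma mat_adjoint_eqI:
  fixes X :: "complex mat"
  assumes X: "X \<in> carrier_mat n n"
    and sym: "\<And>x y. x \<in> carrier_vec n \<Longrightarrow> y \<in> carrier_vec n \<Longrightarrow> ip (X *\<^sub>v x) y = ip x (X *\<^sub>v y)"
  shows "mat_adjoint X = X"
proof -
  note [simp] = carrier_matD[OF X]
  have "mat_adjoint X - X = 0\<^sub>m n n"
  proof (rule mat_eq_0I)
    fix v :: "complex vec" assume v: "v \<in> carrier_vec n"
    show "(mat_adjoint X - X) *\<^sub>v v = 0\<^sub>v n"
    proof (rule ip_ext)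
      fix y :: "complex vec" assume y: "y \<in> carrier_vec n"
      have "ip (mat_adjoint X *\<^sub>v v) y = ip v (X *\<^sub>v y)" using v y by (simp add: ip_adjoint_right)
      then show "ip ((mat_adjoint X - X) *\<^sub>v v) y = 0" using v y by (simp add: vec_distribs ip_simps sym)
    qed (auto intro!: carrier_vecI)
  qed (auto intro!: carrier_matI)
  then show ?thesis by (auto simp: mat_eq_iff)
qed

subsection \<open>The Riccati equation\<close>

text \<open>Multiplicities matter: the stable eigenvalues will be counted through the reflection
  symmetry of the spectrum, and equality of root sets would not determine their number.\<close>

lemma mset_eq_of_linear_factors_eq:
  fixes xs ys :: "'a :: field list"
  assumes "(\<Prod>a\<leftarrow>xs. [:- a, 1:]) = (\<Prod>a\<leftarrow>ys. [:- a, 1:])"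
  shows "mset xs = mset ys"
  using assms
proof (induction xs arbitrary: ys)
  case Nil
  have "degree (\<Prod>a\<leftarrow>ys. [:- a, 1:]) = length ys"
    by (rule degree_linear_factors)
  with Nil show ?case by (metis degree_1 length_0_conv list.map(1) prod_list.Nil mset.simps(1))
next
  case (Cons x xs)
  have "poly (\<Prod>a\<leftarrow>ys. [:- a, 1:]) x = 0"
    unfolding Cons.prems[symmetric] by simp
  then have "x \<in> set ys" by (auto simp: poly_prod_list prod_list_zero_iff)
  then obtain us vs where ys: "ys = us @ x # vs" by (meson split_list)
  have "[:- x, 1:] * (\<Prod>a\<leftarrow>xs. [:- a, 1:]) = [:- x, 1:] * (\<Prod>a\<leftarrow>us @ vs. [:- a, 1:])"
    using Cons.prems unfolding ys list.map prod_list.Cons map_append prod_list.append by (simp only: mult_ac)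
  then have "(\<Prod>a\<leftarrow>xs. [:- a, 1:]) = (\<Prod>a\<leftarrow>us @ vs. [:- a, 1:])"
    by (subst (asm) mult_cancel_left) auto
  from Cons.IH[OF this] show ?case by (simp add: ys)
qed

text \<open>In Schur form this can be read off the diagonal: \<open>- mat_adjoint B\<close> is the
  transpose of a triangular matrix with diagonal entries \<open>- cnj e\<close>, and transposition
  keeps the characteristic polynomial.\<close>

lemma char_poly_neg_adjoint:
  fixes H :: "complex mat"
  assumes H: "H \<in> carrier_mat n n" and cp: "char_poly H = (\<Prod>e\<leftarrow>es. [:- e, 1:])"
  shows "char_poly (- mat_adjoint H) = (\<Prod>e\<leftarrow>map (\<lambda>e. - cnj e) es. [:- e, 1:])"
proof -
  obtain B P Q where S: "schur_decomposition H es = (B,P,Q)" by (metis prod_cases3)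
  from schur_decomposition[OF H cp S] have sim: "similar_mat_wit H B P Q"
    and ut: "upper_triangular B" and dg: "diag_mat B = es" by auto
  note w = similar_mat_witD2[OF H sim]
  let ?T = "map_mat (\<lambda>z. - cnj z) B"
  have T: "?T \<in> carrier_mat n n" using w by simp
  have tr: "- mat_adjoint B = transpose_mat ?T"
    using w by (intro eq_matI) auto
  have "similar_mat (- mat_adjoint H) (- mat_adjoint B)"
  proof (rule similar_matI[where P = "mat_adjoint Q" and Q = "mat_adjoint P" and n = n])
    have d: "dim_row P = n" "dim_col P = n" "dim_row Q = n" "dim_col Q = n" "dim_row B = n" "dim_col B = n"
      using w(5-7) by auto
    show "{- mat_adjoint H, - mat_adjoint B, mat_adjoint Q, mat_adjoint P} \<subseteq> carrier_mat n n"
      using H w by auto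
    show "mat_adjoint Q * mat_adjoint P = 1\<^sub>m n" "mat_adjoint P * mat_adjoint Q = 1\<^sub>m n"
      using w d by (simp_all add: mat_adjoint_mult[symmetric])
    have "mat_adjoint H = mat_adjoint Q * (mat_adjoint B * mat_adjoint P)"
      unfolding w(3) using d by (simp add: mat_adjoint_mult)
    also have "\<dots> = mat_adjoint Q * mat_adjoint B * mat_adjoint P"
      by (rule assoc_mult_mat[symmetric, of _ n n _ n _ n]) (use w in auto)
    finally show "- mat_adjoint H = mat_adjoint Q * - mat_adjoint B * mat_adjoint P"
      using d by simp
  qed
  then have "char_poly (- mat_adjoint H) = char_poly ?T"
    using char_poly_similar tr char_poly_transpose_mat[OF T] by metis
  also have "\<dots> = (\<Prod>a\<leftarrow>diag_mat ?T. [:- a, 1:])"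
    by (rule char_poly_upper_triangular[OF T]) (use ut w in \<open>auto simp: upper_triangular_def\<close>)
  also have "diag_mat ?T = map (\<lambda>e. - cnj e) es"
    using w unfolding dg[symmetric] by (auto simp: diag_mat_def)
  finally show ?thesis .
qed

text \<open>Conjugation by the symplectic unit \<open>J\<close> turns \<open>- mat_adjoint H\<close>
  into \<open>H\<close>. Together with \<open>char_poly_neg_adjoint\<close> this makes the spectrum
  of \<open>H\<close> symmetric about the imaginary axis, with multiplicities.\<close>

lemma hamiltonian_char_poly:
  fixes A R Q :: "complex mat"
  assumes [simp]: "A \<in> carrier_mat n n" "R \<in> carrier_mat n n" "Q \<in> carrier_mat n n"
    and R: "mat_adjoint R = R" and Q: "mat_adjoint Q = Q"
  defines "H \<equiv> four_block_mat A R (- Q) (- mat_adjoint A)"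
  shows "char_poly (- mat_adjoint H) = char_poly H"
proof -
  let ?J = "four_block_mat (0\<^sub>m n n) (1\<^sub>m n) (- 1\<^sub>m n) (0\<^sub>m n n) :: complex mat"
  let ?K = "four_block_mat (0\<^sub>m n n) (- 1\<^sub>m n) (1\<^sub>m n) (0\<^sub>m n n) :: complex mat"
  have d[simp]: "dim_row A = n" "dim_col A = n" "dim_row R = n" "dim_col R = n" "dim_row Q = n" "dim_col Q = n"
    using carrier_matD[OF assms(1)] carrier_matD[OF assms(2)] carrier_matD[OF assms(3)] by simp_all
  have z[simp]: "- 0\<^sub>m n n = (0\<^sub>m n n :: complex mat)" by (rule eq_matI) auto
  have adj: "- mat_adjoint H = four_block_mat (- mat_adjoint A) Q (- R) A"
  proof (rule eq_matI)
    fix i j assume "i < dim_row (four_block_mat (- mat_adjoint A) Q (- R) A)"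
      "j < dim_col (four_block_mat (- mat_adjoint A) Q (- R) A)"
    then have ij: "i < n + n" "j < n + n" by auto
    have e: "conjugate (R $$ (j,i)) = R $$ (i,j)" "conjugate (Q $$ (j,i)) = Q $$ (i,j)" if "i < n" "j < n" for i j
      using that mat_adjoint_index[of i R j] mat_adjoint_index[of i Q j] R Q by auto
    show "(- mat_adjoint H) $$ (i,j) = four_block_mat (- mat_adjoint A) Q (- R) A $$ (i,j)"
      using ij e[of "i-n" j] e[of i "j-n"] by (auto simp: H_def)
  qed (auto simp: H_def)
  have JK: "?J * ?K = 1\<^sub>m (n+n)" "?K * ?J = 1\<^sub>m (n+n)"
    by (subst mult_four_block_mat[of _ n n _ n _ n _ _ n _ n]; auto)+
  have "?J * - mat_adjoint H = four_block_mat (- R) A (mat_adjoint A) (- Q)"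
    unfolding adj by (subst mult_four_block_mat[of _ n n _ n _ n _ _ n _ n]) auto
  then have "?J * - mat_adjoint H * ?K = H"
    unfolding H_def by (simp, subst mult_four_block_mat[of _ n n _ n _ n _ _ n _ n]) auto
  then have "similar_mat H (- mat_adjoint H)"
    by (intro similar_matI[OF _ JK]) (auto simp: H_def)
  then show ?thesis using char_poly_similar by metis
qed

text \<open>The last hypothesis is the weak form of \<open>L\<^sup>* Y + Y L = 0\<close>. As
  \<open>L\<close> is triangular, the entry \<open>(i,j)\<close> of this equation is
  \<open>Y\<^sub>i\<^sub>j (L\<^sub>j\<^sub>j + cnj L\<^sub>i\<^sub>i)\<close> plus multiples of
  entries of \<open>Y\<close> with smaller index sum, so \<open>Y\<close> vanishes by induction on
  \<open>i + j\<close>; the bracket is nonzero because its real part is negative.\<close>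

lemma sylvester_upper_triangular_zero:
  fixes L Y :: "complex mat"
  assumes L: "L \<in> carrier_mat n n" and Y: "Y \<in> carrier_mat n n"
    and ut: "upper_triangular L" and neg: "\<And>i. i < n \<Longrightarrow> Re (L $$ (i,i)) < 0"
    and eq: "\<And>u v. u \<in> carrier_vec n \<Longrightarrow> v \<in> carrier_vec n \<Longrightarrow> 
        ip (Y *\<^sub>v (L *\<^sub>v u)) v + ip (Y *\<^sub>v u) (L *\<^sub>v v) = 0"
  shows "Y = 0\<^sub>m n n"
proof -
  have "Y $$ (i,j) = 0" if "i < n" "j < n" for i j
    using that
  proof (induction "i + j" arbitrary: i j rule: less_induct)
    case less
    have d[simp]: "dim_row L = n" "dim_col L = n" "dim_row Y = n" "dim_col Y = n" using L Y by auto
    have a: "ip (Y *\<^sub>v (L *\<^sub>v unit_vec n j)) (unit_vec n i) = (\<Sum>k<n. Y $$ (i,k) * L $$ (k,j))"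
      using less.prems by (simp add: ip_unit_right mult_unit_vec mult_vec_index del: index_mult_mat_vec)
    have b: "ip (Y *\<^sub>v unit_vec n j) (L *\<^sub>v unit_vec n i) = (\<Sum>k<n. Y $$ (k,j) * cnj (L $$ (k,i)))"
      using less.prems by (simp add: mult_unit_vec ip_def)
    have a': "(\<Sum>k<n. Y $$ (i,k) * L $$ (k,j)) = Y $$ (i,j) * L $$ (j,j)"
    proof (subst sum.remove[of _ j])
      show "Y $$ (i,j) * L $$ (j,j) + (\<Sum>k\<in>{..<n}-{j}. Y $$ (i,k) * L $$ (k,j)) = Y $$ (i,j) * L $$ (j,j)"
      proof -
        have "Y $$ (i,k) * L $$ (k,j) = 0" if "k < n" "k \<noteq> j" for k
        proof (cases "k < j")
          case True then show ?thesis using less.hyps[of i k] less.prems that by auto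
        next
          case False then show ?thesis using ut that by (auto simp: upper_triangular_def)
        qed
        then show ?thesis by (simp add: sum.neutral)
      qed
    qed (use less.prems in auto)
    have b': "(\<Sum>k<n. Y $$ (k,j) * cnj (L $$ (k,i))) = Y $$ (i,j) * cnj (L $$ (i,i))"
    proof (subst sum.remove[of _ i])
      show "Y $$ (i,j) * cnj (L $$ (i,i)) + (\<Sum>k\<in>{..<n}-{i}. Y $$ (k,j) * cnj (L $$ (k,i))) = Y $$ (i,j) * cnj (L $$ (i,i))"
      proof -
        have "Y $$ (k,j) * cnj (L $$ (k,i)) = 0" if "k < n" "k \<noteq> i" for k
        proof (cases "k < i")
          case True then show ?thesis using less.hyps[of k j] less.prems that by auto
        next
          case False then show ?thesis using ut that by (auto simp: upper_triangular_def)
        qed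
        then show ?thesis by (simp add: sum.neutral)
      qed
    qed (use less.prems in auto)
    have "Y $$ (i,j) * (L $$ (j,j) + cnj (L $$ (i,i))) = 0"
      using eq[of "unit_vec n j" "unit_vec n i"] unfolding a b a' b' by (simp add: algebra_simps)
    moreover have "Re (L $$ (j,j) + cnj (L $$ (i,i))) < 0"
      using neg[of i] neg[of j] less.prems by simp
    ultimately show ?case by (metis less_irrefl mult_eq_0_iff zero_complex.simps(1))
  qed
  then show ?thesis using Y by (intro eq_matI) auto
qed

text \<open>Among the nonzero vectors of the kernel, take one whose last nonzero index \<open>l\<close> is minimal:
  then \<open>(L - L\<^sub>l\<^sub>l) v\<close> lies in the kernel and its last nonzero index is smaller.\<close>

lemma upper_triangular_invariant_kernel_eigenvector:
  fixes L X :: "complex mat"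
  assumes L: "L \<in> carrier_mat n n" and X: "X \<in> carrier_mat m n" and ut: "upper_triangular L"
    and inv: "\<And>v. v \<in> carrier_vec n \<Longrightarrow> X *\<^sub>v v = 0\<^sub>v m \<Longrightarrow> X *\<^sub>v (L *\<^sub>v v) = 0\<^sub>v m"
    and ex: "v0 \<in> carrier_vec n" "v0 \<noteq> 0\<^sub>v n" "X *\<^sub>v v0 = 0\<^sub>v m"
  obtains v i where "v \<in> carrier_vec n" "v \<noteq> 0\<^sub>v n" "X *\<^sub>v v = 0\<^sub>v m" "i < n" "L *\<^sub>v v = L $$ (i,i) \<cdot>\<^sub>v v"
proof -
  have d[simp]: "dim_row L = n" "dim_col L = n" "dim_row X = m" "dim_col X = n" using L X by auto
  define good where "good l \<longleftrightarrow> (\<exists>v\<in>carrier_vec n. v \<noteq> 0\<^sub>v n \<and> X *\<^sub>v v = 0\<^sub>v m \<and> (\<forall>i<n. l \<le> i \<longrightarrow> v $ i = 0))" for l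
  have "good n" using ex by (auto simp: good_def)
  define l where "l = (LEAST l. good l)"
  have gl: "good l" and min: "\<And>k. k < l \<Longrightarrow> \<not> good k"
    unfolding l_def using \<open>good n\<close> by (auto intro: LeastI dest: not_less_Least)
  have ln: "l \<le> n" unfolding l_def using \<open>good n\<close> by (rule Least_le)
  from gl obtain v where v: "v \<in> carrier_vec n" "v \<noteq> 0\<^sub>v n" "X *\<^sub>v v = 0\<^sub>v m" "\<And>i. i < n \<Longrightarrow> l \<le> i \<Longrightarrow> v $ i = 0"
    by (auto simp: good_def)
  have "l \<noteq> 0"
  proof
    assume "l = 0"
    then have "v = 0\<^sub>v n" using v(1,4) by (intro eq_vecI) auto
    with v(2) show False by simp
  qed
  then obtain k where k: "l = Suc k" by (cases l) auto
  with ln have kn: "k < n" by simp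
  define w where "w = L *\<^sub>v v - L $$ (k,k) \<cdot>\<^sub>v v"
  have w: "w \<in> carrier_vec n" using v(1) unfolding w_def by (intro carrier_vecI) auto
  have "X *\<^sub>v w = 0\<^sub>v m"
    using v inv[of v] unfolding w_def by (simp add: vec_distribs, auto simp: vec_eq_iff)
  moreover have "w $ i = 0" if "i < n" "k \<le> i" for i
  proof -
    have "(L *\<^sub>v v) $ i = (\<Sum>j<n. L $$ (i,j) * v $ j)"
      using v that by (simp add: mult_vec_index del: index_mult_mat_vec)
    also have "\<dots> = (\<Sum>j<n. if j = i then L $$ (k,k) * v $ i else 0)"
    proof (intro sum.cong refl)
      fix j assume j: "j \<in> {..<n}"
      show "L $$ (i,j) * v $ j = (if j = i then L $$ (k,k) * v $ i else 0)"
        using ut v(4)[of j] v(4)[of i] that j k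
        by (cases "j < i"; cases "i = j"; cases "i = k") (auto simp: upper_triangular_def)
    qed
    also have "\<dots> = L $$ (k,k) * v $ i" using that by simp
    finally show ?thesis using that v by (simp add: w_def)
  qed
  ultimately have "w = 0\<^sub>v n"
    using min[of k] k w by (auto simp: good_def)
  then have "L *\<^sub>v v = L $$ (k,k) \<cdot>\<^sub>v v"
    using v by (auto simp: w_def vec_eq_iff simp del: index_mult_mat_vec)
  then show thesis using that v kn by blast
qed

text \<open>The reflection of \<open>e\<close> to \<open>- cnj e\<close> permutes the spectrum and
  exchanges its stable and unstable parts; with no eigenvalue on the axis, exactly \<open>n\<close>
  of the \<open>2 n\<close> eigenvalues are stable. So the leading \<open>n\<close> by
  \<open>n\<close> block of the Schur form holds precisely the stable ones, and the first
  \<open>n\<close> columns of the transformation are \<open>X1\<close> stacked over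
  \<open>X2\<close>.\<close>

lemma hamiltonian_stable_factor:
  fixes A R Q :: "complex mat"
  assumes A: "A \<in> carrier_mat n n" and R: "R \<in> carrier_mat n n" and Q: "Q \<in> carrier_mat n n"
    and Rh: "mat_adjoint R = R" and Qh: "mat_adjoint Q = Q"
    and noimag: "\<And>x p \<omega>. x \<in> carrier_vec n \<Longrightarrow> p \<in> carrier_vec n \<Longrightarrow>
        A *\<^sub>v x + R *\<^sub>v p = (\<i> * complex_of_real \<omega>) \<cdot>\<^sub>v x \<Longrightarrow>
        - (Q *\<^sub>v x) - mat_adjoint A *\<^sub>v p = (\<i> * complex_of_real \<omega>) \<cdot>\<^sub>v p \<Longrightarrow> x = 0\<^sub>v n \<and> p = 0\<^sub>v n"
  obtains L X1 X2 where "L \<in> carrier_mat n n" "X1 \<in> carrier_mat n n" "X2 \<in> carrier_mat n n"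
    "upper_triangular L" "\<And>i. i < n \<Longrightarrow> Re (L $$ (i,i)) < 0"
    "\<And>u. u \<in> carrier_vec n \<Longrightarrow> A *\<^sub>v (X1 *\<^sub>v u) + R *\<^sub>v (X2 *\<^sub>v u) = X1 *\<^sub>v (L *\<^sub>v u)"
    "\<And>u. u \<in> carrier_vec n \<Longrightarrow> - (Q *\<^sub>v (X1 *\<^sub>v u)) - mat_adjoint A *\<^sub>v (X2 *\<^sub>v u) = X2 *\<^sub>v (L *\<^sub>v u)"
    "\<And>u. u \<in> carrier_vec n \<Longrightarrow> X1 *\<^sub>v u = 0\<^sub>v n \<Longrightarrow> X2 *\<^sub>v u = 0\<^sub>v n \<Longrightarrow> u = 0\<^sub>v n"
proof -
  define H where "H = four_block_mat A R (- Q) (- mat_adjoint A)"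
  have H: "H \<in> carrier_mat (n + n) (n + n)" using A by (simp add: H_def)
  have Hv: "H *\<^sub>v (x @\<^sub>v p) = (A *\<^sub>v x + R *\<^sub>v p) @\<^sub>v (- (Q *\<^sub>v x) - mat_adjoint A *\<^sub>v p)"
    if "x \<in> carrier_vec n" "p \<in> carrier_vec n" for x p
  proof -
    have "- Q *\<^sub>v x + - mat_adjoint A *\<^sub>v p = - (Q *\<^sub>v x) - mat_adjoint A *\<^sub>v p"
      using that A Q by (auto simp: vec_distribs)
    then show ?thesis unfolding H_def
      by (subst four_block_mat_mult_vec[OF A R _ _ that]) (use A Q in auto)
  qed
  obtain es where es: "char_poly H = (\<Prod>e\<leftarrow>es. [:- e, 1:])" "length es = n + n"
    using char_poly_factorized[OF H] by blast
  have nz: "Re e \<noteq> 0" if "e \<in> set es" for e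
  proof
    assume re: "Re e = 0"
    have "poly (char_poly H) e = 0" using that by (auto simp: es poly_prod_list prod_list_zero_iff)
    then have "eigenvalue H e" using eigenvalue_root_char_poly[OF H] by simp
    then obtain v where v: "v \<in> carrier_vec (n+n)" "v \<noteq> 0\<^sub>v (n+n)" "H *\<^sub>v v = e \<cdot>\<^sub>v v"
      using H by (auto simp: eigenvalue_def eigenvector_def)
    define x where "x = vec_first v n"
    define p where "p = vec_last v n"
    have xp: "x \<in> carrier_vec n" "p \<in> carrier_vec n" "v = x @\<^sub>v p"
      using v(1) by (auto simp: x_def p_def)
    have "(A *\<^sub>v x + R *\<^sub>v p) @\<^sub>v (- (Q *\<^sub>v x) - mat_adjoint A *\<^sub>v p) = (e \<cdot>\<^sub>v x) @\<^sub>v (e \<cdot>\<^sub>v p)"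
    proof -
      have "e \<cdot>\<^sub>v (x @\<^sub>v p) = (e \<cdot>\<^sub>v x) @\<^sub>v (e \<cdot>\<^sub>v p)"
        by (rule eq_vecI) auto
      then show ?thesis using v(3) Hv[OF xp(1,2)] unfolding xp(3) by simp
    qed
    then have "A *\<^sub>v x + R *\<^sub>v p = e \<cdot>\<^sub>v x" "- (Q *\<^sub>v x) - mat_adjoint A *\<^sub>v p = e \<cdot>\<^sub>v p"
      using append_vec_eq[of "A *\<^sub>v x + R *\<^sub>v p" n "e \<cdot>\<^sub>v x"] A R xp by auto
    moreover have "e = \<i> * complex_of_real (Im e)" using re by (simp add: complex_eq_iff)
    ultimately have "x = 0\<^sub>v n \<and> p = 0\<^sub>v n" using noimag[OF xp(1,2)] by metis
    with v(2) xp(3) show False by auto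
  qed
  define s where "s = (\<lambda>e::complex. Re e < 0)"
  have "(\<Prod>e\<leftarrow>es. [:- e, 1:]) = (\<Prod>e\<leftarrow>map (\<lambda>e. - cnj e) es. [:- e, 1:])"
    using char_poly_neg_adjoint[OF H es(1)] hamiltonian_char_poly[OF A R Q Rh Qh]
    by (simp only: es(1)[symmetric] H_def)
  then have "mset es = mset (map (\<lambda>e. - cnj e) es)"
    by (rule mset_eq_of_linear_factors_eq)
  then have "length (filter s es) = length (filter s (map (\<lambda>e. - cnj e) es))"
    by (metis mset_filter size_mset)
  also have "\<dots> = length (filter (\<lambda>e. \<not> s e) es)"
    unfolding filter_map length_map
    by (intro arg_cong[of _ _ length] filter_cong) (use nz in \<open>force simp: s_def\<close>)+
  finally have len: "length (filter s es) = n"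
    using sum_length_filter_compl[of s es] es(2) by simp
  define fs where "fs = filter s es @ filter (\<lambda>e. \<not> s e) es"
  have "char_poly H = (\<Prod>e\<leftarrow>fs. [:- e, 1:])"
    unfolding es(1) fs_def by (induction es) (auto simp: mult_ac simp del: mult_pCons_left mult_pCons_right)
  moreover obtain B P P' where S: "schur_decomposition H fs = (B,P,P')" by (metis prod_cases3)
  ultimately have sim: "similar_mat_wit H B P P'"
    and ut: "upper_triangular B" and dg: "diag_mat B = fs"
    using schur_decomposition[OF H _ S] by auto
  note w = similar_mat_witD2[OF H sim]
  obtain X1 Y1 X2 Y2 where sp: "split_block P n n = (X1,Y1,X2,Y2)" by (metis prod_cases4)
  obtain L M Z N where sb: "split_block B n n = (L,M,Z,N)" by (metis prod_cases4)
  note p = split_block[OF sp, of n n] and b = split_block[OF sb, of n n]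
  have pc: "X1 \<in> carrier_mat n n" "Y1 \<in> carrier_mat n n" "X2 \<in> carrier_mat n n" "Y2 \<in> carrier_mat n n"
     "P = four_block_mat X1 Y1 X2 Y2" using p w by auto
  have bc: "L \<in> carrier_mat n n" "M \<in> carrier_mat n n" "Z \<in> carrier_mat n n" "N \<in> carrier_mat n n"
     "B = four_block_mat L M Z N" using b w by auto
  have Bi: "B $$ (i,j) = L $$ (i,j)" if "i < n" "j < n" for i j
    using that bc by auto
  have Z: "Z = 0\<^sub>m n n"
  proof (rule eq_matI)
    fix i j assume "i < dim_row (0\<^sub>m n n :: complex mat)" "j < dim_col (0\<^sub>m n n :: complex mat)"
    then have ij: "i < n" "j < n" by auto
    then have "n + i < dim_row B" "j < n + i" "B $$ (n + i, j) = Z $$ (i,j)"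
      using bc by auto
    moreover from this(1,2) have "B $$ (n + i, j) = 0" using ut by (auto simp: upper_triangular_def)
    ultimately have "B $$ (n + i, j) = Z $$ (i,j)" "B $$ (n + i, j) = 0" by auto
    then show "Z $$ (i,j) = 0\<^sub>m n n $$ (i,j)" using ij by simp
  qed (use bc in auto)
  have z[simp]: "0\<^sub>v n \<in> carrier_vec n" by simp
  have Pv: "P *\<^sub>v (u @\<^sub>v 0\<^sub>v n) = (X1 *\<^sub>v u) @\<^sub>v (X2 *\<^sub>v u)" if "u \<in> carrier_vec n" for u
    unfolding pc(5) by (subst four_block_mat_mult_vec[OF pc(1-4) that z]) (use pc that in \<open>auto simp: vec_distribs\<close>)
  have Bv: "B *\<^sub>v (u @\<^sub>v 0\<^sub>v n) = (L *\<^sub>v u) @\<^sub>v 0\<^sub>v n" if "u \<in> carrier_vec n" for u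
    unfolding bc(5) by (subst four_block_mat_mult_vec[OF bc(1-4) that z]) (use bc that in \<open>auto simp: vec_distribs Z\<close>)
  have HP: "H *\<^sub>v (P *\<^sub>v u) = P *\<^sub>v (B *\<^sub>v u)" if "u \<in> carrier_vec (n+n)" for u
  proof -
    have "H *\<^sub>v (P *\<^sub>v u) = P *\<^sub>v (B *\<^sub>v ((P' * P) *\<^sub>v u))"
      using w that unfolding w(3) by (subst vec_distribs(9), simp, simp, subst vec_distribs(9), simp, simp)  (auto simp: vec_distribs(9) simp del: w(2))
    then show ?thesis using w that by simp
  qed
  show thesis
  proof (rule that[of L X1 X2])
    show "upper_triangular L" 
    proof (rule upper_triangularI)
      fix i j assume "j < i" "i < dim_row L"
      then show "L $$ (i,j) = 0" using Bi[of i j] bc(1) w(5) upper_triangularD[OF ut, of j i] by auto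
    qed
    show "Re (L $$ (i,i)) < 0" if "i < n" for i
    proof -
      have "L $$ (i,i) = fs ! i" using Bi[OF that that] dg[symmetric] that w by (simp add: diag_mat_def)
      also have "\<dots> = filter s es ! i" using that len by (simp add: fs_def nth_append)
      finally have "s (L $$ (i,i))" using that len nth_mem[of i "filter s es"] by auto
      then show ?thesis by (simp add: s_def)
    qed
    fix u :: "complex vec" assume u: "u \<in> carrier_vec n"
    have "(A *\<^sub>v (X1 *\<^sub>v u) + R *\<^sub>v (X2 *\<^sub>v u)) @\<^sub>v (- (Q *\<^sub>v (X1 *\<^sub>v u)) - mat_adjoint A *\<^sub>v (X2 *\<^sub>v u))
        = (X1 *\<^sub>v (L *\<^sub>v u)) @\<^sub>v (X2 *\<^sub>v (L *\<^sub>v u))"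
      using HP[of "u @\<^sub>v 0\<^sub>v n"] Pv[OF u] Bv[OF u] Pv[of "L *\<^sub>v u"] Hv[of "X1 *\<^sub>v u" "X2 *\<^sub>v u"] u bc pc by simp
    then show "A *\<^sub>v (X1 *\<^sub>v u) + R *\<^sub>v (X2 *\<^sub>v u) = X1 *\<^sub>v (L *\<^sub>v u)"
      "- (Q *\<^sub>v (X1 *\<^sub>v u)) - mat_adjoint A *\<^sub>v (X2 *\<^sub>v u) = X2 *\<^sub>v (L *\<^sub>v u)"
      using append_vec_eq[of "A *\<^sub>v (X1 *\<^sub>v u) + R *\<^sub>v (X2 *\<^sub>v u)" n "X1 *\<^sub>v (L *\<^sub>v u)"] A R u pc bc by auto
    assume 0: "X1 *\<^sub>v u = 0\<^sub>v n" "X2 *\<^sub>v u = 0\<^sub>v n"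
    \<comment> \<open>Joint injectivity of \<open>X1\<close> and \<open>X2\<close> is invertibility
      of \<open>P\<close> on vectors supported in the first block.\<close>
    have "u @\<^sub>v 0\<^sub>v n = (P' * P) *\<^sub>v (u @\<^sub>v 0\<^sub>v n)" unfolding w(2) using u by simp
    also have "\<dots> = P' *\<^sub>v (0\<^sub>v n @\<^sub>v 0\<^sub>v n)"
      using w u Pv[OF u] 0 by (subst vec_distribs(9)) auto
    also have "\<dots> = 0\<^sub>v n @\<^sub>v 0\<^sub>v n"
    proof -
      have "0\<^sub>v n @\<^sub>v 0\<^sub>v n = (0\<^sub>v (n+n) :: complex vec)" by (rule eq_vecI) auto
      then show ?thesis using w(7) vec_distribs(12)[of P' "n+n"] by simp
    qed
    finally show "u = 0\<^sub>v n" using append_vec_eq[OF u z] by blast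
  qed (use bc pc in auto)
qed

text \<open>The columns of \<open>X1\<close>, \<open>X2\<close> span the stable invariant subspace of the Hamiltonian matrix. That
  subspace is isotropic, so \<open>X1\<^sup>* X2\<close> is Hermitian, and it is a graph, so that \<open>P = X2 X1\<^sup>-\<^sup>1\<close> is defined.\<close>

lemma riccati_solution:
  fixes A R Q :: "complex mat"
  assumes A: "A \<in> carrier_mat n n" and R: "R \<in> carrier_mat n n" and Q: "Q \<in> carrier_mat n n"
    and Rh: "mat_adjoint R = R" and Qh: "mat_adjoint Q = Q"
    and Rdef: "\<And>x. x \<in> carrier_vec n \<Longrightarrow> ip (R *\<^sub>v x) x = 0 \<Longrightarrow> R *\<^sub>v x = 0\<^sub>v n"
    and stab: "\<And>p \<mu>. p \<in> carrier_vec n \<Longrightarrow> p \<noteq> 0\<^sub>v n \<Longrightarrow> R *\<^sub>v p = 0\<^sub>v n \<Longrightarrow> 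
        mat_adjoint A *\<^sub>v p = \<mu> \<cdot>\<^sub>v p \<Longrightarrow> Re \<mu> < 0"
    and noimag: "\<And>x p \<omega>. x \<in> carrier_vec n \<Longrightarrow> p \<in> carrier_vec n \<Longrightarrow>
        A *\<^sub>v x + R *\<^sub>v p = (\<i> * complex_of_real \<omega>) \<cdot>\<^sub>v x \<Longrightarrow>
        - (Q *\<^sub>v x) - mat_adjoint A *\<^sub>v p = (\<i> * complex_of_real \<omega>) \<cdot>\<^sub>v p \<Longrightarrow> x = 0\<^sub>v n \<and> p = 0\<^sub>v n"
  obtains P where "P \<in> carrier_mat n n" "mat_adjoint P = P"
    "\<And>x. x \<in> carrier_vec n \<Longrightarrow>
      mat_adjoint A *\<^sub>v (P *\<^sub>v x) + P *\<^sub>v (A *\<^sub>v x) + P *\<^sub>v (R *\<^sub>v (P *\<^sub>v x)) + Q *\<^sub>v x = 0\<^sub>v n"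
proof -
  obtain L X1 X2 where L: "L \<in> carrier_mat n n" "X1 \<in> carrier_mat n n" "X2 \<in> carrier_mat n n"
    "upper_triangular L" "\<And>i. i < n \<Longrightarrow> Re (L $$ (i,i)) < 0"
    and e1': "\<And>u. u \<in> carrier_vec n \<Longrightarrow> A *\<^sub>v (X1 *\<^sub>v u) + R *\<^sub>v (X2 *\<^sub>v u) = X1 *\<^sub>v (L *\<^sub>v u)"
    and e2': "\<And>u. u \<in> carrier_vec n \<Longrightarrow> - (Q *\<^sub>v (X1 *\<^sub>v u)) - mat_adjoint A *\<^sub>v (X2 *\<^sub>v u) = X2 *\<^sub>v (L *\<^sub>v u)"
    and inj: "\<And>u. u \<in> carrier_vec n \<Longrightarrow> X1 *\<^sub>v u = 0\<^sub>v n \<Longrightarrow> X2 *\<^sub>v u = 0\<^sub>v n \<Longrightarrow> u = 0\<^sub>v n"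
    apply (rule hamiltonian_stable_factor[OF A R Q Rh Qh])
    subgoal by (rule noimag)
    subgoal premises prems by (rule prems(1)[OF prems(2-5)]) (fact prems(6-9))+
    done
  note e1 = e1'[symmetric] and e2 = e2'[symmetric]
  have d[simp]: "dim_row A = n" "dim_col A = n" "dim_row R = n" "dim_col R = n" "dim_row Q = n" "dim_col Q = n"
    "dim_row L = n" "dim_col L = n" "dim_row X1 = n" "dim_col X1 = n" "dim_row X2 = n" "dim_col X2 = n"
    using A R Q L by auto
  have mvI: "M *\<^sub>v v \<in> carrier_vec n" if "dim_row M = n" for M :: "complex mat" and v
    using that by (intro carrier_vecI) auto
  let ?Y = "mat_adjoint X1 * X2 - mat_adjoint X2 * X1"
  have ipY: "ip (?Y *\<^sub>v u) v = ip (X2 *\<^sub>v u) (X1 *\<^sub>v v) - ip (X1 *\<^sub>v u) (X2 *\<^sub>v v)"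
    if "u \<in> carrier_vec n" "v \<in> carrier_vec n" for u v
    using that by (simp add: vec_distribs ip_simps ip_adjoint_right)
  have Rsym: "ip (R *\<^sub>v x) y = ip x (R *\<^sub>v y)" and Qsym: "ip (Q *\<^sub>v x) y = ip x (Q *\<^sub>v y)"
    if "x \<in> carrier_vec n" "y \<in> carrier_vec n" for x y
    using that ip_adjoint[of R y x] ip_adjoint[of Q y x] Rh Qh by simp_all
  \<comment> \<open>Isotropy of the subspace: the two invariance relations and the symmetry of
    \<open>R\<close> and \<open>Q\<close> give \<open>L\<^sup>* Y + Y L = 0\<close>.\<close>
  have "?Y = 0\<^sub>m n n"
  proof (rule sylvester_upper_triangular_zero[OF L(1) _ L(4,5)])
    fix u v :: "complex vec" assume u: "u \<in> carrier_vec n" and v: "v \<in> carrier_vec n"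
    note [simp] = carrier_vecD[OF u] carrier_vecD[OF v]
    have a: "ip (mat_adjoint A *\<^sub>v x) y = ip x (A *\<^sub>v y)" if "x \<in> carrier_vec n" "y \<in> carrier_vec n" for x y
      using that ip_adjoint_right[of A x y] by simp
    have b: "ip x (mat_adjoint A *\<^sub>v y) = ip (A *\<^sub>v x) y" if "x \<in> carrier_vec n" "y \<in> carrier_vec n" for x y
      using that ip_adjoint[of A y x] by simp
    show "ip (?Y *\<^sub>v (L *\<^sub>v u)) v + ip (?Y *\<^sub>v u) (L *\<^sub>v v) = 0"
      by (simp add: ipY mvI u v e1 e2 ip_simps a b Rsym Qsym)
  qed auto
  then have iso: "ip (X2 *\<^sub>v u) (X1 *\<^sub>v v) = ip (X1 *\<^sub>v u) (X2 *\<^sub>v v)"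
    if "u \<in> carrier_vec n" "v \<in> carrier_vec n" for u v
    using ipY[OF that] that by (simp add: vec_distribs ip_simps)
  have X1inj: "u = 0\<^sub>v n" if u: "u \<in> carrier_vec n" "X1 *\<^sub>v u = 0\<^sub>v n" for u
  proof (rule ccontr)
    assume nz: "u \<noteq> 0\<^sub>v n"
    \<comment> \<open>If \<open>X1 v = 0\<close>, isotropy applied to \<open>L v\<close> and
      \<open>v\<close> makes the form of \<open>R\<close> vanish at \<open>X2 v\<close>, and
      \<open>X1 L v\<close> equals \<open>R X2 v\<close>; hence the kernel of \<open>X1\<close> is
      invariant under \<open>L\<close>.\<close>
    have ker: "R *\<^sub>v (X2 *\<^sub>v v) = 0\<^sub>v n \<and> X1 *\<^sub>v (L *\<^sub>v v) = 0\<^sub>v n" if v: "v \<in> carrier_vec n" "X1 *\<^sub>v v = 0\<^sub>v n" for v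
    proof -
      have "ip (X1 *\<^sub>v (L *\<^sub>v v)) (X2 *\<^sub>v v) = ip (X2 *\<^sub>v (L *\<^sub>v v)) (X1 *\<^sub>v v)"
        using iso[of "L *\<^sub>v v" v] v(1) mvI by simp
      then have "ip (R *\<^sub>v (X2 *\<^sub>v v)) (X2 *\<^sub>v v) = 0"
        using v by (simp add: e1 ip_simps vec_distribs)
      then have "R *\<^sub>v (X2 *\<^sub>v v) = 0\<^sub>v n" using Rdef mvI by simp
      then show ?thesis using v by (simp add: e1 vec_distribs)
    qed
    obtain v i where v: "v \<in> carrier_vec n" "v \<noteq> 0\<^sub>v n" "X1 *\<^sub>v v = 0\<^sub>v n" "i < n" "L *\<^sub>v v = L $$ (i,i) \<cdot>\<^sub>v v"
      using upper_triangular_invariant_kernel_eigenvector[OF L(1,2,4) _ u(1) nz u(2)] ker by blast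
    note [simp] = carrier_vecD[OF v(1)]
    \<comment> \<open>On this kernel the \<open>Q\<close> term drops out, so \<open>X2 v\<close> is
      an eigenvector of \<open>A\<^sup>*\<close> in the kernel of \<open>R\<close> whose eigenvalue
      \<open>- L\<^sub>i\<^sub>i\<close> has positive real part, against
      \<open>stab\<close>.\<close>
    have "mat_adjoint A *\<^sub>v (X2 *\<^sub>v v) = (- L $$ (i,i)) \<cdot>\<^sub>v (X2 *\<^sub>v v)"
    proof -
      have "L $$ (i,i) \<cdot>\<^sub>v (X2 *\<^sub>v v) = - (Q *\<^sub>v (X1 *\<^sub>v v)) - mat_adjoint A *\<^sub>v (X2 *\<^sub>v v)"
        using e2[OF v(1)] v(5) by (simp add: vec_distribs)
      then show ?thesis by (auto simp: vec_eq_iff vec_distribs v(3) simp del: index_mult_mat_vec)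
    qed
    moreover have "X2 *\<^sub>v v \<noteq> 0\<^sub>v n" using inj v by blast
    ultimately have "Re (- L $$ (i,i)) < 0"
      using stab[of "X2 *\<^sub>v v" "- L $$ (i,i)"] ker[OF v(1,3)] mvI by simp
    with L(5)[OF v(4)] show False by simp
  qed
  then have "det X1 \<noteq> 0" using det_0_iff_vec_prod_zero[OF L(2)] by blast
  then obtain W where W: "W \<in> carrier_mat n n" "X1 * W = 1\<^sub>m n"
    using det_non_zero_imp_unit[OF L(2), of "()"] by (auto simp: Units_def ring_mat_simps)
  then have [simp]: "dim_row W = n" "dim_col W = n" by auto
  have XW: "X1 *\<^sub>v (W *\<^sub>v x) = x" if "x \<in> carrier_vec n" for x
    using W that by (simp flip: vec_distribs(9))
  have WX: "W *\<^sub>v (X1 *\<^sub>v x) = x" if x: "x \<in> carrier_vec n" for x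
  proof -
    have "X1 *\<^sub>v (W *\<^sub>v (X1 *\<^sub>v x) - x) = 0\<^sub>v n"
      using x XW[OF mvI[of X1 x]] by (simp add: vec_distribs minus_cancel_vec[of _ n] mvI)
    then have "W *\<^sub>v (X1 *\<^sub>v x) - x = 0\<^sub>v n" by (rule X1inj[rotated]) (use x mvI[of W] in auto)
    then show ?thesis using x by (auto simp: vec_eq_iff)
  qed
  define P where "P = X2 * W"
  have P: "P \<in> carrier_mat n n" by (rule carrier_matI) (simp_all add: P_def)
  have Pv: "P *\<^sub>v x = X2 *\<^sub>v (W *\<^sub>v x)" if "x \<in> carrier_vec n" for x
    using that by (simp add: P_def vec_distribs)
  have herm: "ip (P *\<^sub>v x) y = ip x (P *\<^sub>v y)" if "x \<in> carrier_vec n" "y \<in> carrier_vec n" for x y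
    using iso[of "W *\<^sub>v x" "W *\<^sub>v y"] that by (simp add: Pv XW mvI)
  show thesis
  proof (rule that[OF P])
    show "mat_adjoint P = P" by (rule mat_adjoint_eqI[OF P herm])
    fix x :: "complex vec" assume x: "x \<in> carrier_vec n"
    note [simp] = carrier_vecD[OF x] carrier_matD[OF P]
    \<comment> \<open>With \<open>u = W x\<close> the two block rows read
      \<open>A x + R P x = X1 L u\<close> and \<open>- Q x - A\<^sup>* P x = X2 L u\<close>, and
      \<open>P\<close> maps the first right side to the second.\<close>
    have "P *\<^sub>v (A *\<^sub>v x + R *\<^sub>v (P *\<^sub>v x)) = - (Q *\<^sub>v x) - mat_adjoint A *\<^sub>v (P *\<^sub>v x)"
      using e1[of "W *\<^sub>v x"] e2[of "W *\<^sub>v x"] WX[of "L *\<^sub>v (W *\<^sub>v x)"] Pv[of "X1 *\<^sub>v (L *\<^sub>v (W *\<^sub>v x))"] x mvI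
      by (simp add: XW Pv)
    then show "mat_adjoint A *\<^sub>v (P *\<^sub>v x) + P *\<^sub>v (A *\<^sub>v x) + P *\<^sub>v (R *\<^sub>v (P *\<^sub>v x)) + Q *\<^sub>v x = 0\<^sub>v n"
      by (simp add: vec_distribs, auto simp: vec_eq_iff algebra_simps simp del: index_mult_mat_vec)
  qed
qed

subsection \<open>Lyapunov functions\<close>

text \<open>Lyapunov's theorem in triangular coordinates, without the matrix exponential: pivots are
  eliminated one at a time, from the first index on. Each pivot is positive because the
  corresponding unit vector is an eigenvector of the remaining triangular block, and the Schur
  complement satisfies the same hypotheses on the smaller index set. Families over
  \<open>nat\<close> make passing to a trailing block a mere change of \<open>k\<close>.\<close>

lemma hermitian_form_pos_of_upper_triangular_stable:
  fixes P B :: "nat \<Rightarrow> nat \<Rightarrow> complex"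
  assumes "k \<le> n"
    and herm: "\<And>i j. P j i = cnj (P i j)"
    and ut: "\<And>i j. j < i \<Longrightarrow> i < n \<Longrightarrow> B i j = 0" and stab: "\<And>i. i < n \<Longrightarrow> Re (B i i) < 0"
    and neg: "\<And>y. \<exists>i\<in>{k..<n}. y i \<noteq> 0 \<Longrightarrow>
       Re (\<Sum>i\<in>{k..<n}. (\<Sum>j\<in>{k..<n}. P i j * y j) * cnj (\<Sum>j\<in>{k..<n}. B i j * y j)) < 0"
    and y: "\<exists>i\<in>{k..<n}. y i \<noteq> 0"
  shows "Re (\<Sum>i\<in>{k..<n}. (\<Sum>j\<in>{k..<n}. P i j * y j) * cnj (y i)) > 0"
  using assms(1) herm neg y
proof (induction k arbitrary: P y rule: inc_induct)
  case base
  from base.prems(3) show ?case by simp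
next
  case (step k P y)
  define I where "I = {Suc k..<n}"
  have I: "{k..<n} = insert k I" "finite I" "k \<notin> I" using step.hyps by (auto simp: I_def)
  have Ik: "i \<in> I \<Longrightarrow> B i k = 0" for i using ut[of k i] by (auto simp: I_def)
  note herm = step.prems(1)
  have Pk: "P k k = of_real (Re (P k k))" using herm[of k k] by (simp add: complex_eq_iff)
  define p where "p = Re (P k k)"
  have Pkp: "P k k = of_real p" using Pk by (simp add: p_def)
  \<comment> \<open>The unit vector \<open>e\<close> is an eigenvector of the truncated
    \<open>B\<close>, whose column \<open>k\<close> vanishes below the diagonal; the strict
    inequality at \<open>e\<close> says that \<open>p\<close> times \<open>Re (B k k)\<close> is
    negative.\<close>
  have "p > 0"
  proof -
    define e :: "nat \<Rightarrow> complex" where "e i = (if i = k then 1 else 0)" for i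
    have e: "e k = 1" "\<And>i. i \<in> I \<Longrightarrow> e i = 0" using I(3) by (auto simp: e_def)
    have es: "(\<Sum>j\<in>insert k I. f j * e j) = f k" for f
      using I e by simp
    have "Re (\<Sum>i\<in>insert k I. (\<Sum>j\<in>insert k I. P i j * e j) * cnj (\<Sum>j\<in>insert k I. B i j * e j)) < 0"
      using step.prems(2)[of e] e(1) unfolding I(1) by simp
    then have "Re (P k k * cnj (B k k)) < 0"
      unfolding es using I Ik by simp
    then show ?thesis using stab[OF step.hyps(2)] unfolding Pkp by (simp add: mult_less_0_iff)
  qed
  \<comment> \<open>Schur complement of the pivot \<open>p\<close>.\<close>
  define P' where "P' i j = P i j - P i k * P k j / of_real p" for i j
  define c where "c y = (\<Sum>j\<in>I. P k j * y j)" for y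
  have P'sum: "(\<Sum>j\<in>I. P' i j * y j) = (\<Sum>j\<in>I. P i j * y j) - P i k * c y / of_real p" for i y
  proof -
    have "(\<Sum>j\<in>I. P' i j * y j) = (\<Sum>j\<in>I. P i j * y j - P i k / of_real p * (P k j * y j))"
      by (intro sum.cong refl) (simp add: P'_def left_diff_distrib)
    then show ?thesis unfolding sum_subtractf sum_distrib_left[symmetric] c_def by simp
  qed
  have cn: "(\<Sum>i\<in>I. P i k * cnj (y i)) = cnj (c y)" for y
    unfolding c_def cnj_sum complex_cnj_mult by (intro sum.cong refl) (simp only: herm[where i = k])
  have pos: "Re (\<Sum>i\<in>I. (\<Sum>j\<in>I. P' i j * y j) * cnj (y i)) > 0" if "\<exists>i\<in>I. y i \<noteq> 0" for y
    unfolding I_def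
  proof (rule step.IH[of P' y])
    show "P' j i = cnj (P' i j)" for i j using herm[of i j] herm[of k j] herm[of i k] by (simp add: P'_def)
    show "\<exists>i\<in>{Suc k..<n}. y i \<noteq> 0" using that by (simp add: I_def)
    fix y :: "nat \<Rightarrow> complex" assume ny: "\<exists>i\<in>{Suc k..<n}. y i \<noteq> 0"
    \<comment> \<open>The component \<open>k\<close> is chosen to annihilate row \<open>k\<close> of
      \<open>P z\<close>. Then the form of \<open>P\<close> at \<open>z\<close> against
      \<open>B z\<close> is that of \<open>P'\<close> at \<open>y\<close> against
      \<open>B y\<close>, so the hypothesis descends.\<close>
    define z where "z = y(k := - c y / of_real p)"
    have zI: "z i = y i" if "i \<in> I" for i using that I by (auto simp: z_def)
    have zs: "(\<Sum>j\<in>I. f j * z j) = (\<Sum>j\<in>I. f j * y j)" for f using zI by (auto intro!: sum.cong)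
    have Pz: "(\<Sum>j\<in>insert k I. P i j * z j) = (\<Sum>j\<in>I. P' i j * y j)" for i
    proof -
      have "(\<Sum>j\<in>insert k I. P i j * z j) = P i k * z k + (\<Sum>j\<in>I. P i j * y j)"
        using I by (simp add: zs)
      then show ?thesis by (simp add: P'sum z_def)
    qed
    have Pzk: "(\<Sum>j\<in>insert k I. P k j * z j) = 0"
      using I \<open>p > 0\<close> by (simp add: zs Pkp c_def[symmetric]) (simp add: z_def)
    have Bz: "(\<Sum>j\<in>insert k I. B i j * z j) = (\<Sum>j\<in>I. B i j * y j)" if "i \<in> I" for i
      using I Ik[OF that] by (simp add: zs)
    have "\<exists>i\<in>{k..<n}. z i \<noteq> 0" using ny zI by (auto simp: I I_def)
    from step.prems(2)[OF this]
    have "Re (\<Sum>i\<in>insert k I. (\<Sum>j\<in>insert k I. P i j * z j) * cnj (\<Sum>j\<in>insert k I. B i j * z j)) < 0"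
      by (simp only: I)
    also have "(\<Sum>i\<in>insert k I. (\<Sum>j\<in>insert k I. P i j * z j) * cnj (\<Sum>j\<in>insert k I. B i j * z j))
       = (\<Sum>i\<in>I. (\<Sum>j\<in>insert k I. P i j * z j) * cnj (\<Sum>j\<in>insert k I. B i j * z j))"
      using sum.insert[OF I(2,3), of "\<lambda>i. (\<Sum>j\<in>insert k I. P i j * z j) * cnj (\<Sum>j\<in>insert k I. B i j * z j)"]
      unfolding Pzk by simp
    also have "\<dots> = (\<Sum>i\<in>I. (\<Sum>j\<in>I. P' i j * y j) * cnj (\<Sum>j\<in>I. B i j * y j))"
      by (intro sum.cong refl) (simp only: Pz Bz)
    finally show "Re (\<Sum>i\<in>{Suc k..<n}. (\<Sum>j\<in>{Suc k..<n}. P' i j * y j) * cnj (\<Sum>j\<in>{Suc k..<n}. B i j * y j)) < 0"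
      by (simp only: I_def)
  qed
  have "(\<Sum>i\<in>I. (P i k * y k + (\<Sum>j\<in>I. P i j * y j)) * cnj (y i))
      = (\<Sum>i\<in>I. P i k * cnj (y i)) * y k + (\<Sum>i\<in>I. (\<Sum>j\<in>I. P i j * y j) * cnj (y i))"
    by (simp add: algebra_simps sum.distrib sum_distrib_left sum_distrib_right)
  moreover have "(\<Sum>i\<in>I. (\<Sum>j\<in>I. P' i j * y j) * cnj (y i))
      = (\<Sum>i\<in>I. (\<Sum>j\<in>I. P i j * y j) * cnj (y i)) - (\<Sum>i\<in>I. P i k * cnj (y i)) * (c y / of_real p)"
  proof -
    have "(\<Sum>i\<in>I. (\<Sum>j\<in>I. P' i j * y j) * cnj (y i))
       = (\<Sum>i\<in>I. (\<Sum>j\<in>I. P i j * y j) * cnj (y i) - P i k * cnj (y i) * (c y / of_real p))"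
      unfolding P'sum by (intro sum.cong refl) (simp add: left_diff_distrib)
    then show ?thesis unfolding sum_subtractf sum_distrib_right .
  qed
  \<comment> \<open>Completing the square in \<open>y k\<close>: the form of \<open>P\<close> is a
    nonnegative square over \<open>p\<close> plus the form of \<open>P'\<close>.\<close>
  ultimately have "(\<Sum>i\<in>insert k I. (\<Sum>j\<in>insert k I. P i j * y j) * cnj (y i))
    = (of_real p * y k + c y) * cnj (y k) + cnj (c y) * y k + cnj (c y) * (c y / of_real p)
       + (\<Sum>i\<in>I. (\<Sum>j\<in>I. P' i j * y j) * cnj (y i))"
    using I by (simp add: Pkp c_def[symmetric] cn)
  also have "(of_real p * y k + c y) * cnj (y k) + cnj (c y) * y k + cnj (c y) * (c y / of_real p)
    = (of_real p * y k + c y) * cnj (of_real p * y k + c y) / of_real p"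
    using \<open>p > 0\<close> by (simp add: field_simps)
  also have "\<dots> = of_real ((cmod (of_real p * y k + c y))\<^sup>2 / p)"
    by (simp only: complex_norm_square[symmetric] of_real_divide of_real_power)
  finally have eq: "Re (\<Sum>i\<in>insert k I. (\<Sum>j\<in>insert k I. P i j * y j) * cnj (y i))
     = (cmod (of_real p * y k + c y))\<^sup>2 / p + Re (\<Sum>i\<in>I. (\<Sum>j\<in>I. P' i j * y j) * cnj (y i))" by simp
  show ?case
  proof (cases "\<exists>i\<in>I. y i \<noteq> 0")
    case True
    have "(cmod (of_real p * y k + c y))\<^sup>2 / p \<ge> 0" using \<open>p > 0\<close> by simp
    then show ?thesis using pos[OF True] eq unfolding I(1) by linarith
  next
    case False
    then have "y k \<noteq> 0" "c y = 0" using step.prems(3) I by (auto simp: c_def)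
    moreover have "Re (\<Sum>i\<in>I. (\<Sum>j\<in>I. P' i j * y j) * cnj (y i)) = 0" using False by simp
    ultimately show ?thesis using eq \<open>p > 0\<close> unfolding I(1) by (simp add: norm_mult)
  qed
qed

text \<open>A Schur similarity makes the dynamics triangular and carries the form along by
  congruence, which preserves both the sign condition and positivity.\<close>

lemma lyapunov_pos:
  fixes A P :: "complex mat"
  assumes A: "A \<in> carrier_mat n n" and P: "P \<in> carrier_mat n n" and herm: "mat_adjoint P = P"
    and stab: "\<And>s. eigenvalue A s \<Longrightarrow> Re s < 0"
    and neg: "\<And>x. x \<in> carrier_vec n \<Longrightarrow> x \<noteq> 0\<^sub>v n \<Longrightarrow> Re (ip (P *\<^sub>v x) (A *\<^sub>v x)) < 0"
    and x: "x \<in> carrier_vec n" "x \<noteq> 0\<^sub>v n"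
  shows "Re (ip (P *\<^sub>v x) x) > 0"
proof -
  obtain es where es: "char_poly A = (\<Prod>e\<leftarrow>es. [:- e, 1:])" "length es = n"
    using char_poly_factorized[OF A] by blast
  obtain B S T where "schur_decomposition A es = (B,S,T)" by (metis prod_cases3)
  from schur_decomposition[OF A es(1) this] have sim: "similar_mat_wit A B S T"
    and ut: "upper_triangular B" and dg: "diag_mat B = es" by auto
  note w = similar_mat_witD2[OF A sim]
  have d[simp]: "dim_row A = n" "dim_col A = n" "dim_row P = n" "dim_col P = n"
    "dim_row B = n" "dim_col B = n" "dim_row S = n" "dim_col S = n" "dim_row T = n" "dim_col T = n"
    using w A P by auto
  define Q where "Q = mat_adjoint S * (P * S)"
  have Qd[simp]: "dim_row Q = n" "dim_col Q = n" by (simp_all add: Q_def)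
  have "mat_adjoint Q = Q"
    unfolding Q_def using herm assoc_mult_mat[of "mat_adjoint S" n n P n S n] w P by (simp add: mat_adjoint_mult)
  then have Qh: "Q $$ (j,i) = cnj (Q $$ (i,j))" if "i < n" "j < n" for i j
    using mat_adjoint_index[of j Q i] that by simp
  have AS: "A *\<^sub>v (S *\<^sub>v u) = S *\<^sub>v (B *\<^sub>v u)" if "u \<in> carrier_vec n" for u
  proof -
    have "A *\<^sub>v (S *\<^sub>v u) = S *\<^sub>v (B *\<^sub>v ((T * S) *\<^sub>v u))"
      unfolding w(3) using that by (simp add: vec_distribs del: w(2) assoc_mult_mat_vec)
    then show ?thesis using w that by simp
  qed
  have Qf: "ip (Q *\<^sub>v u) v = ip (P *\<^sub>v (S *\<^sub>v u)) (S *\<^sub>v v)" if "u \<in> carrier_vec n" "v \<in> carrier_vec n" for u v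
    using that by (simp add: Q_def vec_distribs ip_adjoint_right)
  define u where "u = T *\<^sub>v x"
  have u: "u \<in> carrier_vec n" using w(7) x by (simp add: u_def)
  have xu: "x = S *\<^sub>v u" using x w by (simp add: u_def flip: vec_distribs(9))
  have sinj: "S *\<^sub>v v \<noteq> 0\<^sub>v n" if v: "v \<in> carrier_vec n" "v \<noteq> 0\<^sub>v n" for v
  proof
    assume "S *\<^sub>v v = 0\<^sub>v n"
    then have "(T * S) *\<^sub>v v = 0\<^sub>v n" using v by (simp add: vec_distribs)
    then show False using v w by simp
  qed
  let ?v = "\<lambda>y. vec n y :: complex vec"
  \<comment> \<open>Entries outside the matrix are set to 0, because the symmetry is demanded for
    all pairs of natural numbers.\<close>
  have "Re (\<Sum>i\<in>{0..<n}. (\<Sum>j\<in>{0..<n}. (if i < n \<and> j < n then Q $$ (i,j) else 0) * u $ j) * cnj (u $ i)) > 0"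
  proof (rule hermitian_form_pos_of_upper_triangular_stable[where B = "\<lambda>i j. B $$ (i,j)"])
    show "(if j < n \<and> i < n then Q $$ (j, i) else 0) = cnj (if i < n \<and> j < n then Q $$ (i, j) else 0)" for i j
      using Qh[of j i] by auto
    show "B $$ (i,j) = 0" if "j < i" "i < n" for i j using ut that by (auto simp: upper_triangular_def)
    show "Re (B $$ (i,i)) < 0" if "i < n" for i
    proof (rule stab)
      have "B $$ (i,i) \<in> set es" using that dg[symmetric] by (auto simp: diag_mat_def)
      then show "eigenvalue A (B $$ (i,i))"
        unfolding eigenvalue_root_char_poly[OF A] es by (auto simp: poly_prod_list prod_list_zero_iff)
    qed
    show "\<exists>i\<in>{0..<n}. u $ i \<noteq> 0"
    proof (rule ccontr)
      assume "\<not> ?thesis"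
      then have "u = 0\<^sub>v n" using u by (intro eq_vecI) auto
      then show False using x xu by (simp add: vec_distribs)
    qed
    fix y :: "nat \<Rightarrow> complex" assume ny: "\<exists>i\<in>{0..<n}. y i \<noteq> 0"
    then have "?v y \<noteq> 0\<^sub>v n" by (auto simp: vec_eq_iff)
    then have "Re (ip (Q *\<^sub>v ?v y) (B *\<^sub>v ?v y)) < 0"
      using neg[of "S *\<^sub>v ?v y"] sinj[of "?v y"] w(6) w(5) by (simp add: Qf AS)
    then show "Re (\<Sum>i\<in>{0..<n}. (\<Sum>j\<in>{0..<n}. (if i < n \<and> j < n then Q $$ (i,j) else 0) * y j)
       * cnj (\<Sum>j\<in>{0..<n}. B $$ (i,j) * y j)) < 0"
      by (simp add: ip_def mult_vec_index atLeast0LessThan del: index_mult_mat_vec cnj_sum)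
  qed auto
  then have "Re (ip (Q *\<^sub>v u) u) > 0"
    using u by (simp add: ip_def mult_vec_index atLeast0LessThan del: index_mult_mat_vec)
  then show ?thesis using Qf[OF u u] xu by simp
qed

lemma eigenvalueI:
  "A \<in> carrier_mat n n \<Longrightarrow> x \<in> carrier_vec n \<Longrightarrow> x \<noteq> 0\<^sub>v n \<Longrightarrow> A *\<^sub>v x = s \<cdot>\<^sub>v x \<Longrightarrow> eigenvalue A s"
  by (auto simp: eigenvalue_def eigenvector_def)

lemma adjoint_eigenvalue:
  fixes A :: "complex mat"
  assumes A: "A \<in> carrier_mat n n" and p: "p \<in> carrier_vec n" "p \<noteq> 0\<^sub>v n"
    and ev: "mat_adjoint A *\<^sub>v p = \<mu> \<cdot>\<^sub>v p"
  shows "eigenvalue A (cnj \<mu>)"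
proof -
  obtain es where es: "char_poly A = (\<Prod>e\<leftarrow>es. [:- e, 1:])"
    using char_poly_factorized[OF A] by blast
  have A': "- mat_adjoint A \<in> carrier_mat n n" using A by simp
  have "- mat_adjoint A *\<^sub>v p = (- \<mu>) \<cdot>\<^sub>v p"
    using A p ev by (auto simp: vec_distribs vec_eq_iff simp del: index_mult_mat_vec)
  from eigenvalueI[OF A' p this] have "poly (char_poly (- mat_adjoint A)) (- \<mu>) = 0"
    using eigenvalue_root_char_poly[OF A'] by simp
  then obtain e where "e \<in> set es" "- \<mu> + cnj e = 0"
    unfolding char_poly_neg_adjoint[OF A es] by (auto simp: poly_prod_list prod_list_zero_iff)
  then have "cnj \<mu> \<in> set es" by (metis add.inverse_inverse complex_cnj_cnj eq_neg_iff_add_eq_0 neg_eq_iff_add_eq_0 add.commute)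
  then show ?thesis
    unfolding eigenvalue_root_char_poly[OF A] es by (auto simp: poly_prod_list prod_list_zero_iff)
qed

section \<open>Quadratic estimates, the Lyapunov equation and the resolvent\<close>

lemma nsq_add: "dim_vec u = dim_vec v \<Longrightarrow> nsq (u + v) = nsq u + nsq v + 2 * Re (ip u v)"
proof -
  assume d: "dim_vec u = dim_vec v"
  have "complex_of_real (nsq (u + v)) = of_real (nsq u) + of_real (nsq v) + ip u v + ip v u"
    using d by (simp add: ip_self_nsq[symmetric] ip_simps)
  then have "Re (complex_of_real (nsq (u + v))) = Re (of_real (nsq u) + of_real (nsq v) + ip u v + ip v u)" by simp
  then show ?thesis using ip_commute[OF d] by simp
qed

lemma nsq_smult: "nsq (c \<cdot>\<^sub>v v) = (cmod c)\<^sup>2 * nsq v"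
  by (simp add: nsq_def norm_mult power_mult_distrib sum_distrib_left)

lemma nsq_uminus: "nsq (- v) = nsq v"
  by (simp add: nsq_def)

lemma two_Re_ip_le:
  assumes d: "dim_vec u = dim_vec v" and t: "t > 0"
  shows "2 * Re (ip u v) \<le> t * nsq u + nsq v / t"
proof -
  have "0 \<le> nsq (of_real t \<cdot>\<^sub>v u + - v)" by simp
  also have "\<dots> = t\<^sup>2 * nsq u + nsq v - 2 * t * Re (ip u v)"
    using d by (simp add: nsq_add nsq_smult nsq_uminus ip_simps)
  finally have "t * (2 * Re (ip u v)) \<le> t * (t * nsq u + nsq v / t)"
    using t by (simp add: power2_eq_square algebra_simps)
  then show ?thesis using t by simp
qed

lemma nsq_add_le:
  assumes "dim_vec u = dim_vec v" "t > 0"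
  shows "nsq (u + v) \<le> (1 + t) * nsq u + (1 + 1 / t) * nsq v"
  using two_Re_ip_le[OF assms] nsq_add[OF assms(1)] by (simp add: algebra_simps)

lemma mult_mat_vec_bounded:
  fixes M :: "complex mat"
  obtains c where "c \<ge> 0" "\<And>v. dim_vec v = dim_col M \<Longrightarrow> nsq (M *\<^sub>v v) \<le> c * nsq v"
proof
  define c where "c = (\<Sum>i<dim_row M. (\<Sum>j<dim_col M. cmod (M $$ (i,j)))\<^sup>2)"
  show "c \<ge> 0" by (auto simp: c_def intro: sum_nonneg)
  fix v :: "complex vec" assume d: "dim_vec v = dim_col M"
  have "nsq (M *\<^sub>v v) = (\<Sum>i<dim_row M. (cmod (\<Sum>j<dim_col M. M $$ (i,j) * v $ j))\<^sup>2)"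
    using d by (simp add: nsq_def mult_vec_index del: index_mult_mat_vec)
  also have "\<dots> \<le> (\<Sum>i<dim_row M. (\<Sum>j<dim_col M. cmod (M $$ (i,j)))\<^sup>2 * nsq v)"
  proof (rule sum_mono)
    fix i
    have "cmod (v $ j) \<le> sqrt (nsq v)" if "j < dim_col M" for j
      using d that unfolding nsq_def by (intro real_le_rsqrt member_le_sum) auto
    then have "cmod (\<Sum>j<dim_col M. M $$ (i,j) * v $ j) \<le> (\<Sum>j<dim_col M. cmod (M $$ (i,j)) * sqrt (nsq v))"
      by (intro order.trans[OF norm_sum] sum_mono) (auto simp: norm_mult intro: mult_left_mono)
    then have "(cmod (\<Sum>j<dim_col M. M $$ (i,j) * v $ j))\<^sup>2 \<le> ((\<Sum>j<dim_col M. cmod (M $$ (i,j))) * sqrt (nsq v))\<^sup>2"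
      by (intro power_mono) (auto simp: sum_distrib_right)
    then show "(cmod (\<Sum>j<dim_col M. M $$ (i,j) * v $ j))\<^sup>2 \<le> (\<Sum>j<dim_col M. cmod (M $$ (i,j)))\<^sup>2 * nsq v"
      by (simp add: power_mult_distrib)
  qed
  finally show "nsq (M *\<^sub>v v) \<le> c * nsq v" by (simp add: c_def sum_distrib_right)
qed

text \<open>The Riccati equation with \<open>R = 0\<close> and \<open>Q = I\<close>. Its Hamiltonian
  matrix is block triangular with the spectra of \<open>A\<close> and \<open>- A\<^sup>*\<close>, so
  stability keeps the imaginary axis free; pairing the solved equation with \<open>x\<close> gives
  the stated identity.\<close>

lemma lyapunov_equation:
  fixes A :: "complex mat"
  assumes A: "A \<in> carrier_mat n n" and stab: "\<And>s. eigenvalue A s \<Longrightarrow> Re s < 0"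
  obtains P where "P \<in> carrier_mat n n" "mat_adjoint P = P"
    "\<And>x. x \<in> carrier_vec n \<Longrightarrow> 2 * Re (ip (P *\<^sub>v x) (A *\<^sub>v x)) = - nsq x"
proof (rule riccati_solution[OF A, of "0\<^sub>m n n" "1\<^sub>m n"])
  note [simp] = carrier_matD[OF A]
  have adj: "Re \<mu> < 0" if "p \<in> carrier_vec n" "p \<noteq> 0\<^sub>v n" "mat_adjoint A *\<^sub>v p = \<mu> \<cdot>\<^sub>v p" for p \<mu>
    using stab[OF adjoint_eigenvalue[OF A that]] by simp
  show "Re \<mu> < 0" if "p \<in> carrier_vec n" "p \<noteq> 0\<^sub>v n" "mat_adjoint A *\<^sub>v p = \<mu> \<cdot>\<^sub>v p" for p \<mu>
    using adj that by blast
  fix x p :: "complex vec" and \<omega> :: real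
  assume x: "x \<in> carrier_vec n" and p: "p \<in> carrier_vec n"
    and e: "A *\<^sub>v x + 0\<^sub>m n n *\<^sub>v p = (\<i> * complex_of_real \<omega>) \<cdot>\<^sub>v x"
     "- (1\<^sub>m n *\<^sub>v x) - mat_adjoint A *\<^sub>v p = (\<i> * complex_of_real \<omega>) \<cdot>\<^sub>v p"
  note [simp] = carrier_vecD[OF x] carrier_vecD[OF p]
  have "A *\<^sub>v x = (\<i> * complex_of_real \<omega>) \<cdot>\<^sub>v x"
    using e(1) by (auto simp: vec_distribs vec_eq_iff simp del: index_mult_mat_vec)
  then have x0: "x = 0\<^sub>v n" using stab eigenvalueI[OF A x] by fastforce
  have "mat_adjoint A *\<^sub>v p = (- (\<i> * complex_of_real \<omega>)) \<cdot>\<^sub>v p"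
  proof (rule eq_vecI)
    fix i assume "i < dim_vec ((- (\<i> * complex_of_real \<omega>)) \<cdot>\<^sub>v p)"
    then have "- (mat_adjoint A *\<^sub>v p) $ i = \<i> * complex_of_real \<omega> * p $ i"
      using e(2) unfolding x0 by (auto simp: vec_distribs vec_eq_iff simp del: index_mult_mat_vec)
    then have "(mat_adjoint A *\<^sub>v p) $ i = - (\<i> * complex_of_real \<omega> * p $ i)"
      by (simp only: minus_equation_iff[of "(mat_adjoint A *\<^sub>v p) $ i"] eq_commute)
    then show "(mat_adjoint A *\<^sub>v p) $ i = ((- (\<i> * complex_of_real \<omega>)) \<cdot>\<^sub>v p) $ i"
      using \<open>i < _\<close> by (simp del: index_mult_mat_vec)
  qed simp
  then have "p = 0\<^sub>v n" using adj[OF p] by fastforce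
  with x0 show "x = 0\<^sub>v n \<and> p = 0\<^sub>v n" by simp
next
  note [simp] = carrier_matD[OF A]
  fix P assume P: "P \<in> carrier_mat n n" "mat_adjoint P = P"
    and eq: "\<And>x. x \<in> carrier_vec n \<Longrightarrow> mat_adjoint A *\<^sub>v (P *\<^sub>v x) + P *\<^sub>v (A *\<^sub>v x) +
       P *\<^sub>v (0\<^sub>m n n *\<^sub>v (P *\<^sub>v x)) + 1\<^sub>m n *\<^sub>v x = 0\<^sub>v n"
  show thesis
  proof (rule that[OF P])
    fix x :: "complex vec" assume x: "x \<in> carrier_vec n"
    note [simp] = carrier_vecD[OF x] carrier_matD[OF P(1)]
    have "ip (mat_adjoint A *\<^sub>v (P *\<^sub>v x) + P *\<^sub>v (A *\<^sub>v x) + P *\<^sub>v (0\<^sub>m n n *\<^sub>v (P *\<^sub>v x)) + 1\<^sub>m n *\<^sub>v x) x = 0"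
      by (subst eq[OF x]) (simp add: ip_simps)
    moreover have "ip (mat_adjoint A *\<^sub>v (P *\<^sub>v x)) x = ip (P *\<^sub>v x) (A *\<^sub>v x)"
      by (simp add: ip_adjoint_right)
    moreover have "ip (P *\<^sub>v (A *\<^sub>v x)) x = cnj (ip (P *\<^sub>v x) (A *\<^sub>v x))"
      using ip_adjoint[of P x "A *\<^sub>v x"] ip_commute[of "P *\<^sub>v x" "A *\<^sub>v x"] P by simp
    ultimately have "ip (P *\<^sub>v x) (A *\<^sub>v x) + cnj (ip (P *\<^sub>v x) (A *\<^sub>v x)) + of_real (nsq x) = 0"
      by (simp add: vec_distribs ip_simps ip_self_nsq)
    then have "Re (ip (P *\<^sub>v x) (A *\<^sub>v x) + cnj (ip (P *\<^sub>v x) (A *\<^sub>v x)) + of_real (nsq x)) = 0" by simp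
    then show "2 * Re (ip (P *\<^sub>v x) (A *\<^sub>v x)) = - nsq x" by simp
  qed
qed (auto simp: vec_distribs ip_simps)

lemma resolvent_exists:
  fixes A :: "complex mat"
  assumes A: "A \<in> carrier_mat n n" and s: "\<not> eigenvalue A s" and b: "b \<in> carrier_vec n"
  obtains x where "x \<in> carrier_vec n" "s \<cdot>\<^sub>v x = A *\<^sub>v x + b"
proof -
  note [simp] = carrier_matD[OF A] carrier_vecD[OF b]
  let ?M = "s \<cdot>\<^sub>m 1\<^sub>m n - A"
  have M: "?M \<in> carrier_mat n n" by (rule minus_carrier_mat[OF A])
  have Mv: "?M *\<^sub>v x = s \<cdot>\<^sub>v x - A *\<^sub>v x" if "x \<in> carrier_vec n" for x
    using that by (simp add: vec_distribs)
  have "det ?M \<noteq> 0"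
  proof
    assume "det ?M = 0"
    then obtain v where v: "v \<in> carrier_vec n" "v \<noteq> 0\<^sub>v n" "?M *\<^sub>v v = 0\<^sub>v n"
      using det_0_iff_vec_prod_zero[OF M] by blast
    then have "A *\<^sub>v v = s \<cdot>\<^sub>v v" by (auto simp: Mv vec_eq_iff simp del: index_mult_mat_vec)
    with s eigenvalueI[OF A v(1,2)] show False by blast
  qed
  then obtain W where W: "W \<in> carrier_mat n n" "?M * W = 1\<^sub>m n"
    using det_non_zero_imp_unit[OF M, of "()"] by (auto simp: Units_def ring_mat_simps)
  have Wb: "W *\<^sub>v b \<in> carrier_vec n" using W b by simp
  have "?M *\<^sub>v (W *\<^sub>v b) = b" using W b by (simp flip: vec_distribs(9))
  then have "s \<cdot>\<^sub>v (W *\<^sub>v b) = A *\<^sub>v (W *\<^sub>v b) + b"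
    using Wb W unfolding Mv[OF Wb] by (auto simp: vec_eq_iff algebra_simps simp del: index_mult_mat_vec)
  with Wb that show thesis by blast
qed


text \<open>The Lyapunov equation bounds the resolvent on the imaginary axis uniformly in \<open>\<omega>\<close>, so the transfer
  function tends to \<open>D\<close> along it.\<close>

lemma feedthrough_bound:
  fixes A B C D :: "complex mat"
  assumes A: "A \<in> carrier_mat n n" and B: "B \<in> carrier_mat n m"
    and C: "C \<in> carrier_mat p n" and D: "D \<in> carrier_mat p m"
    and stab: "\<And>s. eigenvalue A s \<Longrightarrow> Re s < 0"
    and gain: "\<And>\<omega> x w. x \<in> carrier_vec n \<Longrightarrow> w \<in> carrier_vec m \<Longrightarrow>
       (\<i> * complex_of_real \<omega>) \<cdot>\<^sub>v x = A *\<^sub>v x + B *\<^sub>v w \<Longrightarrow> nsq (C *\<^sub>v x + D *\<^sub>v w) \<le> G * nsq w"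
    and w: "w \<in> carrier_vec m"
  shows "nsq (D *\<^sub>v w) \<le> G * nsq w"
proof -
  note [simp] = carrier_matD[OF A] carrier_matD[OF B] carrier_matD[OF C] carrier_matD[OF D] carrier_vecD[OF w]
  have Bw: "B *\<^sub>v w \<in> carrier_vec n" using B w by simp
  obtain P where P: "P \<in> carrier_mat n n" "mat_adjoint P = P"
    "\<And>x. x \<in> carrier_vec n \<Longrightarrow> 2 * Re (ip (P *\<^sub>v x) (A *\<^sub>v x)) = - nsq x"
    using lyapunov_equation[OF A stab] by metis
  note [simp] = carrier_matD[OF P(1)]
  obtain cA where cA: "\<And>v. dim_vec v = dim_col A \<Longrightarrow> nsq (A *\<^sub>v v) \<le> cA * nsq v" "cA \<ge> 0"
    using mult_mat_vec_bounded[of A] by metis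
  obtain cC where cC: "\<And>v. dim_vec v = dim_col C \<Longrightarrow> nsq (C *\<^sub>v v) \<le> cC * nsq v" "cC \<ge> 0"
    using mult_mat_vec_bounded[of C] by metis
  define b where "b = nsq (P *\<^sub>v (B *\<^sub>v w))"
  define K where "K = 2 * (cA * (4 * b)) + 2 * nsq (B *\<^sub>v w)"
  have bound: "nsq x \<le> 4 * b \<and> \<omega>\<^sup>2 * nsq x \<le> K"
    if x: "x \<in> carrier_vec n" and e: "(\<i> * complex_of_real \<omega>) \<cdot>\<^sub>v x = A *\<^sub>v x + B *\<^sub>v w" for x \<omega>
  proof -
    note [simp] = carrier_vecD[OF x]
    have "ip (P *\<^sub>v x) x = cnj (ip (P *\<^sub>v x) x)"
      using ip_adjoint[of P x x] ip_commute[of "P *\<^sub>v x" x] P by simp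
    then have "Im (ip (P *\<^sub>v x) x) = 0" by (simp add: complex_eq_iff)
    \<comment> \<open>The Hermitian form is real at \<open>x\<close>, so the frequency drops out and
      the first bound on \<open>x\<close> is uniform in \<open>\<omega>\<close>.\<close>
    then have "Re (ip (P *\<^sub>v x) ((\<i> * complex_of_real \<omega>) \<cdot>\<^sub>v x)) = 0" by (simp add: ip_simps)
    then have "Re (ip (P *\<^sub>v x) (A *\<^sub>v x)) + Re (ip (P *\<^sub>v x) (B *\<^sub>v w)) = 0"
      unfolding e by (simp add: ip_simps)
    then have "nsq x = 2 * Re (ip x (P *\<^sub>v (B *\<^sub>v w)))"
      using P(3)[OF x] ip_adjoint[of P "B *\<^sub>v w" x] P(2) by simp
    \<comment> \<open>The weight 1/2 lets half of \<open>nsq x\<close> be absorbed on the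
      left.\<close>
    also have "\<dots> \<le> 1/2 * nsq x + nsq (P *\<^sub>v (B *\<^sub>v w)) / (1/2)"
      by (rule two_Re_ip_le) auto
    finally have 1: "nsq x \<le> 4 * b" by (simp add: b_def)
    have "\<omega>\<^sup>2 * nsq x = nsq (A *\<^sub>v x + B *\<^sub>v w)"
      unfolding e[symmetric] by (simp add: nsq_smult norm_mult)
    also have "\<dots> \<le> (1 + 1) * nsq (A *\<^sub>v x) + (1 + 1 / 1) * nsq (B *\<^sub>v w)"
      by (rule nsq_add_le) auto
    also have "nsq (A *\<^sub>v x) \<le> cA * nsq x" using cA by simp
    also have "cA * nsq x \<le> cA * (4 * b)" using 1 cA(2) by (rule mult_left_mono)
    finally show ?thesis using 1 by (simp add: K_def)
  qed
  \<comment> \<open>The weight \<open>t\<close> splits off the state contribution, which at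
    frequency \<open>Suc k\<close> is of order \<open>1/k\<^sup>2\<close>. First \<open>k\<close>
    tends to infinity, then \<open>t\<close> to 0.\<close>
  have le: "nsq (D *\<^sub>v w) \<le> (1 + t) * (G * nsq w) + (1 + 1 / t) * (cC * K) / (real (Suc k))\<^sup>2"
    if t: "t > 0" for t k
  proof -
    let ?\<omega> = "real (Suc k)"
    have "\<not> eigenvalue A (\<i> * complex_of_real ?\<omega>)" using stab by fastforce
    then obtain x where x: "x \<in> carrier_vec n" "(\<i> * complex_of_real ?\<omega>) \<cdot>\<^sub>v x = A *\<^sub>v x + B *\<^sub>v w"
      using resolvent_exists[OF A _ Bw] by metis
    note [simp] = carrier_vecD[OF x(1)]
    have "D *\<^sub>v w = (C *\<^sub>v x + D *\<^sub>v w) + - (C *\<^sub>v x)"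
      by (auto simp: vec_eq_iff simp del: index_mult_mat_vec)
    then have "nsq (D *\<^sub>v w) \<le> (1 + t) * nsq (C *\<^sub>v x + D *\<^sub>v w) + (1 + 1 / t) * nsq (C *\<^sub>v x)"
      using nsq_add_le[of "C *\<^sub>v x + D *\<^sub>v w" "- (C *\<^sub>v x)" t] t by (simp add: nsq_uminus)
    also have "nsq (C *\<^sub>v x + D *\<^sub>v w) \<le> G * nsq w" by (rule gain[OF x(1) w x(2)])
    also have "nsq (C *\<^sub>v x) \<le> cC * nsq x" using cC by simp
    also have "nsq x \<le> K / ?\<omega>\<^sup>2" using bound[OF x] by (simp add: field_simps)
    finally show ?thesis using t cC(2) by (simp add: mult_left_mono)
  qed
  have le2: "nsq (D *\<^sub>v w) \<le> (1 + t) * (G * nsq w)" if t: "t > 0" for t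
  proof (rule LIMSEQ_le_const)
    have "(\<lambda>k. (1 + t) * (G * nsq w) + (1 + 1 / t) * (cC * K) * (inverse (real (Suc k)))\<^sup>2)
        \<longlonglongrightarrow> (1 + t) * (G * nsq w) + (1 + 1 / t) * (cC * K) * 0\<^sup>2"
      by (intro tendsto_intros LIMSEQ_inverse_real_of_nat)
    then show "(\<lambda>k. (1 + t) * (G * nsq w) + (1 + 1 / t) * (cC * K) / (real (Suc k))\<^sup>2) \<longlonglongrightarrow> (1 + t) * (G * nsq w)"
      by (simp add: field_simps power_inverse)
    show "\<exists>N. \<forall>k\<ge>N. nsq (D *\<^sub>v w) \<le> (1 + t) * (G * nsq w) + (1 + 1 / t) * (cC * K) / (real (Suc k))\<^sup>2"
      using le[OF t] by blast
  qed
  show ?thesis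
  proof (rule LIMSEQ_le_const)
    have "(\<lambda>k. (1 + inverse (real (Suc k))) * (G * nsq w)) \<longlonglongrightarrow> (1 + 0) * (G * nsq w)"
      by (intro tendsto_intros LIMSEQ_inverse_real_of_nat)
    then show "(\<lambda>k. (1 + inverse (real (Suc k))) * (G * nsq w)) \<longlonglongrightarrow> G * nsq w" by simp
    show "\<exists>N. \<forall>k\<ge>N. nsq (D *\<^sub>v w) \<le> (1 + inverse (real (Suc k))) * (G * nsq w)"
      using le2 by simp
  qed
qed

subsection \<open>The bounded real lemma\<close>

lemma hermitian_inverse:
  fixes M :: "complex mat"
  assumes M: "M \<in> carrier_mat m m" and h: "mat_adjoint M = M"
    and inj: "\<And>w. w \<in> carrier_vec m \<Longrightarrow> M *\<^sub>v w = 0\<^sub>v m \<Longrightarrow> w = 0\<^sub>v m"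
  obtains S where "S \<in> carrier_mat m m" "mat_adjoint S = S"
    "\<And>w. w \<in> carrier_vec m \<Longrightarrow> M *\<^sub>v (S *\<^sub>v w) = w" "\<And>w. w \<in> carrier_vec m \<Longrightarrow> S *\<^sub>v (M *\<^sub>v w) = w"
proof -
  have "det M \<noteq> 0" using det_0_iff_vec_prod_zero[OF M] inj by blast
  then obtain S where S: "S \<in> carrier_mat m m" "M * S = 1\<^sub>m m" "S * M = 1\<^sub>m m"
    using det_non_zero_imp_unit[OF M, of "()"] by (auto simp: Units_def ring_mat_simps)
  note [simp] = carrier_matD[OF M] carrier_matD[OF S(1)]
  have "mat_adjoint S * M = mat_adjoint (M * S)" by (simp add: mat_adjoint_mult h)
  then have 1: "mat_adjoint S * M = 1\<^sub>m m" by (simp add: S(2))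
  have "mat_adjoint S = mat_adjoint S * (M * S)" by (simp add: S(2) right_mult_one_mat[of _ m m])
  also have "\<dots> = mat_adjoint S * M * S"
    by (rule assoc_mult_mat[symmetric, of _ m m _ m _ m]) (use M S in auto)
  finally have "mat_adjoint S = S" using 1 S(1) by simp
  moreover have "M *\<^sub>v (S *\<^sub>v w) = w" "S *\<^sub>v (M *\<^sub>v w) = w" if "w \<in> carrier_vec m" for w
    using that S(2,3) by (simp_all flip: vec_distribs(9))
  ultimately show thesis using that S(1) by blast
qed

text \<open>An imaginary eigenvalue \<open>\<i>\<omega>\<close> of the Hamiltonian matrix would yield an input
  direction whose squared gain at frequency \<open>\<omega>\<close> is exactly \<open>G1\<close>.\<close>

lemma bounded_real_nonstrict:
  fixes A B C D :: "complex mat"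
  assumes A: "A \<in> carrier_mat n n" and B: "B \<in> carrier_mat n m"
    and C: "C \<in> carrier_mat p n" and D: "D \<in> carrier_mat p m"
    and stab: "\<And>s. eigenvalue A s \<Longrightarrow> Re s < 0"
    and gain: "\<And>\<omega> x w. x \<in> carrier_vec n \<Longrightarrow> w \<in> carrier_vec m \<Longrightarrow>
       (\<i> * complex_of_real \<omega>) \<cdot>\<^sub>v x = A *\<^sub>v x + B *\<^sub>v w \<Longrightarrow> nsq (C *\<^sub>v x + D *\<^sub>v w) \<le> G * nsq w"
    and G: "G < G1"
  obtains P where "P \<in> carrier_mat n n" "mat_adjoint P = P"
    "\<forall>x\<in>carrier_vec n. \<forall>w\<in>carrier_vec m.
      2 * Re (ip (P *\<^sub>v x) (A *\<^sub>v x + B *\<^sub>v w)) + nsq (C *\<^sub>v x + D *\<^sub>v w) - G1 * nsq w \<le> 0"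
proof -
  note dm[simp] = carrier_matD[OF A] carrier_matD[OF B] carrier_matD[OF C] carrier_matD[OF D]
  have vI: "v \<in> carrier_vec k" if "dim_vec v = k" for v :: "complex vec" and k using that by (rule carrier_vecI)
  \<comment> \<open>The margin at infinite frequency: by the feedthrough bound the form of
    \<open>M\<close> is at least \<open>G1 - G\<close> times \<open>nsq w\<close>, so
    \<open>M\<close> is invertible, with inverse \<open>S\<close>.\<close>
  define M where "M = of_real G1 \<cdot>\<^sub>m 1\<^sub>m m - mat_adjoint D * D"
  have M: "M \<in> carrier_mat m m" by (rule carrier_matI) (simp_all add: M_def)
  note [simp] = carrier_matD[OF M]
  have Mv: "M *\<^sub>v w = of_real G1 \<cdot>\<^sub>v w - mat_adjoint D *\<^sub>v (D *\<^sub>v w)" if "w \<in> carrier_vec m" for w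
    using that by (simp add: M_def vec_distribs)
  have Mform: "ip (M *\<^sub>v w) w = of_real (G1 * nsq w - nsq (D *\<^sub>v w))" if "w \<in> carrier_vec m" for w
    using that by (simp add: Mv ip_simps ip_self_nsq flip: ip_adjoint_right)
  have Mge: "(G1 - G) * nsq w \<le> Re (ip (M *\<^sub>v w) w)" if "w \<in> carrier_vec m" for w
    using feedthrough_bound[OF A B C D stab gain that] by (simp add: Mform[OF that] algebra_simps)
  have Minj: "w = 0\<^sub>v m" if w: "w \<in> carrier_vec m" "ip (M *\<^sub>v w) w = 0" for w
  proof -
    have "(G1 - G) * nsq w \<le> 0" using Mge[OF w(1)] w(2) by simp
    then have "nsq w = 0" using G nsq_ge0[of w] by (simp add: mult_le_0_iff)
    then show ?thesis using nsq_eq0[of w] w by simp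
  qed
  have Mh: "mat_adjoint M = M"
    unfolding M_def
    by (rule eq_matI) (auto simp: scalar_prod_def sum_conjugate conjugate_dist_mul mult.commute
        minus_mat_def intro!: sum.cong)
  obtain S where S: "S \<in> carrier_mat m m" "mat_adjoint S = S"
    and MS: "\<And>w. w \<in> carrier_vec m \<Longrightarrow> M *\<^sub>v (S *\<^sub>v w) = w"
    using hermitian_inverse[OF M Mh] Minj by (metis ip_simps(9) carrier_vecD)
  note [simp] = carrier_matD[OF S(1)]
  have Ssym: "ip (S *\<^sub>v a) b = ip a (S *\<^sub>v b)" if "a \<in> carrier_vec m" "b \<in> carrier_vec m" for a b
    using ip_adjoint[of S b a] S that by simp
  \<comment> \<open>Coefficients left after maximising the quadratic form over the input; the
    maximiser is \<open>S (B\<^sup>* p + D\<^sup>* C x)\<close> for the costate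
    \<open>p = P x\<close>.\<close>
  define AH where "AH = A + B * (S * (mat_adjoint D * C))"
  define R where "R = B * (S * mat_adjoint B)"
  define Q where "Q = mat_adjoint C * C + mat_adjoint C * (D * (S * (mat_adjoint D * C)))"
  have car: "AH \<in> carrier_mat n n" "R \<in> carrier_mat n n" "Q \<in> carrier_mat n n"
    by (auto intro!: carrier_matI simp: AH_def R_def Q_def)
  note [simp] = carrier_matD[OF car(1)] carrier_matD[OF car(2)] carrier_matD[OF car(3)]
  have AHv: "AH *\<^sub>v x = A *\<^sub>v x + B *\<^sub>v (S *\<^sub>v (mat_adjoint D *\<^sub>v (C *\<^sub>v x)))" if "x \<in> carrier_vec n" for x
    using that by (simp add: AH_def vec_distribs)
  have Rv: "R *\<^sub>v x = B *\<^sub>v (S *\<^sub>v (mat_adjoint B *\<^sub>v x))" if "x \<in> carrier_vec n" for x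
    using that by (simp add: R_def vec_distribs)
  have Qv: "Q *\<^sub>v x = mat_adjoint C *\<^sub>v (C *\<^sub>v x) + mat_adjoint C *\<^sub>v (D *\<^sub>v (S *\<^sub>v (mat_adjoint D *\<^sub>v (C *\<^sub>v x))))"
    if "x \<in> carrier_vec n" for x
    using that by (simp add: Q_def vec_distribs)
  have AHa: "mat_adjoint AH *\<^sub>v y = mat_adjoint A *\<^sub>v y + mat_adjoint C *\<^sub>v (D *\<^sub>v (S *\<^sub>v (mat_adjoint B *\<^sub>v y)))"
    if "y \<in> carrier_vec n" for y
    using that by (simp add: AH_def mat_adjoint_add mat_adjoint_mult vec_distribs S)
  have Rh: "mat_adjoint R = R"
  proof (rule mat_adjoint_eqI[OF car(2)])
    fix x y :: "complex vec" assume x: "x \<in> carrier_vec n" and y: "y \<in> carrier_vec n"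
    note [simp] = carrier_vecD[OF x] carrier_vecD[OF y]
    show "ip (R *\<^sub>v x) y = ip x (R *\<^sub>v y)" by (simp add: Rv[OF x] Rv[OF y] ip_adjoint S(2))
  qed
  have Qh: "mat_adjoint Q = Q"
  proof (rule mat_adjoint_eqI[OF car(3)])
    fix x y :: "complex vec" assume x: "x \<in> carrier_vec n" and y: "y \<in> carrier_vec n"
    note [simp] = carrier_vecD[OF x] carrier_vecD[OF y]
    show "ip (Q *\<^sub>v x) y = ip x (Q *\<^sub>v y)" by (simp add: Qv[OF x] Qv[OF y] ip_simps ip_adjoint S(2))
  qed
  have Bker: "mat_adjoint B *\<^sub>v x = 0\<^sub>v m" if x: "x \<in> carrier_vec n" "ip (R *\<^sub>v x) x = 0" for x
  proof -
    define y where "y = S *\<^sub>v (mat_adjoint B *\<^sub>v x)"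
    have y: "y \<in> carrier_vec m" by (simp add: y_def vI)
    have My: "M *\<^sub>v y = mat_adjoint B *\<^sub>v x" by (simp add: y_def MS vI)
    have "ip (R *\<^sub>v x) x = ip y (M *\<^sub>v y)"
      using x y unfolding My by (simp add: Rv y_def ip_adjoint)
    also have "\<dots> = cnj (ip (M *\<^sub>v y) y)" using y ip_commute[of "M *\<^sub>v y" y] by simp
    finally have "ip (M *\<^sub>v y) y = 0" using x(2) by simp
    then have "y = 0\<^sub>v m" using Minj y by blast
    with My show ?thesis by (simp add: vec_distribs)
  qed
  have adj: "Re \<mu> < 0" if "p \<in> carrier_vec n" "p \<noteq> 0\<^sub>v n" "mat_adjoint A *\<^sub>v p = \<mu> \<cdot>\<^sub>v p" for p \<mu>
    using stab[OF adjoint_eigenvalue[OF A that]] by simp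
  show thesis
  proof (rule riccati_solution[OF car Rh Qh])
    show "R *\<^sub>v x = 0\<^sub>v n" if "x \<in> carrier_vec n" "ip (R *\<^sub>v x) x = 0" for x
      using that Bker[OF that] by (simp add: Rv vec_distribs)
    show "Re \<mu> < 0" if q: "q \<in> carrier_vec n" "q \<noteq> 0\<^sub>v n" "R *\<^sub>v q = 0\<^sub>v n" "mat_adjoint AH *\<^sub>v q = \<mu> \<cdot>\<^sub>v q" for q \<mu>
    proof (rule adj[OF q(1,2)])
      \<comment> \<open>On the kernel of \<open>R\<close> the adjoints of \<open>AH\<close> and
        \<open>A\<close> agree, so stability of \<open>A\<close> suffices there.\<close>
      have "mat_adjoint B *\<^sub>v q = 0\<^sub>v m" using Bker[OF q(1)] q by (simp add: ip_simps)
      then show "mat_adjoint A *\<^sub>v q = \<mu> \<cdot>\<^sub>v q"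
        using q(4) unfolding AHa[OF q(1)] by (simp add: vec_distribs vI)
    qed
  next
    fix x q :: "complex vec" and \<omega> :: real
    assume x: "x \<in> carrier_vec n" and q: "q \<in> carrier_vec n"
      and e: "AH *\<^sub>v x + R *\<^sub>v q = (\<i> * complex_of_real \<omega>) \<cdot>\<^sub>v x"
        "- (Q *\<^sub>v x) - mat_adjoint AH *\<^sub>v q = (\<i> * complex_of_real \<omega>) \<cdot>\<^sub>v q"
    note [simp] = carrier_vecD[OF x] carrier_vecD[OF q]
    \<comment> \<open>The maximising input for the pair \<open>(x, q)\<close>; it rewrites the
      Hamiltonian eigenvector equation as state and costate equations of the original plant.\<close>
    define w where "w = S *\<^sub>v (mat_adjoint B *\<^sub>v q + mat_adjoint D *\<^sub>v (C *\<^sub>v x))"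
    have w: "w \<in> carrier_vec m" by (simp add: w_def vI)
    note [simp] = carrier_vecD[OF w]
    define z where "z = C *\<^sub>v x + D *\<^sub>v w"
    have [simp]: "dim_vec z = p" by (simp add: z_def)
    have Mw: "of_real G1 \<cdot>\<^sub>v w - mat_adjoint D *\<^sub>v (D *\<^sub>v w) = mat_adjoint B *\<^sub>v q + mat_adjoint D *\<^sub>v (C *\<^sub>v x)"
      using MS[of "mat_adjoint B *\<^sub>v q + mat_adjoint D *\<^sub>v (C *\<^sub>v x)"] Mv[OF w]
      unfolding w_def by (simp add: vI)
    have e1: "(\<i> * complex_of_real \<omega>) \<cdot>\<^sub>v x = A *\<^sub>v x + B *\<^sub>v w"
      unfolding e(1)[symmetric] AHv[OF x] Rv[OF q] w_def
      by (simp add: vec_distribs, auto simp: vec_eq_iff simp del: index_mult_mat_vec)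
    have e2: "(\<i> * complex_of_real \<omega>) \<cdot>\<^sub>v q = - (mat_adjoint A *\<^sub>v q) - mat_adjoint C *\<^sub>v z"
      unfolding e(2)[symmetric] AHa[OF q] Qv[OF x] w_def z_def
      by (simp add: vec_distribs, auto simp: vec_eq_iff simp del: index_mult_mat_vec)
    \<comment> \<open>The state equation is paired with \<open>q\<close> and the costate equation
      with \<open>x\<close>. On the imaginary axis the left sides cancel, which leaves the power
      balance \<open>e3\<close>.\<close>
    have "ip q ((\<i> * complex_of_real \<omega>) \<cdot>\<^sub>v x) + ip ((\<i> * complex_of_real \<omega>) \<cdot>\<^sub>v q) x = 0"
      by (simp add: ip_simps)
    then have "ip q (A *\<^sub>v x) + ip q (B *\<^sub>v w) - ip (mat_adjoint A *\<^sub>v q) x - ip (mat_adjoint C *\<^sub>v z) x = 0"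
      unfolding e1 e2 by (simp add: ip_simps algebra_simps)
    then have e3: "ip (mat_adjoint B *\<^sub>v q) w = ip z (C *\<^sub>v x)"
      by (simp add: ip_adjoint_right)
    have "ip (of_real G1 \<cdot>\<^sub>v w - mat_adjoint D *\<^sub>v (D *\<^sub>v w)) w = ip (mat_adjoint B *\<^sub>v q + mat_adjoint D *\<^sub>v (C *\<^sub>v x)) w"
      unfolding Mw ..
    then have "of_real G1 * ip w w = ip z (C *\<^sub>v x) + ip (D *\<^sub>v w) (D *\<^sub>v w) + ip (C *\<^sub>v x) (D *\<^sub>v w)"
      by (simp add: ip_simps e3 algebra_simps flip: ip_adjoint_right)
    also have "\<dots> = ip z z" by (simp add: z_def ip_simps)
    finally have "complex_of_real (G1 * nsq w) = of_real (nsq z)" by (simp add: ip_self_nsq)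
    then have "G1 * nsq w = nsq z" by (simp only: of_real_eq_iff)
    also have "\<dots> \<le> G * nsq w" unfolding z_def by (rule gain[OF x w e1])
    finally have "(G1 - G) * nsq w \<le> 0" by (simp add: algebra_simps)
    \<comment> \<open>Attaining the gain \<open>G1 > G\<close> is possible only for
      \<open>w = 0\<close>; then \<open>x\<close>, and after it \<open>q\<close>, would be an
      eigenvector of a stable matrix with imaginary eigenvalue unless it vanishes.\<close>
    then have "nsq w = 0" using G nsq_ge0[of w] by (simp add: mult_le_0_iff)
    then have w0: "w = 0\<^sub>v m" using nsq_eq0[of w] by simp
    then have "A *\<^sub>v x = (\<i> * complex_of_real \<omega>) \<cdot>\<^sub>v x"
      unfolding e1 by (simp add: vec_distribs vI)
    then have x0: "x = 0\<^sub>v n" using stab eigenvalueI[OF A x] by fastforce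
    have "z = 0\<^sub>v p" by (simp add: z_def w0 x0 vec_distribs)
    then have e4: "(\<i> * complex_of_real \<omega>) \<cdot>\<^sub>v q = - (mat_adjoint A *\<^sub>v q)"
      unfolding e2 by (simp add: vec_distribs, auto simp: vec_eq_iff simp del: index_mult_mat_vec)
    have "mat_adjoint A *\<^sub>v q = - ((\<i> * complex_of_real \<omega>) \<cdot>\<^sub>v q)"
      unfolding e4 by simp
    also have "\<dots> = (- (\<i> * complex_of_real \<omega>)) \<cdot>\<^sub>v q" by (auto simp: vec_eq_iff)
    finally have "q = 0\<^sub>v n" using adj[OF q] by fastforce
    with x0 show "x = 0\<^sub>v n \<and> q = 0\<^sub>v n" by simp
  next
  fix P assume P: "P \<in> carrier_mat n n" "mat_adjoint P = P"
    and ric: "\<And>x. x \<in> carrier_vec n \<Longrightarrow> mat_adjoint AH *\<^sub>v (P *\<^sub>v x) + P *\<^sub>v (AH *\<^sub>v x) +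
       P *\<^sub>v (R *\<^sub>v (P *\<^sub>v x)) + Q *\<^sub>v x = 0\<^sub>v n"
  note [simp] = carrier_matD[OF P(1)]
  show thesis
  proof (rule that[OF P]; intro ballI)
    fix x w :: "complex vec" assume x: "x \<in> carrier_vec n" and w: "w \<in> carrier_vec m"
    note [simp] = carrier_vecD[OF x] carrier_vecD[OF w]
    define a where "a = mat_adjoint B *\<^sub>v (P *\<^sub>v x)"
    define b where "b = mat_adjoint D *\<^sub>v (C *\<^sub>v x)"
    have [simp]: "dim_vec a = m" "dim_vec b = m" by (simp_all add: a_def b_def)
    define h where "h = a + b"
    have [simp]: "dim_vec h = m" by (simp add: h_def)
    \<comment> \<open>Deviation from the maximising input \<open>S h\<close>. By the Riccati
      equation, completing the square turns the whole form into
      \<open>- Re (ip (M e) e)\<close>.\<close>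
    define e where "e = w - S *\<^sub>v h"
    have [simp]: "dim_vec e = m" by (simp add: e_def)
    have Psym: "ip (P *\<^sub>v u) v = ip u (P *\<^sub>v v)" if "u \<in> carrier_vec n" "v \<in> carrier_vec n" for u v
      using ip_adjoint[of P v u] P that by simp
    have i1: "ip (mat_adjoint AH *\<^sub>v (P *\<^sub>v x)) x = ip (P *\<^sub>v x) (A *\<^sub>v x) + ip a (S *\<^sub>v b)"
    proof -
      have "ip (mat_adjoint AH *\<^sub>v (P *\<^sub>v x)) x = ip (P *\<^sub>v x) (A *\<^sub>v x) + ip (D *\<^sub>v (S *\<^sub>v a)) (C *\<^sub>v x)"
        by (simp add: AHa vI ip_simps a_def flip: ip_adjoint_right)
      also have "ip (D *\<^sub>v (S *\<^sub>v a)) (C *\<^sub>v x) = ip (S *\<^sub>v a) b" by (simp add: ip_adjoint b_def)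
      finally show ?thesis by (simp add: Ssym vI)
    qed
    have i2: "ip (P *\<^sub>v (AH *\<^sub>v x)) x = cnj (ip (P *\<^sub>v x) (A *\<^sub>v x)) + ip (S *\<^sub>v b) a"
    proof -
      have "ip (P *\<^sub>v (AH *\<^sub>v x)) x = ip (A *\<^sub>v x) (P *\<^sub>v x) + ip (B *\<^sub>v (S *\<^sub>v b)) (P *\<^sub>v x)"
        by (simp add: Psym vI x AHv ip_simps b_def)
      also have "ip (B *\<^sub>v (S *\<^sub>v b)) (P *\<^sub>v x) = ip (S *\<^sub>v b) a" by (simp add: ip_adjoint a_def)
      also have "ip (A *\<^sub>v x) (P *\<^sub>v x) = cnj (ip (P *\<^sub>v x) (A *\<^sub>v x))"
        using ip_commute[of "P *\<^sub>v x" "A *\<^sub>v x"] by simp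
      finally show ?thesis .
    qed
    have i3: "ip (P *\<^sub>v (R *\<^sub>v (P *\<^sub>v x))) x = ip (S *\<^sub>v a) a"
    proof -
      have "ip (P *\<^sub>v (R *\<^sub>v (P *\<^sub>v x))) x = ip (B *\<^sub>v (S *\<^sub>v a)) (P *\<^sub>v x)"
        by (simp add: Psym vI x Rv a_def)
      then show ?thesis by (simp add: ip_adjoint a_def)
    qed
    have i4: "ip (Q *\<^sub>v x) x = of_real (nsq (C *\<^sub>v x)) + ip (S *\<^sub>v b) b"
    proof -
      have "ip (Q *\<^sub>v x) x = ip (C *\<^sub>v x) (C *\<^sub>v x) + ip (D *\<^sub>v (S *\<^sub>v b)) (C *\<^sub>v x)"
        by (simp add: Qv x ip_simps b_def flip: ip_adjoint_right)
      then show ?thesis by (simp add: ip_self_nsq ip_adjoint b_def)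
    qed
    have "ip (mat_adjoint AH *\<^sub>v (P *\<^sub>v x) + P *\<^sub>v (AH *\<^sub>v x) + P *\<^sub>v (R *\<^sub>v (P *\<^sub>v x)) + Q *\<^sub>v x) x = 0"
      by (subst ric[OF x]) (simp add: ip_simps)
    then have "ip (P *\<^sub>v x) (A *\<^sub>v x) + cnj (ip (P *\<^sub>v x) (A *\<^sub>v x)) + of_real (nsq (C *\<^sub>v x)) + ip h (S *\<^sub>v h) = 0"
      by (simp add: ip_simps i1 i2 i3 i4 h_def vec_distribs Ssym vI algebra_simps)
    then have "Re (ip (P *\<^sub>v x) (A *\<^sub>v x) + cnj (ip (P *\<^sub>v x) (A *\<^sub>v x)) + of_real (nsq (C *\<^sub>v x)) + ip h (S *\<^sub>v h)) = 0"
      by simp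
    then have j1: "2 * Re (ip (P *\<^sub>v x) (A *\<^sub>v x)) + nsq (C *\<^sub>v x) + Re (ip h (S *\<^sub>v h)) = 0" by simp
    have j2: "Re (ip (P *\<^sub>v x) (B *\<^sub>v w)) + Re (ip (C *\<^sub>v x) (D *\<^sub>v w)) = Re (ip h w)"
      by (simp add: h_def ip_simps a_def b_def ip_adjoint_right)
    have Msym: "ip (M *\<^sub>v u) v = ip u (M *\<^sub>v v)" if "u \<in> carrier_vec m" "v \<in> carrier_vec m" for u v
      using ip_adjoint[of M v u] Mh that by simp
    have "ip (M *\<^sub>v e) e = ip (M *\<^sub>v w) w - ip w h - ip h w + ip h (S *\<^sub>v h)"
      by (simp add: e_def vec_distribs ip_simps MS vI Msym w)
    then have "Re (ip (M *\<^sub>v e) e) = Re (ip (M *\<^sub>v w) w - ip w h - ip h w + ip h (S *\<^sub>v h))" by simp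
    also have "\<dots> = G1 * nsq w - nsq (D *\<^sub>v w) - 2 * Re (ip h w) + Re (ip h (S *\<^sub>v h))"
      using ip_commute[of h w] by (simp add: Mform w)
    finally have j3: "Re (ip (M *\<^sub>v e) e) = G1 * nsq w - nsq (D *\<^sub>v w) - 2 * Re (ip h w) + Re (ip h (S *\<^sub>v h))" .
    have "0 \<le> (G1 - G) * nsq e" using G by simp
    also have "\<dots> \<le> Re (ip (M *\<^sub>v e) e)" by (rule Mge) (simp add: vI)
    finally show "2 * Re (ip (P *\<^sub>v x) (A *\<^sub>v x + B *\<^sub>v w)) + nsq (C *\<^sub>v x + D *\<^sub>v w) - G1 * nsq w \<le> 0"
      using j1 j2 j3 by (simp add: ip_simps nsq_add)
  qed
qed
qed

text \<open>The margin is spent twice. The halfway level \<open>G2\<close> gives the nonstrict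
  inequality for \<open>P1\<close>; the remaining gap pays for the cross term caused by adding
  \<open>\<delta> P0\<close>, where \<open>P0\<close> solves the Lyapunov equation and contributes
  \<open>- \<delta> |x|\<^sup>2\<close>. At \<open>w = 0\<close> the result contains a strict
  Lyapunov inequality, so stability yields positivity.\<close>

lemma bounded_real_strict:
  fixes A B C D :: "complex mat"
  assumes A: "A \<in> carrier_mat n n" and B: "B \<in> carrier_mat n m"
    and C: "C \<in> carrier_mat p n" and D: "D \<in> carrier_mat p m"
    and stab: "\<And>s. eigenvalue A s \<Longrightarrow> Re s < 0"
    and gain: "\<And>\<omega> x w. x \<in> carrier_vec n \<Longrightarrow> w \<in> carrier_vec m \<Longrightarrow>
       (\<i> * complex_of_real \<omega>) \<cdot>\<^sub>v x = A *\<^sub>v x + B *\<^sub>v w \<Longrightarrow> nsq (C *\<^sub>v x + D *\<^sub>v w) \<le> G * nsq w"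
    and G: "G < G1"
  obtains P where "P \<in> carrier_mat n n" "mat_adjoint P = P"
    "\<forall>x\<in>carrier_vec n. \<forall>w\<in>carrier_vec m. x \<noteq> 0\<^sub>v n \<or> w \<noteq> 0\<^sub>v m \<longrightarrow>
      2 * Re (ip (P *\<^sub>v x) (A *\<^sub>v x + B *\<^sub>v w)) + nsq (C *\<^sub>v x + D *\<^sub>v w) - G1 * nsq w < 0"
    "\<forall>x\<in>carrier_vec n. x \<noteq> 0\<^sub>v n \<longrightarrow> Re (ip (P *\<^sub>v x) x) > 0"
proof -
  note [simp] = carrier_matD[OF A] carrier_matD[OF B] carrier_matD[OF C] carrier_matD[OF D]
  define G2 where "G2 = (G + G1) / 2"
  have G2: "G < G2" "G2 < G1" using G by (auto simp: G2_def)
  obtain P1 where P1: "P1 \<in> carrier_mat n n" "mat_adjoint P1 = P1"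
    and f1: "\<forall>x\<in>carrier_vec n. \<forall>w\<in>carrier_vec m.
      2 * Re (ip (P1 *\<^sub>v x) (A *\<^sub>v x + B *\<^sub>v w)) + nsq (C *\<^sub>v x + D *\<^sub>v w) - G2 * nsq w \<le> 0"
    by (rule bounded_real_nonstrict[OF A B C D stab gain G2(1)]) blast
  obtain P0 where P0: "P0 \<in> carrier_mat n n" "mat_adjoint P0 = P0"
    and f0: "\<And>x. x \<in> carrier_vec n \<Longrightarrow> 2 * Re (ip (P0 *\<^sub>v x) (A *\<^sub>v x)) = - nsq x"
    using lyapunov_equation[OF A stab] by metis
  note [simp] = carrier_matD[OF P1(1)] carrier_matD[OF P0(1)]
  obtain c where c: "c \<ge> 0" "\<And>w. dim_vec w = dim_col (P0 * B) \<Longrightarrow> nsq ((P0 * B) *\<^sub>v w) \<le> c * nsq w"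
    using mult_mat_vec_bounded[of "P0 * B"] by metis
  \<comment> \<open>With \<open>c\<close> bounding \<open>P0 B\<close>, the cross term costs at most
    half of the gap in \<open>|w|\<^sup>2\<close> and, through the weight 1/2 used below, half of
    \<open>\<delta> |x|\<^sup>2\<close>. The summand 1 keeps the denominator positive when
    \<open>c = 0\<close>.\<close>
  define \<delta> where "\<delta> = (G1 - G2) / (4 * (c + 1))"
  have \<delta>: "\<delta> > 0" using G2 c by (simp add: \<delta>_def)
  have \<delta>c: "2 * c * \<delta> \<le> (G1 - G2) / 2"
    using G2 c by (simp add: \<delta>_def field_simps)
  define P where "P = P1 + of_real \<delta> \<cdot>\<^sub>m P0"
  have P: "P \<in> carrier_mat n n" by (rule carrier_matI) (simp_all add: P_def)
  have Ph: "mat_adjoint P = P" by (simp add: P_def mat_adjoint_add mat_adjoint_smult P1 P0)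
  have Pv: "P *\<^sub>v x = P1 *\<^sub>v x + of_real \<delta> \<cdot>\<^sub>v (P0 *\<^sub>v x)" if "x \<in> carrier_vec n" for x
    using that by (simp add: P_def vec_distribs)
  have main: "2 * Re (ip (P *\<^sub>v x) (A *\<^sub>v x + B *\<^sub>v w)) + nsq (C *\<^sub>v x + D *\<^sub>v w) - G1 * nsq w < 0"
    if x: "x \<in> carrier_vec n" and w: "w \<in> carrier_vec m" and nz: "x \<noteq> 0\<^sub>v n \<or> w \<noteq> 0\<^sub>v m" for x w
  proof -
    note [simp] = carrier_vecD[OF x] carrier_vecD[OF w]
    have "2 * Re (ip (P0 *\<^sub>v x) (B *\<^sub>v w)) = 2 * Re (ip x ((P0 * B) *\<^sub>v w))"
      using ip_adjoint[of P0 "B *\<^sub>v w" x] P0 by (simp add: vec_distribs)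
    also have "\<dots> \<le> 1/2 * nsq x + nsq ((P0 * B) *\<^sub>v w) / (1/2)"
      by (rule two_Re_ip_le) auto
    also have "\<dots> \<le> 1/2 * nsq x + 2 * (c * nsq w)" using c(2)[of w] by simp
    finally have "\<delta> * (2 * Re (ip (P0 *\<^sub>v x) (B *\<^sub>v w))) \<le> \<delta> * (1/2 * nsq x + 2 * (c * nsq w))"
      using \<delta> by simp
    also have "\<dots> = \<delta> / 2 * nsq x + 2 * c * \<delta> * nsq w" by (simp add: algebra_simps)
    also have "2 * c * \<delta> * nsq w \<le> (G1 - G2) / 2 * nsq w" by (rule mult_right_mono[OF \<delta>c]) simp
    finally have 1: "\<delta> * (2 * Re (ip (P0 *\<^sub>v x) (B *\<^sub>v w))) \<le> \<delta> / 2 * nsq x + (G1 - G2) / 2 * nsq w" by simp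
    have "2 * Re (ip (P *\<^sub>v x) (A *\<^sub>v x + B *\<^sub>v w)) = 2 * Re (ip (P1 *\<^sub>v x) (A *\<^sub>v x + B *\<^sub>v w))
       + \<delta> * (2 * Re (ip (P0 *\<^sub>v x) (A *\<^sub>v x))) + \<delta> * (2 * Re (ip (P0 *\<^sub>v x) (B *\<^sub>v w)))"
      by (simp add: Pv x ip_simps algebra_simps)
    also have "\<dots> \<le> G2 * nsq w - nsq (C *\<^sub>v x + D *\<^sub>v w) - \<delta> * nsq x + (\<delta> / 2 * nsq x + (G1 - G2) / 2 * nsq w)"
      using f1[rule_format, OF x w] 1 unfolding f0[OF x] by simp
    finally have "2 * Re (ip (P *\<^sub>v x) (A *\<^sub>v x + B *\<^sub>v w)) + nsq (C *\<^sub>v x + D *\<^sub>v w) - G1 * nsq w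
       \<le> - (\<delta> / 2 * nsq x + (G1 - G2) / 2 * nsq w)" by (simp add: field_simps)
    moreover have "\<delta> / 2 * nsq x + (G1 - G2) / 2 * nsq w > 0"
      using nz
    proof
      assume "x \<noteq> 0\<^sub>v n"
      then have "\<delta> / 2 * nsq x > 0" using nsq_pos[of x] \<delta> by simp
      moreover have "(G1 - G2) / 2 * nsq w \<ge> 0" using G2 by simp
      ultimately show ?thesis by linarith
    next
      assume "w \<noteq> 0\<^sub>v m"
      then have "(G1 - G2) / 2 * nsq w > 0" using nsq_pos[of w] G2 by simp
      moreover have "\<delta> / 2 * nsq x \<ge> 0" using \<delta> by simp
      ultimately show ?thesis by linarith
    qed
    ultimately show ?thesis by linarith
  qed
  have "Re (ip (P *\<^sub>v x) (A *\<^sub>v x)) < 0" if x: "x \<in> carrier_vec n" "x \<noteq> 0\<^sub>v n" for x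
  proof -
    have "A *\<^sub>v x + B *\<^sub>v 0\<^sub>v m = A *\<^sub>v x" using x by (auto simp: vec_distribs vec_eq_iff simp del: index_mult_mat_vec)
    then show ?thesis using main[of x "0\<^sub>v m"] x nsq_ge0[of "C *\<^sub>v x + D *\<^sub>v 0\<^sub>v m"] by (simp add: nsq_def)
  qed
  then have "Re (ip (P *\<^sub>v x) x) > 0" if "x \<in> carrier_vec n" "x \<noteq> 0\<^sub>v n" for x
    using lyapunov_pos[OF A P Ph stab] that by blast
  with P Ph main that show thesis by blast
qed

section \<open>From complex vectors to the real matrix inequality and back\<close>

abbreviation cvec :: "real vec \<Rightarrow> complex vec" where "cvec \<equiv> map_vec complex_of_real"

abbreviation Rev :: "complex vec \<Rightarrow> real vec" where "Rev \<equiv> map_vec Re"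

abbreviation Imv :: "complex vec \<Rightarrow> real vec" where "Imv \<equiv> map_vec Im"

lemma Rev_cmat_mult: "dim_vec v = dim_col M \<Longrightarrow> Rev (cmat M *\<^sub>v v) = M *\<^sub>v Rev v"
  and Imv_cmat_mult: "dim_vec v = dim_col M \<Longrightarrow> Imv (cmat M *\<^sub>v v) = M *\<^sub>v Imv v"
  by (auto simp: vec_eq_iff mult_vec_index simp del: index_mult_mat_vec)

lemma cmat_mult_cvec: "dim_vec v = dim_col M \<Longrightarrow> cmat M *\<^sub>v cvec v = cvec (M *\<^sub>v v)"
  by (auto simp: vec_eq_iff mult_vec_index simp del: index_mult_mat_vec)

lemma Re_ip_split: "dim_vec u = dim_vec v \<Longrightarrow> Re (ip u v) = ip (Rev u) (Rev v) + ip (Imv u) (Imv v)"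
  by (simp add: ip_def sum.distrib)

lemma nsq_split: "nsq v = ip (Rev v) (Rev v) + ip (Imv v) (Imv v)"
  by (simp add: nsq_def ip_def sum.distrib cmod_power2) (simp add: power2_eq_square)

lemma nsq_cvec: "nsq (cvec v) = ip v v"
  by (simp add: nsq_def ip_def) (simp add: power2_eq_square)

lemma ip_real_commute: "dim_vec u = dim_vec v \<Longrightarrow> ip (v :: real vec) u = ip u v"
  using ip_commute[of u v] by simp

lemma ip_real_ge0 [simp]: "ip (v :: real vec) v \<ge> 0"
  by (auto simp: ip_def intro: sum_nonneg)

lemma ip_real_eq0: "ip (v :: real vec) v = 0 \<longleftrightarrow> v = 0\<^sub>v (dim_vec v)"
  by (auto simp: ip_def sum_nonneg_eq_0_iff vec_eq_iff)

lemma ip_real_pos: "v \<noteq> 0\<^sub>v (dim_vec v) \<Longrightarrow> ip (v :: real vec) v > 0"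
  using ip_real_eq0[of v] ip_real_ge0[of v] by linarith

text \<open>The bounded real inequality in the variable \<open>X = P\<^sup>-\<^sup>1\<close>, where \<open>P\<close> is the Lyapunov matrix of the closed loop:
  \<open>M = A X + B\<^sub>2 Y\<close> and \<open>N = C X + D\<^sub>2 Y\<close> with \<open>Y = K X\<close>, so that it is affine in \<open>X\<close> and \<open>Y\<close>; \<open>G\<close> is the square
  of the performance level.\<close>

definition br_form :: "real mat \<Rightarrow> real mat \<Rightarrow> real mat \<Rightarrow> real mat \<Rightarrow> real \<Rightarrow> real vec \<Rightarrow> real vec \<Rightarrow> real" where
  "br_form M B N D G x w = 2 * ip x (M *\<^sub>v x + B *\<^sub>v w) + ip (N *\<^sub>v x + D *\<^sub>v w) (N *\<^sub>v x + D *\<^sub>v w) - G * ip w w"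

text \<open>Negative definiteness jointly in state and input: at \<open>x = 0\<close> it says
  \<open>|D w|\<^sup>2 < G |w|\<^sup>2\<close>, and at \<open>w = 0\<close> it contains a strict
  Lyapunov inequality. Both dimensions are read off \<open>B\<close>.\<close>

definition br_lmi :: "real mat \<Rightarrow> real mat \<Rightarrow> real mat \<Rightarrow> real mat \<Rightarrow> real \<Rightarrow> bool" where
  "br_lmi M B N D G \<longleftrightarrow> (\<forall>x\<in>carrier_vec (dim_row B). \<forall>w\<in>carrier_vec (dim_col B).
     x \<noteq> 0\<^sub>v (dim_row B) \<or> w \<noteq> 0\<^sub>v (dim_col B) \<longrightarrow> br_form M B N D G x w < 0)"

definition pos_def :: "real mat \<Rightarrow> bool" where
  "pos_def X \<longleftrightarrow> dim_col X = dim_row X \<and> mat_adjoint X = X \<and>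
     (\<forall>x\<in>carrier_vec (dim_row X). x \<noteq> 0\<^sub>v (dim_row X) \<longrightarrow> ip (X *\<^sub>v x) x > 0)"

lemma pos_def_inverse:
  assumes X: "pos_def X" "X \<in> carrier_mat n n"
  obtains P where "P \<in> carrier_mat n n" "pos_def P" "X * P = 1\<^sub>m n" "P * X = 1\<^sub>m n"
proof -
  note [simp] = carrier_matD[OF X(2)]
  have Xp: "ip (X *\<^sub>v x) x > 0" if "x \<in> carrier_vec n" "x \<noteq> 0\<^sub>v n" for x
    using X that by (auto simp: pos_def_def)
  have Xh: "mat_adjoint X = X" using X by (auto simp: pos_def_def)
  have "det X \<noteq> 0"
  proof
    assume "det X = 0"
    then obtain v where v: "v \<in> carrier_vec n" "v \<noteq> 0\<^sub>v n" "X *\<^sub>v v = 0\<^sub>v n"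
      using det_0_iff_vec_prod_zero[OF X(2)] by blast
    then show False using Xp[OF v(1,2)] by (simp add: ip_simps)
  qed
  then obtain P where P: "P \<in> carrier_mat n n" "X * P = 1\<^sub>m n" "P * X = 1\<^sub>m n"
    using det_non_zero_imp_unit[OF X(2), of "()"] by (auto simp: Units_def ring_mat_simps)
  note [simp] = carrier_matD[OF P(1)]
  have adj1: "mat_adjoint (1\<^sub>m n :: real mat) = 1\<^sub>m n" by (rule eq_matI) auto
  have "mat_adjoint P * X = mat_adjoint (X * P)" by (simp add: mat_adjoint_mult Xh)
  then have 1: "mat_adjoint P * X = 1\<^sub>m n" by (simp add: P(2) adj1)
  have "mat_adjoint P = mat_adjoint P * (X * P)" by (simp add: P(2) right_mult_one_mat[of _ n n])
  also have "\<dots> = mat_adjoint P * X * P"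
    by (rule assoc_mult_mat[symmetric, of _ n n _ n _ n]) (use X P in auto)
  finally have Ph: "mat_adjoint P = P" using 1 P(1) by simp
  have XP: "X *\<^sub>v (P *\<^sub>v x) = x" if "x \<in> carrier_vec n" for x
    using that P by (simp flip: vec_distribs(9))
  have "ip (P *\<^sub>v x) x > 0" if x: "x \<in> carrier_vec n" "x \<noteq> 0\<^sub>v n" for x
  proof -
    have "P *\<^sub>v x \<noteq> 0\<^sub>v n"
    proof
      assume "P *\<^sub>v x = 0\<^sub>v n"
      then show False using XP[OF x(1)] x(2) by (simp add: vec_distribs)
    qed
    then have "ip (X *\<^sub>v (P *\<^sub>v x)) (P *\<^sub>v x) > 0" using Xp[of "P *\<^sub>v x"] P x by simp
    then show ?thesis using XP[OF x(1)] x ip_real_commute[of "P *\<^sub>v x" x] by simp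
  qed
  then have "pos_def P" using Ph by (auto simp: pos_def_def)
  with P that show thesis by blast
qed

text \<open>The matrix from the Riccati equation is complex, but real vectors see only its entrywise
  real part \<open>Q\<close>, which inherits symmetry, positivity and the inequality. Substituting
  \<open>x = Q y\<close> moves the inverse \<open>X\<close> into the coefficients.\<close>

lemma bounded_real_lmi:
  fixes A B C D :: "real mat"
  assumes A: "A \<in> carrier_mat n n" and B: "B \<in> carrier_mat n m"
    and C: "C \<in> carrier_mat p n" and D: "D \<in> carrier_mat p m"
    and stab: "hurwitz_stable A"
    and gain: "\<And>\<omega> x w. x \<in> carrier_vec n \<Longrightarrow> w \<in> carrier_vec m \<Longrightarrow>
       (\<i> * complex_of_real \<omega>) \<cdot>\<^sub>v x = cmat A *\<^sub>v x + cmat B *\<^sub>v w \<Longrightarrow>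
       nsq (cmat C *\<^sub>v x + cmat D *\<^sub>v w) \<le> G * nsq w"
    and G: "G < G1"
  obtains X where "X \<in> carrier_mat n n" "pos_def X" "br_lmi (A * X) B (C * X) D G1"
proof -
  note [simp] = carrier_matD[OF A] carrier_matD[OF B] carrier_matD[OF C] carrier_matD[OF D]
  have cA: "cmat A \<in> carrier_mat n n" "cmat B \<in> carrier_mat n m" "cmat C \<in> carrier_mat p n" "cmat D \<in> carrier_mat p m"
    using A B C D by auto
  have st: "eigenvalue (cmat A) s \<Longrightarrow> Re s < 0" for s using stab by (auto simp: hurwitz_stable_def)
  obtain P where P: "P \<in> carrier_mat n n" "mat_adjoint P = P"
    and f: "\<forall>x\<in>carrier_vec n. \<forall>w\<in>carrier_vec m. x \<noteq> 0\<^sub>v n \<or> w \<noteq> 0\<^sub>v m \<longrightarrow>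
      2 * Re (ip (P *\<^sub>v x) (cmat A *\<^sub>v x + cmat B *\<^sub>v w)) + nsq (cmat C *\<^sub>v x + cmat D *\<^sub>v w) - G1 * nsq w < 0"
    and pos: "\<forall>x\<in>carrier_vec n. x \<noteq> 0\<^sub>v n \<longrightarrow> Re (ip (P *\<^sub>v x) x) > 0"
    by (rule bounded_real_strict[OF cA st gain G]) blast
  note [simp] = carrier_matD[OF P(1)]
  define Q where "Q = map_mat Re P"
  have Q: "Q \<in> carrier_mat n n" using P by (simp add: Q_def)
  note [simp] = carrier_matD[OF Q]
  have QP: "Re (ip (P *\<^sub>v cvec x) (cvec y)) = ip (Q *\<^sub>v x) y" if "x \<in> carrier_vec n" "y \<in> carrier_vec n" for x y
    using that by (simp add: ip_def Q_def mult_vec_index sum_distrib_right del: index_mult_mat_vec)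
  have nz: "cvec x \<noteq> 0\<^sub>v k" if "x \<noteq> 0\<^sub>v k" for x k using that by (auto simp: vec_eq_iff)
  have Qh: "mat_adjoint Q = Q"
  proof (rule eq_matI)
    fix i j assume "i < dim_row Q" "j < dim_col Q"
    then show "mat_adjoint Q $$ (i,j) = Q $$ (i,j)"
      using mat_adjoint_index[of i P j] P by (simp add: Q_def)
  qed simp_all
  have Qpos: "pos_def Q"
    unfolding pos_def_def
  proof (intro conjI ballI impI)
    fix x :: "real vec" assume "x \<in> carrier_vec (dim_row Q)" and x0: "x \<noteq> 0\<^sub>v (dim_row Q)"
    then have x: "x \<in> carrier_vec n" by simp
    then have "Re (ip (P *\<^sub>v cvec x) (cvec x)) > 0" using pos[rule_format, of "cvec x"] nz[of x n] x0 by simp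
    then show "ip (Q *\<^sub>v x) x > 0" using QP[OF x x] by simp
  qed (use Qh in simp_all)
  obtain X where X: "X \<in> carrier_mat n n" "pos_def X" "Q * X = 1\<^sub>m n" "X * Q = 1\<^sub>m n"
    by (rule pos_def_inverse[OF Qpos Q])
  note [simp] = carrier_matD[OF X(1)]
  show thesis
  proof (rule that[OF X(1,2)])
    show "br_lmi (A * X) B (C * X) D G1"
      unfolding br_lmi_def
    proof (intro ballI impI)
      fix x w :: "real vec" assume "x \<in> carrier_vec (dim_row B)" "w \<in> carrier_vec (dim_col B)"
        and nz': "x \<noteq> 0\<^sub>v (dim_row B) \<or> w \<noteq> 0\<^sub>v (dim_col B)"
      then have x: "x \<in> carrier_vec n" and w: "w \<in> carrier_vec m" by auto
      note [simp] = carrier_vecD[OF x] carrier_vecD[OF w]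
      define y where "y = X *\<^sub>v x"
      have y: "y \<in> carrier_vec n" using X x by (simp add: y_def)
      have Qy: "Q *\<^sub>v y = x" using X x by (simp add: y_def flip: vec_distribs(9))
      have "y \<noteq> 0\<^sub>v n \<or> w \<noteq> 0\<^sub>v m" using nz' Qy by (auto simp: vec_distribs)
      then have "cvec y \<noteq> 0\<^sub>v n \<or> cvec w \<noteq> 0\<^sub>v m" using nz by blast
      then have "2 * Re (ip (P *\<^sub>v cvec y) (cmat A *\<^sub>v cvec y + cmat B *\<^sub>v cvec w))
          + nsq (cmat C *\<^sub>v cvec y + cmat D *\<^sub>v cvec w) - G1 * nsq (cvec w) < 0"
        using f y w by simp
      moreover have "cmat A *\<^sub>v cvec y + cmat B *\<^sub>v cvec w = cvec (A *\<^sub>v y + B *\<^sub>v w)"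
        "cmat C *\<^sub>v cvec y + cmat D *\<^sub>v cvec w = cvec (C *\<^sub>v y + D *\<^sub>v w)"
        using y carrier_vecD[OF y] by (simp_all add: cmat_mult_cvec, auto simp: vec_eq_iff simp del: index_mult_mat_vec)
      ultimately have "2 * ip x (A *\<^sub>v y + B *\<^sub>v w) + ip (C *\<^sub>v y + D *\<^sub>v w) (C *\<^sub>v y + D *\<^sub>v w) - G1 * ip w w < 0"
        using QP[OF y, of "A *\<^sub>v y + B *\<^sub>v w"] by (simp add: nsq_cvec Qy carrier_vecI)
      then show "br_form (A * X) B (C * X) D G1 x w < 0"
        by (simp add: br_form_def y_def vec_distribs)
    qed
  qed
qed

text \<open>Put \<open>\<xi> = X\<^sup>-\<^sup>1 x\<close>. When the state derivative is
  \<open>s x\<close>, the indefinite term of the form is \<open>2 Re s\<close> times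
  \<open>ip \<xi> (X \<xi>)\<close>, a positive number for \<open>x \<noteq> 0\<close>. At an
  eigenvector, with \<open>w = 0\<close>, negativity forces \<open>Re s < 0\<close>; on the
  imaginary axis the term vanishes and the gain bound remains.\<close>

lemma lmi_bounded_real:
  fixes A B C D X :: "real mat"
  assumes A: "A \<in> carrier_mat n n" and B: "B \<in> carrier_mat n m"
    and C: "C \<in> carrier_mat p n" and D: "D \<in> carrier_mat p m"
    and X: "X \<in> carrier_mat n n" "pos_def X" and lmi: "br_lmi (A * X) B (C * X) D G"
  shows "hurwitz_stable A"
    and "\<And>\<omega> x w. x \<in> carrier_vec n \<Longrightarrow> w \<in> carrier_vec m \<Longrightarrow>
       (\<i> * complex_of_real \<omega>) \<cdot>\<^sub>v x = cmat A *\<^sub>v x + cmat B *\<^sub>v w \<Longrightarrow>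
       nsq (cmat C *\<^sub>v x + cmat D *\<^sub>v w) \<le> G * nsq w"
proof -
  note [simp] = carrier_matD[OF A] carrier_matD[OF B] carrier_matD[OF C] carrier_matD[OF D] carrier_matD[OF X(1)]
  obtain P where P: "P \<in> carrier_mat n n" "pos_def P" "X * P = 1\<^sub>m n" "P * X = 1\<^sub>m n"
    by (rule pos_def_inverse[OF X(2,1)])
  note [simp] = carrier_matD[OF P(1)]
  have Xh: "mat_adjoint X = X" and Xp: "\<And>x. x \<in> carrier_vec n \<Longrightarrow> x \<noteq> 0\<^sub>v n \<Longrightarrow> ip (X *\<^sub>v x) x > 0"
    using X by (auto simp: pos_def_def)
  have form_le: "br_form (A * X) B (C * X) D G x w \<le> 0"
    and form_less: "x \<noteq> 0\<^sub>v n \<or> w \<noteq> 0\<^sub>v m \<Longrightarrow> br_form (A * X) B (C * X) D G x w < 0"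
    if "x \<in> carrier_vec n" "w \<in> carrier_vec m" for x w
  proof -
    show less: "br_form (A * X) B (C * X) D G x w < 0" if "x \<noteq> 0\<^sub>v n \<or> w \<noteq> 0\<^sub>v m"
      using lmi that \<open>x \<in> _\<close> \<open>w \<in> _\<close> by (auto simp: br_lmi_def)
    show "br_form (A * X) B (C * X) D G x w \<le> 0"
    proof (cases "x \<noteq> 0\<^sub>v n \<or> w \<noteq> 0\<^sub>v m")
      case False
      then show ?thesis by (simp add: br_form_def vec_distribs ip_simps)
    qed (use less in auto)
  qed
  \<comment> \<open>All coefficients are real, so real and imaginary parts do not mix.\<close>
  have cform: "2 * Re (ip \<xi> (cmat A *\<^sub>v (cmat X *\<^sub>v \<xi>) + cmat B *\<^sub>v w))
      + nsq (cmat C *\<^sub>v (cmat X *\<^sub>v \<xi>) + cmat D *\<^sub>v w) - G * nsq w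
    = br_form (A * X) B (C * X) D G (Rev \<xi>) (Rev w) + br_form (A * X) B (C * X) D G (Imv \<xi>) (Imv w)"
    if \<xi>: "\<xi> \<in> carrier_vec n" and w: "w \<in> carrier_vec m" for \<xi> w
  proof -
    note [simp] = carrier_vecD[OF \<xi>] carrier_vecD[OF w]
    have add: "Rev (u + v) = Rev u + Rev v" "Imv (u + v) = Imv u + Imv v" if "dim_vec u = dim_vec v" for u v
      using that by (auto simp: vec_eq_iff)
    show ?thesis
      by (simp add: Re_ip_split nsq_split add Rev_cmat_mult Imv_cmat_mult br_form_def vec_distribs algebra_simps)
  qed
  have Xherm: "Re (ip \<xi> ((\<i> * complex_of_real \<omega>) \<cdot>\<^sub>v (cmat X *\<^sub>v \<xi>))) = 0"
    and Xreal: "ip \<xi> (cmat X *\<^sub>v \<xi>) = of_real (ip (X *\<^sub>v Rev \<xi>) (Rev \<xi>) + ip (X *\<^sub>v Imv \<xi>) (Imv \<xi>))"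
    if \<xi>: "\<xi> \<in> carrier_vec n" for \<xi> \<omega>
  proof -
    note [simp] = carrier_vecD[OF \<xi>]
    have cX: "mat_adjoint (cmat X) = cmat X"
    proof (rule eq_matI)
      fix i j assume "i < dim_row (cmat X)" "j < dim_col (cmat X)"
      then show "mat_adjoint (cmat X) $$ (i,j) = cmat X $$ (i,j)"
        using mat_adjoint_index[of i X j] Xh by simp
    qed simp_all
    have "ip \<xi> (cmat X *\<^sub>v \<xi>) = cnj (ip \<xi> (cmat X *\<^sub>v \<xi>))"
      using ip_adjoint[of "cmat X" \<xi> \<xi>] ip_commute[of "\<xi>" "cmat X *\<^sub>v \<xi>"] cX by simp
    then have im: "Im (ip \<xi> (cmat X *\<^sub>v \<xi>)) = 0" by (simp add: complex_eq_iff)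
    then show "Re (ip \<xi> ((\<i> * complex_of_real \<omega>) \<cdot>\<^sub>v (cmat X *\<^sub>v \<xi>))) = 0" by (simp add: ip_simps)
    show "ip \<xi> (cmat X *\<^sub>v \<xi>) = of_real (ip (X *\<^sub>v Rev \<xi>) (Rev \<xi>) + ip (X *\<^sub>v Imv \<xi>) (Imv \<xi>))"
      using im by (simp add: complex_eq_iff Re_ip_split Rev_cmat_mult Imv_cmat_mult
          ip_real_commute[of "X *\<^sub>v Rev \<xi>"] ip_real_commute[of "X *\<^sub>v Imv \<xi>"])
  qed
  have XPv: "cmat X *\<^sub>v (cmat P *\<^sub>v x) = x" if "x \<in> carrier_vec n" for x
  proof -
    note [simp] = carrier_vecD[OF that]
    have "X *\<^sub>v (P *\<^sub>v u) = u" if "dim_vec u = n" for u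
      using that P by (simp add: vec_distribs(10) flip: vec_distribs(9))
    then have "Rev (cmat X *\<^sub>v (cmat P *\<^sub>v x)) = Rev x" "Imv (cmat X *\<^sub>v (cmat P *\<^sub>v x)) = Imv x"
      by (simp_all add: Rev_cmat_mult Imv_cmat_mult)
    then show ?thesis by (auto simp: vec_eq_iff complex_eq_iff simp del: index_mult_mat_vec)
  qed
  have nzsplit: "Rev v \<noteq> 0\<^sub>v k \<or> Imv v \<noteq> 0\<^sub>v k" if "v \<noteq> 0\<^sub>v k" for v k
    using that by (auto simp: vec_eq_iff complex_eq_iff)
  show "hurwitz_stable A"
    unfolding hurwitz_stable_def
  proof (intro allI impI)
    fix s assume "eigenvalue (cmat A) s"
    then obtain x where x: "x \<in> carrier_vec n" "x \<noteq> 0\<^sub>v n" "cmat A *\<^sub>v x = s \<cdot>\<^sub>v x"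
      by (auto simp: eigenvalue_def eigenvector_def)
    define \<xi> where "\<xi> = cmat P *\<^sub>v x"
    have \<xi>: "\<xi> \<in> carrier_vec n" by (auto intro!: carrier_vecI simp: \<xi>_def)
    note [simp] = carrier_vecD[OF x(1)] carrier_vecD[OF \<xi>]
    have X\<xi>: "cmat X *\<^sub>v \<xi> = x" using XPv[OF x(1)] by (simp add: \<xi>_def)
    have "\<xi> \<noteq> 0\<^sub>v n" using X\<xi> x(2) by (auto simp: vec_distribs)
    from nzsplit[OF this] have nz: "Rev \<xi> \<noteq> 0\<^sub>v n \<or> Imv \<xi> \<noteq> 0\<^sub>v n" .
    have cv: "Rev \<xi> \<in> carrier_vec n" "Imv \<xi> \<in> carrier_vec n" by (auto intro: carrier_vecI)
    have zi: "Rev (0\<^sub>v m) = 0\<^sub>v m" "Imv (0\<^sub>v m) = 0\<^sub>v m" by auto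
    have "br_form (A * X) B (C * X) D G (Rev \<xi>) (Rev (0\<^sub>v m)) + br_form (A * X) B (C * X) D G (Imv \<xi>) (Imv (0\<^sub>v m)) < 0"
      using form_le[OF cv(1), of "0\<^sub>v m"] form_le[OF cv(2), of "0\<^sub>v m"] form_less[OF cv(1), of "0\<^sub>v m"]
        form_less[OF cv(2), of "0\<^sub>v m"] nz unfolding zi by fastforce
    then have "2 * Re (ip \<xi> (s \<cdot>\<^sub>v x + cmat B *\<^sub>v 0\<^sub>v m)) < 0"
      unfolding cform[OF \<xi>, of "0\<^sub>v m", simplified, symmetric] X\<xi> x(3)
      using nsq_ge0[of "cmat C *\<^sub>v x + cmat D *\<^sub>v 0\<^sub>v m"] by (simp add: nsq_def)
    then have "Re (ip \<xi> (s \<cdot>\<^sub>v x)) < 0" by (simp add: vec_distribs ip_simps)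
    then have neg: "Re s * (ip (X *\<^sub>v Rev \<xi>) (Rev \<xi>) + ip (X *\<^sub>v Imv \<xi>) (Imv \<xi>)) < 0"
      using Xreal[OF \<xi>] X\<xi> by (simp add: ip_simps)
    have "ip (X *\<^sub>v u) u \<ge> 0" if "u \<in> carrier_vec n" for u
      using Xp[OF that] by (cases "u = 0\<^sub>v n") (auto simp: ip_simps)
    then have "ip (X *\<^sub>v Rev \<xi>) (Rev \<xi>) + ip (X *\<^sub>v Imv \<xi>) (Imv \<xi>) > 0"
      using Xp[OF cv(1)] Xp[OF cv(2)] nz cv by (metis add_nonneg_pos add_pos_nonneg)
    with neg show "Re s < 0" by (simp add: mult_less_0_iff)
  qed
  fix \<omega> x w
  assume x: "x \<in> carrier_vec n" and w: "w \<in> carrier_vec m"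
    and e: "(\<i> * complex_of_real \<omega>) \<cdot>\<^sub>v x = cmat A *\<^sub>v x + cmat B *\<^sub>v w"
  define \<xi> where "\<xi> = cmat P *\<^sub>v x"
  have \<xi>: "\<xi> \<in> carrier_vec n" by (auto intro!: carrier_vecI simp: \<xi>_def)
  note [simp] = carrier_vecD[OF x] carrier_vecD[OF \<xi>] carrier_vecD[OF w]
  have X\<xi>: "cmat X *\<^sub>v \<xi> = x" using XPv[OF x] by (simp add: \<xi>_def)
  have "br_form (A * X) B (C * X) D G (Rev \<xi>) (Rev w) + br_form (A * X) B (C * X) D G (Imv \<xi>) (Imv w) \<le> 0"
    using form_le[of "Rev \<xi>" "Rev w"] form_le[of "Imv \<xi>" "Imv w"] by (simp add: carrier_vecI)
  then show "nsq (cmat C *\<^sub>v x + cmat D *\<^sub>v w) \<le> G * nsq w"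
    unfolding cform[OF \<xi> w, symmetric] X\<xi> e[symmetric]
    using Xherm[OF \<xi>, of \<omega>] unfolding X\<xi> by simp
qed

subsection \<open>The largest singular value\<close>

lemma finite_eigenvalues:
  fixes A :: "complex mat"
  assumes A: "A \<in> carrier_mat n n"
  shows "finite {k. eigenvalue A k}"
proof -
  have "char_poly A \<noteq> 0" using degree_monic_char_poly[OF A] by auto
  then show ?thesis unfolding eigenvalue_root_char_poly[OF A] by (rule poly_roots_finite)
qed

lemma sigma_max_finite: "finite (insert 0 {sqrt (Re k) | k. eigenvalue (mat_adjoint M * M) k})"
proof -
  have "mat_adjoint M * M \<in> carrier_mat (dim_col M) (dim_col M)" by (rule carrier_matI) simp_all
  from finite_eigenvalues[OF this] show ?thesis by simp
qed

lemma sigma_max_ge0: "sigma_max M \<ge> 0"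
  unfolding sigma_max_def by (rule Max_ge[OF sigma_max_finite]) simp

lemma sigma_max_le:
  assumes g: "g \<ge> 0" and le: "\<And>w. dim_vec w = dim_col M \<Longrightarrow> nsq (M *\<^sub>v w) \<le> g\<^sup>2 * nsq w"
  shows "sigma_max M \<le> g"
  unfolding sigma_max_def
proof (rule Max.boundedI[OF sigma_max_finite])
  fix a assume "a \<in> insert 0 {sqrt (Re k) | k. eigenvalue (mat_adjoint M * M) k}"
  then consider "a = 0" | k where "a = sqrt (Re k)" "eigenvalue (mat_adjoint M * M) k" by blast
  then show "a \<le> g"
  proof cases
    case (2 k)
    then obtain v where v: "v \<in> carrier_vec (dim_col M)" "v \<noteq> 0\<^sub>v (dim_col M)"
      "(mat_adjoint M * M) *\<^sub>v v = k \<cdot>\<^sub>v v"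
      by (auto simp: eigenvalue_def eigenvector_def)
    note [simp] = carrier_vecD[OF v(1)]
    have "k * ip v v = ip ((mat_adjoint M * M) *\<^sub>v v) v" unfolding v(3) by (simp add: ip_simps)
    also have "\<dots> = ip (M *\<^sub>v v) (M *\<^sub>v v)" by (simp add: vec_distribs ip_adjoint_right)
    finally have "Re (k * of_real (nsq v)) = Re (of_real (nsq (M *\<^sub>v v)))" by (simp only: ip_self_nsq)
    then have "Re k * nsq v \<le> g\<^sup>2 * nsq v" using le[of v] by simp
    then have "Re k \<le> g\<^sup>2" using nsq_pos[of v] v by simp
    then show ?thesis using 2 g by (metis real_sqrt_le_iff real_sqrt_abs abs_of_nonneg)
  qed (use g in auto)
qed simp

text \<open>Let \<open>t\<close> be the supremum of the Rayleigh quotient of \<open>M\<^sup>* M\<close>. The form of \<open>T = t I - M\<^sup>* M\<close> is nonnegative, so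
  \<open>|T u|\<^sup>2\<close> is at most a constant times the form at \<open>u\<close> (Cauchy-Schwarz). Were \<open>T\<close> invertible, the form would be
  bounded below on the unit sphere; hence \<open>t\<close> is an eigenvalue.\<close>

lemma nsq_mult_le_sigma_max:
  assumes w: "dim_vec w = dim_col M"
  shows "nsq (M *\<^sub>v w) \<le> (sigma_max M)\<^sup>2 * nsq w"
proof (cases "w = 0\<^sub>v (dim_col M)")
  case True
  then show ?thesis by (simp add: vec_distribs nsq_def)
next
  case False
  define m where "m = dim_col M"
  define U where "U = {nsq (M *\<^sub>v u) | u. dim_vec u = m \<and> nsq u = 1}"
  define t where "t = Sup U"
  obtain c where c: "c \<ge> 0" "\<And>v. dim_vec v = m \<Longrightarrow> nsq (M *\<^sub>v v) \<le> c * nsq v"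
    using mult_mat_vec_bounded[of M] unfolding m_def by metis
  have bdd: "bdd_above U" unfolding U_def by (rule bdd_aboveI[of _ c]) (use c in fastforce)
  have scale: "\<exists>u. dim_vec u = m \<and> nsq u = 1 \<and> nsq (M *\<^sub>v u) = nsq (M *\<^sub>v v) / nsq v"
    if v: "dim_vec v = m" "nsq v \<noteq> 0" for v
  proof (intro exI conjI)
    let ?u = "complex_of_real (1 / sqrt (nsq v)) \<cdot>\<^sub>v v"
    show "dim_vec ?u = m" "nsq ?u = 1" using v by (auto simp: nsq_smult norm_divide power_divide)
    show "nsq (M *\<^sub>v ?u) = nsq (M *\<^sub>v v) / nsq v"
      using v by (simp add: m_def vec_distribs nsq_smult norm_divide power_divide)
  qed
  have ne: "U \<noteq> {}" using scale[of w] nsq_pos[of w] w False by (auto simp: U_def m_def)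
  have tle: "nsq (M *\<^sub>v v) \<le> t * nsq v" if v: "dim_vec v = m" for v
  proof (cases "nsq v = 0")
    case True
    then have "v = 0\<^sub>v m" using nsq_eq0[of v] v by simp
    then show ?thesis by (simp add: m_def vec_distribs nsq_def)
  next
    case False
    obtain u where "dim_vec u = m" "nsq u = 1" "nsq (M *\<^sub>v u) = nsq (M *\<^sub>v v) / nsq v"
      using scale[OF v False] by blast
    then have "nsq (M *\<^sub>v v) / nsq v \<in> U" unfolding U_def by force
    then have "nsq (M *\<^sub>v v) / nsq v \<le> t" unfolding t_def by (rule cSup_upper[OF _ bdd])
    then show ?thesis using False nsq_ge0[of v] by (simp add: field_simps)
  qed
  have t0: "t \<ge> 0"
  proof -
    obtain u where u: "dim_vec u = m" "nsq u = 1" using scale[of w] nsq_pos[of w] w False by (auto simp: m_def)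
    then show ?thesis using tle[OF u(1)] nsq_ge0[of "M *\<^sub>v u"] unfolding u(2) by linarith
  qed
  define T where "T = of_real t \<cdot>\<^sub>m 1\<^sub>m m - mat_adjoint M * M"
  have Td[simp]: "dim_row T = m" "dim_col T = m" by (simp_all add: T_def m_def)
  have TC: "T \<in> carrier_mat m m" by (rule carrier_matI) simp_all
  have Tv: "T *\<^sub>v u = of_real t \<cdot>\<^sub>v u - mat_adjoint M *\<^sub>v (M *\<^sub>v u)" if "dim_vec u = m" for u
    using that by (simp add: T_def vec_distribs m_def)
  define \<phi> where "\<phi> u = t * nsq u - nsq (M *\<^sub>v u)" for u
  have \<phi>: "Re (ip (T *\<^sub>v u) v) = t * Re (ip u v) - Re (ip (M *\<^sub>v u) (M *\<^sub>v v))"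
    if "dim_vec u = m" "dim_vec v = m" for u v
    using that by (simp add: Tv ip_simps ip_adjoint_right m_def)
  have CS: "nsq (T *\<^sub>v u) \<le> (t + 1) * \<phi> u" if u: "dim_vec u = m" for u
  proof -
    \<comment> \<open>A step of length \<open>s\<close> against the gradient direction
      \<open>T u\<close> leaves the form nonnegative, which bounds \<open>|T u|\<^sup>2\<close>. The
      number \<open>t + 1\<close> bounds the form on unit vectors and stays positive even if
      \<open>t = 0\<close>.\<close>
    define s where "s = 1 / (t + 1)"
    have s: "s > 0" "s * (t + 1) = 1" using t0 by (auto simp: s_def)
    define y where "y = T *\<^sub>v u"
    have y: "dim_vec y = m" by (simp add: y_def)
    define v where "v = u + of_real (- s) \<cdot>\<^sub>v y"
    have nv: "nsq v = nsq u + s\<^sup>2 * nsq y - 2 * s * Re (ip u y)"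
      using u y unfolding v_def by (simp add: nsq_add nsq_smult ip_simps norm_mult)
    have nMv: "nsq (M *\<^sub>v v) = nsq (M *\<^sub>v u) + s\<^sup>2 * nsq (M *\<^sub>v y) - 2 * s * Re (ip (M *\<^sub>v u) (M *\<^sub>v y))"
      using u y unfolding v_def by (simp add: vec_distribs m_def nsq_add nsq_smult ip_simps norm_mult)
    have yy: "nsq y = t * Re (ip u y) - Re (ip (M *\<^sub>v u) (M *\<^sub>v y))"
      using \<phi>[OF u y] by (simp add: y_def[symmetric] ip_self_nsq)
    have "0 \<le> t * nsq v - nsq (M *\<^sub>v v)" using tle[of v] u y by (simp add: v_def)
    also have "\<dots> = \<phi> u + s\<^sup>2 * (t * nsq y - nsq (M *\<^sub>v y)) - 2 * s * nsq y"
      unfolding nv nMv by (subst (3) yy) (simp add: \<phi>_def algebra_simps)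
    also have "\<dots> \<le> \<phi> u + s\<^sup>2 * ((t + 1) * nsq y) - 2 * s * nsq y"
    proof -
      have "t * nsq y - nsq (M *\<^sub>v y) \<le> (t + 1) * nsq y"
        using nsq_ge0[of y] nsq_ge0[of "M *\<^sub>v y"] by (simp add: algebra_simps)
      then have "s\<^sup>2 * (t * nsq y - nsq (M *\<^sub>v y)) \<le> s\<^sup>2 * ((t + 1) * nsq y)"
        by (rule mult_left_mono) simp
      then show ?thesis by simp
    qed
    also have "s\<^sup>2 * ((t + 1) * nsq y) = s * (s * (t + 1)) * nsq y" by (simp add: power2_eq_square)
    also have "\<dots> = s * nsq y" by (simp add: s(2))
    finally have "s * nsq y \<le> \<phi> u" by simp
    then show ?thesis using t0 by (simp add: y_def s_def field_simps)
  qed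
  have "det T = 0"
  proof (rule ccontr)
    assume "det T \<noteq> 0"
    then obtain W where W: "W \<in> carrier_mat m m" "W * T = 1\<^sub>m m"
      using det_non_zero_imp_unit[OF TC, of "()"] by (auto simp: Units_def ring_mat_simps)
    note [simp] = carrier_matD[OF W(1)]
    obtain d where d: "d \<ge> 0" "\<And>v. dim_vec v = m \<Longrightarrow> nsq (W *\<^sub>v v) \<le> d * nsq v"
      using mult_mat_vec_bounded[of W] by auto
    \<comment> \<open>A unit vector within \<open>e\<close> of the supremum satisfies
      \<open>1 \<le> d (t + 1) e\<close>, and this \<open>e\<close> makes the right side
      \<open>d / (d + 1)\<close>.\<close>
    define e where "e = 1 / ((d + 1) * (t + 1))"
    have e: "e > 0" using d t0 by (simp add: e_def)
    obtain a where "a \<in> U" "t - e < a" using less_cSupD[OF ne, of "t - e"] e unfolding t_def by auto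
    then obtain u where u: "dim_vec u = m" "nsq u = 1" "t - e < nsq (M *\<^sub>v u)" by (auto simp: U_def)
    have "1 = nsq (W *\<^sub>v (T *\<^sub>v u))" using u W by (simp add: vec_distribs(10) flip: vec_distribs(9))
    also have "\<dots> \<le> d * nsq (T *\<^sub>v u)" using d(2) by simp
    also have "\<dots> \<le> d * ((t + 1) * \<phi> u)" using CS[OF u(1)] d(1) by (rule mult_left_mono)
    also have "\<dots> \<le> d * ((t + 1) * e)" using u t0 d(1) by (intro mult_left_mono) (auto simp: \<phi>_def)
    also have "\<dots> = d / (d + 1)" using t0 by (simp add: e_def)
    also have "\<dots> < 1" using d(1) by simp
    finally show False by simp
  qed
  then obtain v where v: "v \<in> carrier_vec m" "v \<noteq> 0\<^sub>v m" "T *\<^sub>v v = 0\<^sub>v m"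
    using det_0_iff_vec_prod_zero[OF TC] by blast
  have MM: "mat_adjoint M * M \<in> carrier_mat m m" by (rule carrier_matI) (simp_all add: m_def)
  have "(mat_adjoint M * M) *\<^sub>v v = of_real t \<cdot>\<^sub>v v"
  proof -
    have "of_real t \<cdot>\<^sub>v v - mat_adjoint M *\<^sub>v (M *\<^sub>v v) = 0\<^sub>v m" using v Tv by auto
    moreover have "(mat_adjoint M * M) *\<^sub>v v = mat_adjoint M *\<^sub>v (M *\<^sub>v v)"
      using v by (simp add: vec_distribs m_def)
    ultimately show ?thesis using v by (auto simp: vec_eq_iff m_def simp del: index_mult_mat_vec)
  qed
  then have "eigenvalue (mat_adjoint M * M) (of_real t)" by (rule eigenvalueI[OF MM v(1,2)])
  then have "sqrt t \<le> sigma_max M"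
    unfolding sigma_max_def by (intro Max_ge[OF sigma_max_finite]) force
  then have "t \<le> (sigma_max M)\<^sup>2" using t0 by (metis real_sqrt_le_iff real_sqrt_abs abs_of_nonneg sigma_max_ge0)
  then have "t * nsq w \<le> (sigma_max M)\<^sup>2 * nsq w" by (rule mult_right_mono) simp
  then show ?thesis using tle[of w] w by (simp add: m_def)
qed

subsection \<open>Finsler's lemma\<close>

text \<open>Bolzano-Weierstrass for finitely many coordinates: each further coordinate refines the
  subsequence by a monotone one.\<close>

lemma bounded_subseq_converges:
  fixes f :: "nat \<Rightarrow> nat \<Rightarrow> real"
  assumes "\<And>k i. i < N \<Longrightarrow> \<bar>f k i\<bar> \<le> c"
  shows "\<exists>r l. strict_mono r \<and> (\<forall>i<N. (\<lambda>k. f (r k) i) \<longlonglongrightarrow> l i)"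
  using assms
proof (induction N)
  case 0
  show ?case by (intro exI[of _ id]) (auto simp: strict_mono_def)
next
  case (Suc N)
  obtain r l where r: "strict_mono r" "\<forall>i<N. (\<lambda>k. f (r k) i) \<longlonglongrightarrow> l i"
    using Suc.IH Suc.prems by (meson less_SucI)
  obtain s where s: "strict_mono s" "monoseq (\<lambda>k. f (r (s k)) N)"
    using seq_monosub[of "\<lambda>k. f (r k) N"] by blast
  have "Bseq (\<lambda>k. f (r (s k)) N)" using Suc.prems by (intro BseqI'[of _ c]) simp
  then obtain a where a: "(\<lambda>k. f (r (s k)) N) \<longlonglongrightarrow> a"
    using Bseq_monoseq_convergent[OF _ s(2)] by (auto simp: convergent_def)
  have "(\<lambda>k. f ((r \<circ> s) k) i) \<longlonglongrightarrow> (l(N := a)) i" if "i < Suc N" for i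
  proof (cases "i = N")
    case False
    then show ?thesis using that LIMSEQ_subseq_LIMSEQ[OF r(2)[rule_format, of i] s(1)] by (simp add: o_def)
  qed (use a in simp)
  moreover have "strict_mono (r \<circ> s)" using r s by (simp add: strict_mono_o)
  ultimately show ?case by blast
qed

definition vec_tendsto :: "(nat \<Rightarrow> real vec) \<Rightarrow> real vec \<Rightarrow> bool" where
  "vec_tendsto X x \<longleftrightarrow> (\<forall>k. dim_vec (X k) = dim_vec x) \<and> (\<forall>i<dim_vec x. (\<lambda>k. X k $ i) \<longlonglongrightarrow> x $ i)"

lemma vec_tendsto_mult:
  "vec_tendsto X x \<Longrightarrow> dim_col M = dim_vec x \<Longrightarrow> vec_tendsto (\<lambda>k. M *\<^sub>v X k) (M *\<^sub>v x)"
  by (auto simp: vec_tendsto_def mult_vec_index simp del: index_mult_mat_vec intro!: tendsto_intros)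

lemma vec_tendsto_add:
  "vec_tendsto X x \<Longrightarrow> vec_tendsto Y y \<Longrightarrow> dim_vec x = dim_vec y \<Longrightarrow> vec_tendsto (\<lambda>k. X k + Y k) (x + y)"
  by (auto simp: vec_tendsto_def intro!: tendsto_intros)

lemma vec_tendsto_ip:
  "vec_tendsto X x \<Longrightarrow> vec_tendsto Y y \<Longrightarrow> dim_vec x = dim_vec y \<Longrightarrow> (\<lambda>k. ip (X k) (Y k)) \<longlonglongrightarrow> ip x y"
  by (auto simp: vec_tendsto_def ip_def intro!: tendsto_intros)

text \<open>Compactness: if the claim failed for arbitrarily large \<open>\<rho>\<close>, unit
  vectors violating it would accumulate at one where the penalty vanishes, hence in the kernel of
  \<open>E\<^sup>T\<close>, with nonnegative form. All large \<open>\<rho>\<close> are offered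
  rather than a single one, because one application also needs \<open>\<rho>\<close>
  nonnegative.\<close>

lemma finsler:
  fixes M B N D E :: "real mat"
  assumes M: "M \<in> carrier_mat n n" and B: "B \<in> carrier_mat n m"
    and N: "N \<in> carrier_mat p n" and D: "D \<in> carrier_mat p m" and E: "E \<in> carrier_mat n r"
    and neg: "\<And>x w. x \<in> carrier_vec n \<Longrightarrow> w \<in> carrier_vec m \<Longrightarrow> x \<noteq> 0\<^sub>v n \<or> w \<noteq> 0\<^sub>v m \<Longrightarrow>
       mat_adjoint E *\<^sub>v x = 0\<^sub>v r \<Longrightarrow> br_form M B N D G x w < 0"
  obtains \<rho>0 where "\<And>\<rho>. \<rho> \<ge> \<rho>0 \<Longrightarrow> br_lmi (M - \<rho> \<cdot>\<^sub>m (E * mat_adjoint E)) B N D G"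
proof (rule ccontr)
  note [simp] = carrier_matD[OF M] carrier_matD[OF B] carrier_matD[OF N] carrier_matD[OF D] carrier_matD[OF E]
  assume "\<not> thesis"
  then have "\<exists>\<rho>\<ge>real k. \<not> br_lmi (M - \<rho> \<cdot>\<^sub>m (E * mat_adjoint E)) B N D G" for k
    using that by blast
  have form: "br_form (M - \<rho> \<cdot>\<^sub>m (E * mat_adjoint E)) B N D G x w
      = br_form M B N D G x w - 2 * \<rho> * ip (mat_adjoint E *\<^sub>v x) (mat_adjoint E *\<^sub>v x)"
    if "dim_vec x = n" "dim_vec w = m" for \<rho> x w
  proof -
    have "ip x (E *\<^sub>v (mat_adjoint E *\<^sub>v x)) = ip (mat_adjoint E *\<^sub>v x) (mat_adjoint E *\<^sub>v x)"
      using that by (simp add: ip_adjoint_right)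
    then show ?thesis using that by (simp add: br_form_def vec_distribs ip_simps algebra_simps)
  qed
  have scale: "br_form M B N D G (a \<cdot>\<^sub>v x) (a \<cdot>\<^sub>v w) = a\<^sup>2 * br_form M B N D G x w"
    if "dim_vec x = n" "dim_vec w = m" for a x w
  proof -
    have "N *\<^sub>v (a \<cdot>\<^sub>v x) + D *\<^sub>v (a \<cdot>\<^sub>v w) = a \<cdot>\<^sub>v (N *\<^sub>v x + D *\<^sub>v w)"
      "M *\<^sub>v (a \<cdot>\<^sub>v x) + B *\<^sub>v (a \<cdot>\<^sub>v w) = a \<cdot>\<^sub>v (M *\<^sub>v x + B *\<^sub>v w)"
      using that by (auto simp: vec_distribs vec_eq_iff algebra_simps simp del: index_mult_mat_vec)
    then show ?thesis
      using that unfolding br_form_def by (simp add: ip_simps(4,8) algebra_simps power2_eq_square)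
  qed
  have ex: "\<exists>x w. dim_vec x = n \<and> dim_vec w = m \<and> ip x x + ip w w = 1 \<and>
      2 * real k * ip (mat_adjoint E *\<^sub>v x) (mat_adjoint E *\<^sub>v x) \<le> br_form M B N D G x w" for k
  proof -
    obtain \<rho> where \<rho>: "\<rho> \<ge> real k" "\<not> br_lmi (M - \<rho> \<cdot>\<^sub>m (E * mat_adjoint E)) B N D G"
      using \<open>\<exists>\<rho>\<ge>real k. _ \<rho>\<close> by blast
    then obtain x w where xw: "dim_vec x = n" "dim_vec w = m" "x \<noteq> 0\<^sub>v n \<or> w \<noteq> 0\<^sub>v m"
      "0 \<le> br_form (M - \<rho> \<cdot>\<^sub>m (E * mat_adjoint E)) B N D G x w"
      by (simp add: br_lmi_def not_less) (metis carrier_vecD)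
    define s where "s = ip x x + ip w w"
    have s: "s > 0"
      using xw(3) ip_real_pos[of x] ip_real_pos[of w] ip_real_ge0[of x] ip_real_ge0[of w] xw(1,2)
      unfolding s_def by (metis add_nonneg_pos add_pos_nonneg)
    define a where "a = 1 / sqrt s"
    have a: "a\<^sup>2 = 1 / s" using s by (simp add: a_def power_divide)
    let ?q = "ip (mat_adjoint E *\<^sub>v x) (mat_adjoint E *\<^sub>v x)"
    have "2 * real k * ?q \<le> 2 * \<rho> * ?q" using \<rho>(1) by (intro mult_right_mono) auto
    also have "\<dots> \<le> br_form M B N D G x w" using xw form[of x w \<rho>] by simp
    finally have le: "a\<^sup>2 * (2 * real k * ?q) \<le> a\<^sup>2 * br_form M B N D G x w" by (rule mult_left_mono) simp
    show ?thesis
    proof (intro exI conjI)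
      show "dim_vec (a \<cdot>\<^sub>v x) = n" "dim_vec (a \<cdot>\<^sub>v w) = m" using xw by auto
      have "ip (a \<cdot>\<^sub>v x) (a \<cdot>\<^sub>v x) + ip (a \<cdot>\<^sub>v w) (a \<cdot>\<^sub>v w) = a\<^sup>2 * s"
        by (simp add: ip_simps s_def power2_eq_square algebra_simps)
      then show "ip (a \<cdot>\<^sub>v x) (a \<cdot>\<^sub>v x) + ip (a \<cdot>\<^sub>v w) (a \<cdot>\<^sub>v w) = 1" using a s by simp
      show "2 * real k * ip (mat_adjoint E *\<^sub>v (a \<cdot>\<^sub>v x)) (mat_adjoint E *\<^sub>v (a \<cdot>\<^sub>v x)) \<le> br_form M B N D G (a \<cdot>\<^sub>v x) (a \<cdot>\<^sub>v w)"
        unfolding scale[OF xw(1,2)] using le xw by (simp add: vec_distribs ip_simps power2_eq_square mult_ac)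
    qed
  qed
  then obtain X W where XW: "\<And>k. dim_vec (X k) = n" "\<And>k. dim_vec (W k) = m" "\<And>k. ip (X k) (X k) + ip (W k) (W k) = 1"
    "\<And>k. 2 * real k * ip (mat_adjoint E *\<^sub>v X k) (mat_adjoint E *\<^sub>v X k) \<le> br_form M B N D G (X k) (W k)"
    by metis
  have entry: "\<bar>v $ i\<bar> \<le> 1" if "ip v v \<le> 1" "i < dim_vec v" for v :: "real vec" and i
  proof -
    have "(v $ i)\<^sup>2 \<le> ip v v"
    proof -
      have "v $ i * conjugate (v $ i) \<le> (\<Sum>i<dim_vec v. v $ i * conjugate (v $ i))"
        by (rule member_le_sum) (use that(2) in auto)
      then show ?thesis by (simp add: ip_def power2_eq_square)
    qed
    then have "(v $ i)\<^sup>2 \<le> 1\<^sup>2" using that(1) by simp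
    then show ?thesis by (metis abs_le_square_iff abs_one)
  qed
  \<comment> \<open>State and input are concatenated, so that one subsequence serves both.\<close>
  define f where "f k i = (if i < n then X k $ i else W k $ (i - n))" for k i
  have bnd: "\<bar>f k i\<bar> \<le> 1" if "i < n + m" for k i
    using that XW(1-3)[of k] entry[of "X k" i] entry[of "W k" "i - n"] ip_real_ge0[of "X k"] ip_real_ge0[of "W k"]
    by (auto simp: f_def simp del: ip_real_ge0)
  obtain s l where s: "strict_mono s" and l: "\<forall>i<n + m. (\<lambda>k. f (s k) i) \<longlonglongrightarrow> l i"
    using bounded_subseq_converges[of "n + m" f 1] bnd by blast
  define x where "x = vec n l"
  define w where "w = vec m (\<lambda>i. l (n + i))"
  have [simp]: "dim_vec x = n" "dim_vec w = m" by (auto simp: x_def w_def)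
  have Xl: "vec_tendsto (\<lambda>k. X (s k)) x"
    unfolding vec_tendsto_def
  proof (intro conjI allI impI)
    fix i assume "i < dim_vec x"
    then show "(\<lambda>k. X (s k) $ i) \<longlonglongrightarrow> x $ i" using l[rule_format, of i] by (simp add: f_def x_def)
  qed (simp add: XW)
  have Wl: "vec_tendsto (\<lambda>k. W (s k)) w"
    unfolding vec_tendsto_def
  proof (intro conjI allI impI)
    fix i assume "i < dim_vec w"
    then show "(\<lambda>k. W (s k) $ i) \<longlonglongrightarrow> w $ i" using l[rule_format, of "n + i"] by (simp add: f_def w_def)
  qed (simp add: XW)
  note lims = vec_tendsto_ip vec_tendsto_add vec_tendsto_mult Xl Wl
  have "(\<lambda>k. ip (X (s k)) (X (s k)) + ip (W (s k)) (W (s k))) \<longlonglongrightarrow> ip x x + ip w w"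
    by (intro tendsto_add lims) simp_all
  then have one: "ip x x + ip w w = 1" using XW(3) by (simp add: LIMSEQ_const_iff)
  have Fl: "(\<lambda>k. br_form M B N D G (X (s k)) (W (s k))) \<longlonglongrightarrow> br_form M B N D G x w"
    unfolding br_form_def by (intro tendsto_intros lims) simp_all
  have El: "(\<lambda>k. ip (mat_adjoint E *\<^sub>v X (s k)) (mat_adjoint E *\<^sub>v X (s k))) \<longlonglongrightarrow> ip (mat_adjoint E *\<^sub>v x) (mat_adjoint E *\<^sub>v x)"
    by (intro lims) simp_all
  \<comment> \<open>Hence the penalty weight at the \<open>k\<close>-th term of the subsequence is
    at least of order \<open>k\<close>.\<close>
  have sk: "k \<le> s k" for k using s by (rule seq_suble)
  have "br_form M B N D G x w \<ge> 0"
  proof (rule LIMSEQ_le_const[OF Fl])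
    have "0 \<le> br_form M B N D G (X (s k)) (W (s k))" for k
      using XW(4)[of "s k"] order.trans[of 0 "2 * real (s k) * ip (mat_adjoint E *\<^sub>v X (s k)) (mat_adjoint E *\<^sub>v X (s k))"] by simp
    then show "\<exists>k0. \<forall>k\<ge>k0. 0 \<le> br_form M B N D G (X (s k)) (W (s k))" by blast
  qed
  moreover have "mat_adjoint E *\<^sub>v x = 0\<^sub>v r"
  proof -
    \<comment> \<open>The form stays bounded along the subsequence while the penalty weight grows,
      so \<open>|E\<^sup>T x|\<^sup>2\<close> is squeezed to 0.\<close>
    have "Bseq (\<lambda>k. br_form M B N D G (X (s k)) (W (s k)))"
      using Fl by (rule convergent_imp_Bseq[OF convergentI])
    then obtain K where K: "\<And>k. \<bar>br_form M B N D G (X (s k)) (W (s k))\<bar> \<le> K" by (auto simp: Bseq_def)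
    have "ip (mat_adjoint E *\<^sub>v x) (mat_adjoint E *\<^sub>v x) \<le> 0"
    proof (rule LIMSEQ_le[OF El])
      show "(\<lambda>k. K * inverse (real k)) \<longlonglongrightarrow> 0"
        using tendsto_mult_right_zero[OF lim_inverse_n, of K] by simp
      show "\<exists>k0. \<forall>k\<ge>k0. ip (mat_adjoint E *\<^sub>v X (s k)) (mat_adjoint E *\<^sub>v X (s k)) \<le> K * inverse (real k)"
      proof (intro exI allI impI)
        fix k :: nat assume k: "k \<ge> 1"
        let ?q = "ip (mat_adjoint E *\<^sub>v X (s k)) (mat_adjoint E *\<^sub>v X (s k))"
        have "real k * ?q \<le> 2 * real (s k) * ?q" using sk[of k] by (intro mult_right_mono) auto
        also have "\<dots> \<le> K" using XW(4)[of "s k"] K[of k] by linarith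
        finally show "?q \<le> K * inverse (real k)" using k by (simp add: field_simps)
      qed
    qed
    then show ?thesis using ip_real_ge0[of "mat_adjoint E *\<^sub>v x"] ip_real_eq0[of "mat_adjoint E *\<^sub>v x"] by simp
  qed
  moreover have "x \<noteq> 0\<^sub>v n \<or> w \<noteq> 0\<^sub>v m" using one by (auto simp: ip_simps)
  ultimately show False using neg[of x w] by (simp add: carrier_vecI not_less[symmetric])
qed

subsection \<open>State feedback synthesis\<close>

lemma closed_loop_tf_dim [simp]:
  "dim_row (closed_loop_tf A B1 B2 C D1 D2 K s) = dim_row D1"
  "dim_col (closed_loop_tf A B1 B2 C D1 D2 K s) = dim_col D1"
  by (simp_all add: closed_loop_tf_def)

text \<open>Trades the inverse for a solution of the state equation. Away from the eigenvalues
  \<open>w\<close> determines \<open>x\<close>, so the gain of the transfer function becomes a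
  statement about pairs \<open>(x, w)\<close>, the form used by the bounded real lemma.\<close>

lemma closed_loop_tf_apply:
  assumes A: "A \<in> carrier_mat n n" and B1: "B1 \<in> carrier_mat n m" and B2: "B2 \<in> carrier_mat n k"
    and C: "C \<in> carrier_mat p n" and D1: "D1 \<in> carrier_mat p m" and D2: "D2 \<in> carrier_mat p k"
    and K: "K \<in> carrier_mat k n"
    and s: "\<not> eigenvalue (cmat (A + B2 * K)) s"
    and x: "x \<in> carrier_vec n" and w: "w \<in> carrier_vec m"
    and e: "s \<cdot>\<^sub>v x = cmat (A + B2 * K) *\<^sub>v x + cmat B1 *\<^sub>v w"
  shows "closed_loop_tf A B1 B2 C D1 D2 K s *\<^sub>v w = cmat (C + D2 * K) *\<^sub>v x + cmat D1 *\<^sub>v w"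
proof -
  note [simp] = carrier_matD[OF A] carrier_matD[OF B1] carrier_matD[OF B2] carrier_matD[OF C]
    carrier_matD[OF D1] carrier_matD[OF D2] carrier_matD[OF K] carrier_vecD[OF x] carrier_vecD[OF w]
  define M where "M = s \<cdot>\<^sub>m 1\<^sub>m n - cmat A - cmat (B2 * K)"
  have M: "M \<in> carrier_mat n n" by (rule carrier_matI) (simp_all add: M_def)
  have Ac: "cmat (A + B2 * K) \<in> carrier_mat n n" by (rule carrier_matI) simp_all
  have cA: "cmat (A + B2 * K) = cmat A + cmat (B2 * K)" by (rule eq_matI) auto
  have Mv: "M *\<^sub>v v = s \<cdot>\<^sub>v v - cmat (A + B2 * K) *\<^sub>v v" if "v \<in> carrier_vec n" for v
    unfolding cA using that
    by (simp add: M_def vec_distribs, auto simp: vec_eq_iff simp del: index_mult_mat_vec)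
  have "det M \<noteq> 0"
  proof
    assume "det M = 0"
    then obtain v where v: "v \<in> carrier_vec n" "v \<noteq> 0\<^sub>v n" "M *\<^sub>v v = 0\<^sub>v n"
      using det_0_iff_vec_prod_zero[OF M] by blast
    then have "cmat (A + B2 * K) *\<^sub>v v = s \<cdot>\<^sub>v v"
      by (auto simp: Mv vec_eq_iff simp del: index_mult_mat_vec)
    with s eigenvalueI[OF Ac v(1,2)] show False by blast
  qed
  \<comment> \<open>Invertibility guarantees that \<open>mat_inverse\<close> returns
    \<open>Some W\<close>, so that \<open>the\<close> yields a genuine inverse.\<close>
  then have "M \<in> Units (ring_mat TYPE(complex) n ())" by (rule det_non_zero_imp_unit[OF M])
  then obtain W where W: "mat_inverse M = Some W"
    using mat_inverse(1)[OF M, of "()"] by (cases "mat_inverse M") auto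
  from mat_inverse(2)[OF M W] have WM: "W * M = 1\<^sub>m n" "W \<in> carrier_mat n n" by auto
  note [simp] = carrier_matD[OF WM(2)]
  have "M *\<^sub>v x = cmat B1 *\<^sub>v w"
    unfolding Mv[OF x] e by (auto simp: vec_eq_iff simp del: index_mult_mat_vec)
  then have "W *\<^sub>v (cmat B1 *\<^sub>v w) = W *\<^sub>v (M *\<^sub>v x)" by simp
  also have "\<dots> = x" using WM M by (simp add: vec_distribs(10) flip: vec_distribs(9))
  finally have Wx: "W *\<^sub>v (cmat B1 *\<^sub>v w) = x" .
  have "closed_loop_tf A B1 B2 C D1 D2 K s = cmat (C + D2 * K) * W * cmat B1 + cmat D1"
    by (simp add: closed_loop_tf_def W flip: M_def)
  also have "\<dots> *\<^sub>v w = cmat (C + D2 * K) *\<^sub>v (W *\<^sub>v (cmat B1 *\<^sub>v w)) + cmat D1 *\<^sub>v w"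
    by (simp add: vec_distribs)
  finally show ?thesis unfolding Wx .
qed

definition lmi_feasible ::
  "real mat \<Rightarrow> real mat \<Rightarrow> real mat \<Rightarrow> real mat \<Rightarrow> real mat \<Rightarrow> real mat \<Rightarrow> real \<Rightarrow> bool" where
  "lmi_feasible A B1 B2 C D1 D2 g \<longleftrightarrow>
     (\<exists>X Y. X \<in> carrier_mat (dim_row A) (dim_row A) \<and> Y \<in> carrier_mat (dim_col B2) (dim_row A) \<and> pos_def X \<and>
        br_lmi (A * X + B2 * Y) B1 (C * X + D2 * Y) D1 (g\<^sup>2))"

lemma br_lmi_cong:
  assumes "br_lmi M B N D G" "B \<in> carrier_mat n m"
    and "\<And>x. x \<in> carrier_vec n \<Longrightarrow> M *\<^sub>v x = M' *\<^sub>v x" "\<And>x. x \<in> carrier_vec n \<Longrightarrow> N *\<^sub>v x = N' *\<^sub>v x"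
  shows "br_lmi M' B N' D G"
  using assms by (auto simp: br_lmi_def br_form_def)

lemma br_lmiD:
  "br_lmi M B N D G \<Longrightarrow> B \<in> carrier_mat n m \<Longrightarrow> x \<in> carrier_vec n \<Longrightarrow> w \<in> carrier_vec m \<Longrightarrow>
    x \<noteq> 0\<^sub>v n \<or> w \<noteq> 0\<^sub>v m \<Longrightarrow> br_form M B N D G x w < 0"
  by (auto simp: br_lmi_def)

lemma hinf_norm_ge0: "hinf_norm G \<ge> 0"
  unfolding hinf_norm_def by (rule SUP_upper2[of 0]) (simp_all add: sigma_max_ge0)

text \<open>The norm is a real number \<open>g0 < g\<close>, and this gap is the margin that the
  bounded real lemma uses up.\<close>

lemma lmi_feasible_of_gain:
  assumes A: "A \<in> carrier_mat n n" and B1: "B1 \<in> carrier_mat n m" and B2: "B2 \<in> carrier_mat n k"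
    and C: "C \<in> carrier_mat p n" and D1: "D1 \<in> carrier_mat p m" and D2: "D2 \<in> carrier_mat p k"
    and K: "K \<in> carrier_mat k n"
    and stab: "hurwitz_stable (A + B2 * K)"
    and less: "hinf_norm (closed_loop_tf A B1 B2 C D1 D2 K) < ereal g"
  shows "lmi_feasible A B1 B2 C D1 D2 g"
proof -
  note [simp] = carrier_matD[OF A] carrier_matD[OF B1] carrier_matD[OF B2] carrier_matD[OF C]
    carrier_matD[OF D1] carrier_matD[OF D2] carrier_matD[OF K]
  obtain g0 where g0: "hinf_norm (closed_loop_tf A B1 B2 C D1 D2 K) = ereal g0"
    using less hinf_norm_ge0[of "closed_loop_tf A B1 B2 C D1 D2 K"]
    by (cases "hinf_norm (closed_loop_tf A B1 B2 C D1 D2 K)") auto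
  have g0': "0 \<le> g0" "g0 < g"
    using less hinf_norm_ge0[of "closed_loop_tf A B1 B2 C D1 D2 K"] unfolding g0 by auto
  have Ac: "A + B2 * K \<in> carrier_mat n n" "C + D2 * K \<in> carrier_mat p n" by (rule carrier_matI; simp)+
  obtain X where X: "X \<in> carrier_mat n n" "pos_def X" "br_lmi ((A + B2 * K) * X) B1 ((C + D2 * K) * X) D1 (g\<^sup>2)"
  proof (rule bounded_real_lmi[OF Ac(1) B1 Ac(2) D1 stab])
    show "g0\<^sup>2 < g\<^sup>2" using g0' by (intro power_strict_mono) auto
    fix \<omega> x w assume x: "x \<in> carrier_vec n" and w: "w \<in> carrier_vec m"
      and e: "(\<i> * complex_of_real \<omega>) \<cdot>\<^sub>v x = cmat (A + B2 * K) *\<^sub>v x + cmat B1 *\<^sub>v w"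
    let ?G = "closed_loop_tf A B1 B2 C D1 D2 K (\<i> * complex_of_real \<omega>)"
    have ne: "\<not> eigenvalue (cmat (A + B2 * K)) (\<i> * complex_of_real \<omega>)"
      using stab by (fastforce simp: hurwitz_stable_def)
    have "ereal (sigma_max ?G) \<le> ereal g0"
      unfolding g0[symmetric] hinf_norm_def by (rule SUP_upper) simp
    then have "(sigma_max ?G)\<^sup>2 \<le> g0\<^sup>2" using sigma_max_ge0 by (intro power_mono) auto
    then have "(sigma_max ?G)\<^sup>2 * nsq w \<le> g0\<^sup>2 * nsq w" by (rule mult_right_mono) simp
    moreover have "nsq (?G *\<^sub>v w) \<le> (sigma_max ?G)\<^sup>2 * nsq w"
      using w by (intro nsq_mult_le_sigma_max) simp
    ultimately show "nsq (cmat (C + D2 * K) *\<^sub>v x + cmat D1 *\<^sub>v w) \<le> g0\<^sup>2 * nsq w"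
      unfolding closed_loop_tf_apply[OF A B1 B2 C D1 D2 K ne x w e] by linarith
  qed
  note [simp] = carrier_matD[OF X(1)]
  have "br_lmi (A * X + B2 * (K * X)) B1 (C * X + D2 * (K * X)) D1 (g\<^sup>2)"
    by (rule br_lmi_cong[OF X(3) B1]) (simp_all add: vec_distribs)
  moreover have "K * X \<in> carrier_mat k n" using K X by simp
  ultimately show ?thesis unfolding lmi_feasible_def using X by auto
qed

text \<open>The gain is recovered as \<open>K = Y X\<^sup>-\<^sup>1\<close>. The bound obtained is
  nonstrict, which the comparison of infima tolerates.\<close>

lemma gain_of_lmi_feasible:
  assumes A: "A \<in> carrier_mat n n" and B1: "B1 \<in> carrier_mat n m" and B2: "B2 \<in> carrier_mat n k"
    and C: "C \<in> carrier_mat p n" and D1: "D1 \<in> carrier_mat p m" and D2: "D2 \<in> carrier_mat p k"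
    and feas: "lmi_feasible A B1 B2 C D1 D2 g" and g: "g \<ge> 0"
  obtains K where "K \<in> carrier_mat k n" "hurwitz_stable (A + B2 * K)"
    "hinf_norm (closed_loop_tf A B1 B2 C D1 D2 K) \<le> ereal g"
proof -
  note [simp] = carrier_matD[OF A] carrier_matD[OF B1] carrier_matD[OF B2] carrier_matD[OF C]
    carrier_matD[OF D1] carrier_matD[OF D2]
  obtain X Y where X: "X \<in> carrier_mat n n" "pos_def X" and Y: "Y \<in> carrier_mat k n"
    and lmi: "br_lmi (A * X + B2 * Y) B1 (C * X + D2 * Y) D1 (g\<^sup>2)"
    using feas by (auto simp: lmi_feasible_def)
  obtain P where P: "P \<in> carrier_mat n n" "P * X = 1\<^sub>m n"
    using pos_def_inverse[OF X(2,1)] by blast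
  note [simp] = carrier_matD[OF X(1)] carrier_matD[OF Y] carrier_matD[OF P(1)]
  define K where "K = Y * P"
  have K: "K \<in> carrier_mat k n" using Y P by (simp add: K_def)
  note [simp] = carrier_matD[OF K]
  have KX: "K *\<^sub>v (X *\<^sub>v v) = Y *\<^sub>v v" if "v \<in> carrier_vec n" for v
  proof -
    have "P *\<^sub>v (X *\<^sub>v v) = v" using that P by (simp add: vec_distribs(10) flip: vec_distribs(9))
    then show ?thesis using that by (simp add: K_def vec_distribs)
  qed
  have lmi': "br_lmi ((A + B2 * K) * X) B1 ((C + D2 * K) * X) D1 (g\<^sup>2)"
    by (rule br_lmi_cong[OF lmi B1]) (simp_all add: vec_distribs KX)
  have Ac: "A + B2 * K \<in> carrier_mat n n" "C + D2 * K \<in> carrier_mat p n" by (rule carrier_matI; simp)+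
  note br = lmi_bounded_real[OF Ac(1) B1 Ac(2) D1 X lmi']
  have "sigma_max (closed_loop_tf A B1 B2 C D1 D2 K (\<i> * complex_of_real \<omega>)) \<le> g" for \<omega>
  proof (rule sigma_max_le[OF g])
    let ?G = "closed_loop_tf A B1 B2 C D1 D2 K (\<i> * complex_of_real \<omega>)"
    fix w :: "complex vec" assume "dim_vec w = dim_col ?G"
    then have w: "w \<in> carrier_vec m" by (auto intro: carrier_vecI)
    have ne: "\<not> eigenvalue (cmat (A + B2 * K)) (\<i> * complex_of_real \<omega>)"
      using br(1) by (fastforce simp: hurwitz_stable_def)
    have cA: "cmat (A + B2 * K) \<in> carrier_mat n n" "cmat B1 *\<^sub>v w \<in> carrier_vec n"
      using Ac w B1 by (auto intro!: carrier_vecI)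
    obtain x where x: "x \<in> carrier_vec n"
      "(\<i> * complex_of_real \<omega>) \<cdot>\<^sub>v x = cmat (A + B2 * K) *\<^sub>v x + cmat B1 *\<^sub>v w"
      by (rule resolvent_exists[OF cA(1) ne cA(2)])
    show "nsq (?G *\<^sub>v w) \<le> g\<^sup>2 * nsq w"
      unfolding closed_loop_tf_apply[OF A B1 B2 C D1 D2 K ne x(1) w x(2)]
      by (rule br(2)[OF x(1) w x(2)])
  qed
  then have "hinf_norm (closed_loop_tf A B1 B2 C D1 D2 K) \<le> ereal g"
    unfolding hinf_norm_def by (intro SUP_least) simp
  with K br(1) that show thesis by blast
qed

text \<open>Every real level \<open>z\<close> above the performance of \<open>K\<close> is feasible
  for the first system, hence for the second, whose index is then at most \<open>z\<close>. Letting
  \<open>z\<close> descend absorbs the passage from \<open><\<close> to \<open>\<le>\<close>; an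
  infinite performance of \<open>K\<close> gives no constraint.\<close>

lemma opt_perf_index_mono:
  assumes A: "A \<in> carrier_mat n n" and B1: "B1 \<in> carrier_mat n m"
    and C: "C \<in> carrier_mat p n" and D1: "D1 \<in> carrier_mat p m"
    and B2: "B2 \<in> carrier_mat n k" and D2: "D2 \<in> carrier_mat p k"
    and B2': "B2' \<in> carrier_mat n k'" and D2': "D2' \<in> carrier_mat p k'"
    and feas: "\<And>g. lmi_feasible A B1 B2 C D1 D2 g \<Longrightarrow> lmi_feasible A B1 B2' C D1 D2' g"
  shows "opt_perf_index A B1 B2' C D1 D2' \<le> opt_perf_index A B1 B2 C D1 D2"
  unfolding opt_perf_index_def[of A B1 B2]
proof (rule INF_greatest)
  fix K assume "K \<in> {K \<in> carrier_mat (dim_col B2) (dim_row A). hurwitz_stable (A + B2 * K)}"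
  then have K: "K \<in> carrier_mat k n" "hurwitz_stable (A + B2 * K)" using A B2 by auto
  show "opt_perf_index A B1 B2' C D1 D2' \<le> hinf_norm (closed_loop_tf A B1 B2 C D1 D2 K)"
  proof (rule dense_ge)
    fix z assume z: "hinf_norm (closed_loop_tf A B1 B2 C D1 D2 K) < z"
    show "opt_perf_index A B1 B2' C D1 D2' \<le> z"
    proof (cases z)
      case (real g)
      have "0 < ereal g" using z hinf_norm_ge0 unfolding real by (rule le_less_trans[rotated])
      then have g: "g \<ge> 0" by simp
      have "lmi_feasible A B1 B2' C D1 D2' g"
        using lmi_feasible_of_gain[OF A B1 B2 C D1 D2 K] z real feas by blast
      then obtain K' where K': "K' \<in> carrier_mat k' n" "hurwitz_stable (A + B2' * K')"
        "hinf_norm (closed_loop_tf A B1 B2' C D1 D2' K') \<le> ereal g"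
        using gain_of_lmi_feasible[OF A B1 B2' C D1 D2' _ g] by blast
      then show ?thesis
        unfolding opt_perf_index_def real using A B2' by (intro INF_lower2[of K']) auto
    qed (use z in auto)
  qed
qed

section \<open>Block columns of input matrices and block rows of gains\<close>

lemma append_cols_carrier [simp]:
  "A \<in> carrier_mat n r \<Longrightarrow> B \<in> carrier_mat n k \<Longrightarrow> append_cols A B \<in> carrier_mat n (r + k)"
  by (auto simp: append_cols_def)

lemma append_cols_mult_append:
  fixes A B :: "'a :: field mat"
  assumes A: "A \<in> carrier_mat n r" and B: "B \<in> carrier_mat n k"
    and a: "a \<in> carrier_vec r" and b: "b \<in> carrier_vec k"
  shows "append_cols A B *\<^sub>v (a @\<^sub>v b) = A *\<^sub>v a + B *\<^sub>v b"
  unfolding append_cols_def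
  by (subst four_block_mat_mult_vec[of _ n r _ k _ 0]) (use assms in \<open>auto simp: vec_eq_iff\<close>)

lemma split_rows:
  fixes Y :: "'a :: field mat"
  assumes Y: "Y \<in> carrier_mat (r + k) n"
  obtains Y1 Y2 where "Y1 \<in> carrier_mat r n" "Y2 \<in> carrier_mat k n"
    "\<forall>v\<in>carrier_vec n. Y *\<^sub>v v = (Y1 *\<^sub>v v) @\<^sub>v (Y2 *\<^sub>v v)"
proof (intro that ballI)
  let ?Y1 = "mat r n (\<lambda>(i,j). Y $$ (i,j))" and ?Y2 = "mat k n (\<lambda>(i,j). Y $$ (r + i, j))"
  show "?Y1 \<in> carrier_mat r n" "?Y2 \<in> carrier_mat k n" by simp_all
  fix v :: "'a vec" assume v: "v \<in> carrier_vec n"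
  show "Y *\<^sub>v v = (?Y1 *\<^sub>v v) @\<^sub>v (?Y2 *\<^sub>v v)"
    using v Y by (intro eq_vecI) (auto simp: mult_vec_index simp del: index_mult_mat_vec)
qed

lemma pos_def_add_gram:
  assumes X: "X \<in> carrier_mat n n" "pos_def X" and E: "E \<in> carrier_mat n r" and q: "q \<ge> 0"
  shows "pos_def (X + q \<cdot>\<^sub>m (E * mat_adjoint E))"
proof -
  note [simp] = carrier_matD[OF X(1)] carrier_matD[OF E]
  have "ip ((X + q \<cdot>\<^sub>m (E * mat_adjoint E)) *\<^sub>v x) x > 0" if x: "x \<in> carrier_vec n" "x \<noteq> 0\<^sub>v n" for x
  proof -
    note [simp] = carrier_vecD[OF x(1)]
    have "ip (X *\<^sub>v x) x > 0" using X x by (auto simp: pos_def_def)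
    moreover have "q * ip (mat_adjoint E *\<^sub>v x) (mat_adjoint E *\<^sub>v x) \<ge> 0" using q by simp
    moreover have "ip (E *\<^sub>v (mat_adjoint E *\<^sub>v x)) x = ip (mat_adjoint E *\<^sub>v x) (mat_adjoint E *\<^sub>v x)"
      by (simp add: ip_adjoint)
    ultimately show ?thesis by (simp add: vec_distribs ip_simps)
  qed
  moreover have "mat_adjoint (X + q \<cdot>\<^sub>m (E * mat_adjoint E)) = X + q \<cdot>\<^sub>m (E * mat_adjoint E)"
    using X(2) by (simp add: mat_adjoint_add mat_adjoint_smult mat_adjoint_mult pos_def_def)
  ultimately show ?thesis by (simp add: pos_def_def)
qed

section \<open>Transfer of feasibility between the two systems\<close>

context
  fixes n m k p r :: nat and A B1 C1 D11 D12hat B21 B22 :: "real mat" and \<alpha> :: real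
  assumes A: "A \<in> carrier_mat n n" and B1: "B1 \<in> carrier_mat n m" and C1: "C1 \<in> carrier_mat p n"
    and D11: "D11 \<in> carrier_mat p m" and D12hat: "D12hat \<in> carrier_mat p k"
    and B21: "B21 \<in> carrier_mat n r" and B22: "B22 \<in> carrier_mat n k" and \<alpha>: "\<alpha> > 0"
begin

lemmas sys_dims = carrier_matD[OF A] carrier_matD[OF B1] carrier_matD[OF C1] carrier_matD[OF D11]
  carrier_matD[OF D12hat] carrier_matD[OF B21] carrier_matD[OF B22]

lemma differentiator_carriers: "(A + \<alpha> \<cdot>\<^sub>m 1\<^sub>m n) * B21 \<in> carrier_mat n r" "C1 * B21 \<in> carrier_mat p r"
  by (rule carrier_matI; simp add: sys_dims)+

lemmas append_cols_carriers = append_cols_carrier[OF B21 B22] append_cols_carrier[OF zero_carrier_mat[of p r] D12hat]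
  append_cols_carrier[OF differentiator_carriers(1) B22] append_cols_carrier[OF differentiator_carriers(2) D12hat]

text \<open>With \<open>X' = X + q B21 B21\<^sup>T\<close> and \<open>V = (- q B21\<^sup>T; Y2)\<close> the contributions of \<open>q\<close> to \<open>A X' + A B21 V1\<close> and to
  \<open>C1 X' + C1 B21 V1\<close> cancel, and \<open>\<alpha> B21 V1\<close> is the term \<open>- \<alpha> q B21 B21\<^sup>T\<close> required by Finsler's lemma.\<close>

lemma lmi_feasible_differentiator:
  assumes "lmi_feasible A B1 (append_cols B21 B22) C1 D11 (append_cols (0\<^sub>m p r) D12hat) g"
  shows "lmi_feasible A B1 (append_cols ((A + \<alpha> \<cdot>\<^sub>m 1\<^sub>m n) * B21) B22) C1 D11 (append_cols (C1 * B21) D12hat) g"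
proof -
  note [simp] = sys_dims
  note [simp] = carrier_matD[OF append_cols_carriers(1)] carrier_matD[OF append_cols_carriers(2)] carrier_matD[OF append_cols_carriers(3)] carrier_matD[OF append_cols_carriers(4)]
  obtain X Y where X: "X \<in> carrier_mat n n" "pos_def X" and Y: "Y \<in> carrier_mat (r + k) n"
    and lmi: "br_lmi (A * X + append_cols B21 B22 * Y) B1 (C1 * X + append_cols (0\<^sub>m p r) D12hat * Y) D11 (g\<^sup>2)"
    using assms by (auto simp: lmi_feasible_def)
  obtain Y1 Y2 where Y12: "Y1 \<in> carrier_mat r n" "Y2 \<in> carrier_mat k n"
    and Yv': "\<forall>v\<in>carrier_vec n. Y *\<^sub>v v = (Y1 *\<^sub>v v) @\<^sub>v (Y2 *\<^sub>v v)"
    using split_rows[OF Y] by blast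
  note Yv = Yv'[rule_format]
  note [simp] = carrier_matD[OF X(1)] carrier_matD[OF Y] carrier_matD[OF Y12(1)] carrier_matD[OF Y12(2)]
  \<comment> \<open>The coefficients stripped of \<open>Y1\<close>, which acts on the state through
    \<open>B21\<close> only and does not reach \<open>z\<close>.\<close>
  define M where "M = A * X + B22 * Y2"
  define N where "N = C1 * X + D12hat * Y2"
  have MN: "M \<in> carrier_mat n n" "N \<in> carrier_mat p n"
    by (auto intro!: carrier_matI simp: M_def N_def)
  note [simp] = carrier_matD[OF MN(1)] carrier_matD[OF MN(2)]
  have lmi': "br_lmi (M + B21 * Y1) B1 N D11 (g\<^sup>2)"
  proof (rule br_lmi_cong[OF lmi B1])
    fix x :: "real vec" assume x: "x \<in> carrier_vec n"
    have Yc: "Y1 *\<^sub>v x \<in> carrier_vec r" "Y2 *\<^sub>v x \<in> carrier_vec k" using Y12 x by auto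
    note [simp] = carrier_vecD[OF x]
    show "(A * X + append_cols B21 B22 * Y) *\<^sub>v x = (M + B21 * Y1) *\<^sub>v x"
      by (simp add: vec_distribs M_def Yv[OF x] append_cols_mult_append[OF B21 B22 Yc],
          auto simp: vec_eq_iff simp del: index_mult_mat_vec)
    show "(C1 * X + append_cols (0\<^sub>m p r) D12hat * Y) *\<^sub>v x = N *\<^sub>v x"
      by (simp add: vec_distribs N_def Yv[OF x] append_cols_mult_append[OF _ D12hat Yc],
          auto simp: vec_eq_iff simp del: index_mult_mat_vec)
  qed
  obtain \<rho>0 where \<rho>0: "\<And>\<rho>. \<rho> \<ge> \<rho>0 \<Longrightarrow> br_lmi (M - \<rho> \<cdot>\<^sub>m (B21 * mat_adjoint B21)) B1 N D11 (g\<^sup>2)"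
  proof (rule finsler[OF MN(1) B1 MN(2) D11 B21, of "g\<^sup>2"])
    fix x w :: "real vec" assume x: "x \<in> carrier_vec n" and w: "w \<in> carrier_vec m" and nz: "x \<noteq> 0\<^sub>v n \<or> w \<noteq> 0\<^sub>v m"
      and Ex: "mat_adjoint B21 *\<^sub>v x = 0\<^sub>v r"
    note [simp] = carrier_vecD[OF x] carrier_vecD[OF w]
    have "ip x (B21 *\<^sub>v (Y1 *\<^sub>v x)) = 0" by (subst ip_adjoint_right) (simp_all add: Ex ip_simps)
    then have "br_form (M + B21 * Y1) B1 N D11 (g\<^sup>2) x w = br_form M B1 N D11 (g\<^sup>2) x w"
      by (simp add: br_form_def vec_distribs ip_simps)
    then show "br_form M B1 N D11 (g\<^sup>2) x w < 0"
      using br_lmiD[OF lmi' B1 x w nz] by simp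
  qed blast
  \<comment> \<open>The maximum with 0 makes \<open>q\<close> nonnegative, so that adding
    \<open>q B21 B21\<^sup>T\<close> keeps \<open>X\<close> positive definite; dividing by
    \<open>\<alpha>\<close> makes \<open>\<alpha> q\<close> the Finsler multiplier.\<close>
  define \<rho> where "\<rho> = max \<rho>0 0"
  define q where "q = \<rho> / \<alpha>"
  have q: "q \<ge> 0" "\<alpha> * q = \<rho>" using \<alpha> by (auto simp: q_def \<rho>_def)
  define X' where "X' = X + q \<cdot>\<^sub>m (B21 * mat_adjoint B21)"
  define V where "V = ((- q) \<cdot>\<^sub>m mat_adjoint B21) @\<^sub>r Y2"
  have X': "X' \<in> carrier_mat n n" by (rule carrier_matI) (simp_all add: X'_def)
  have pX': "pos_def X'" unfolding X'_def by (rule pos_def_add_gram[OF X B21 q(1)])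
  have V1: "(- q) \<cdot>\<^sub>m mat_adjoint B21 \<in> carrier_mat r n" by (rule carrier_matI) simp_all
  have V: "V \<in> carrier_mat (r + k) n" unfolding V_def by (rule carrier_append_rows[OF V1 Y12(2)])
  note [simp] = carrier_matD[OF X'] carrier_matD[OF V]
  have "br_lmi (A * X' + append_cols ((A + \<alpha> \<cdot>\<^sub>m 1\<^sub>m n) * B21) B22 * V) B1
      (C1 * X' + append_cols (C1 * B21) D12hat * V) D11 (g\<^sup>2)"
  proof (rule br_lmi_cong[OF \<rho>0 B1])
    fix x :: "real vec" assume x: "x \<in> carrier_vec n"
    note [simp] = carrier_vecD[OF x]
    define y where "y = B21 *\<^sub>v (mat_adjoint B21 *\<^sub>v x)"
    have [simp]: "dim_vec y = n" by (simp add: y_def)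
    have Vx: "V *\<^sub>v x = ((- q) \<cdot>\<^sub>v (mat_adjoint B21 *\<^sub>v x)) @\<^sub>v (Y2 *\<^sub>v x)"
      unfolding V_def mat_mult_append[OF V1 Y12(2) x] by (simp add: vec_distribs)
    have Vc: "(- q) \<cdot>\<^sub>v (mat_adjoint B21 *\<^sub>v x) \<in> carrier_vec r" "Y2 *\<^sub>v x \<in> carrier_vec k"
      by (auto intro: carrier_vecI)
    show "(M - \<rho> \<cdot>\<^sub>m (B21 * mat_adjoint B21)) *\<^sub>v x = (A * X' + append_cols ((A + \<alpha> \<cdot>\<^sub>m 1\<^sub>m n) * B21) B22 * V) *\<^sub>v x"
      by (simp add: vec_distribs Vx append_cols_mult_append[OF differentiator_carriers(1) B22 Vc] M_def X'_def y_def[symmetric],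
          auto simp: vec_eq_iff q(2)[symmetric] algebra_simps simp del: index_mult_mat_vec)
    show "N *\<^sub>v x = (C1 * X' + append_cols (C1 * B21) D12hat * V) *\<^sub>v x"
      by (simp add: vec_distribs Vx append_cols_mult_append[OF differentiator_carriers(2) D12hat Vc] N_def X'_def y_def[symmetric],
          auto simp: vec_eq_iff algebra_simps simp del: index_mult_mat_vec)
  qed (simp add: \<rho>_def)
  then show ?thesis unfolding lmi_feasible_def using X' pX' V by auto
qed

text \<open>On the kernel of \<open>B21\<^sup>T\<close> the symmetric matrix \<open>X + B21 V1 + V1\<^sup>T B21\<^sup>T + q B21 B21\<^sup>T\<close> agrees with the matrix
  \<open>X + B21 V1\<close>, which is what the system with differentiator has in place of \<open>X\<close>; a large \<open>q\<close> makes it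
  positive definite.\<close>

lemma lmi_feasible_of_differentiator:
  assumes "lmi_feasible A B1 (append_cols ((A + \<alpha> \<cdot>\<^sub>m 1\<^sub>m n) * B21) B22) C1 D11 (append_cols (C1 * B21) D12hat) g"
  shows "lmi_feasible A B1 (append_cols B21 B22) C1 D11 (append_cols (0\<^sub>m p r) D12hat) g"
proof -
  note [simp] = sys_dims
  note [simp] = carrier_matD[OF append_cols_carriers(1)] carrier_matD[OF append_cols_carriers(2)] carrier_matD[OF append_cols_carriers(3)] carrier_matD[OF append_cols_carriers(4)]
  obtain X V where X: "X \<in> carrier_mat n n" "pos_def X" and V: "V \<in> carrier_mat (r + k) n"
    and lmi: "br_lmi (A * X + append_cols ((A + \<alpha> \<cdot>\<^sub>m 1\<^sub>m n) * B21) B22 * V) B1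
       (C1 * X + append_cols (C1 * B21) D12hat * V) D11 (g\<^sup>2)"
    using assms by (auto simp: lmi_feasible_def)
  obtain V1 V2 where V12: "V1 \<in> carrier_mat r n" "V2 \<in> carrier_mat k n"
    and Vv': "\<forall>v\<in>carrier_vec n. V *\<^sub>v v = (V1 *\<^sub>v v) @\<^sub>v (V2 *\<^sub>v v)"
    using split_rows[OF V] by blast
  note Vv = Vv'[rule_format]
  note [simp] = carrier_matD[OF X(1)] carrier_matD[OF V] carrier_matD[OF V12(1)] carrier_matD[OF V12(2)]
  define Z where "Z = X + B21 * V1 + mat_adjoint V1 * mat_adjoint B21"
  have Z: "Z \<in> carrier_mat n n" by (rule carrier_matI) (simp_all add: Z_def)
  have Zh: "mat_adjoint Z = Z"
  proof -
    have "mat_adjoint Z = X + mat_adjoint V1 * mat_adjoint B21 + B21 * V1"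
      using X(2) by (simp add: Z_def mat_adjoint_add mat_adjoint_mult pos_def_def)
    also have "\<dots> = Z" unfolding Z_def by (rule eq_matI) auto
    finally show ?thesis .
  qed
  note [simp] = carrier_matD[OF Z]
  have Zv: "Z *\<^sub>v x = X *\<^sub>v x + B21 *\<^sub>v (V1 *\<^sub>v x)"
    if "x \<in> carrier_vec n" "mat_adjoint B21 *\<^sub>v x = 0\<^sub>v r" for x
    using that by (simp add: Z_def vec_distribs, auto simp: vec_eq_iff simp del: index_mult_mat_vec)
  have Eip: "ip x (B21 *\<^sub>v u) = 0" if "x \<in> carrier_vec n" "u \<in> carrier_vec r" "mat_adjoint B21 *\<^sub>v x = 0\<^sub>v r" for x u
    using that by (simp add: ip_adjoint_right ip_simps)
  have Z': "- Z \<in> carrier_mat n n" and zc: "0\<^sub>m n 0 \<in> carrier_mat n 0" "0\<^sub>m 0 n \<in> carrier_mat 0 n" "0\<^sub>m 0 0 \<in> carrier_mat 0 0"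
    using Z by auto
  \<comment> \<open>Positive definiteness of \<open>Z + q B21 B21\<^sup>T\<close> is Finsler's lemma
    for \<open>- Z\<close> with neither input nor output; the level 1 multiplies an empty
    sum.\<close>
  obtain q where q: "br_lmi (- Z - q \<cdot>\<^sub>m (B21 * mat_adjoint B21)) (0\<^sub>m n 0) (0\<^sub>m 0 n) (0\<^sub>m 0 0) 1"
  proof (rule finsler[OF Z' zc B21, of 1])
    fix x w :: "real vec" assume x: "x \<in> carrier_vec n" and w: "w \<in> carrier_vec 0" and nz: "x \<noteq> 0\<^sub>v n \<or> w \<noteq> 0\<^sub>v 0"
      and Ex: "mat_adjoint B21 *\<^sub>v x = 0\<^sub>v r"
    note [simp] = carrier_vecD[OF x] carrier_vecD[OF w]
    have "w = 0\<^sub>v 0" using w by auto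
    then have "ip (X *\<^sub>v x) x > 0" using X nz x by (auto simp: pos_def_def)
    then have "ip x (Z *\<^sub>v x) > 0"
      using Eip[OF x _ Ex, of "V1 *\<^sub>v x"] x ip_real_commute[of "X *\<^sub>v x" x]
      by (simp add: Zv Ex ip_simps carrier_vecI)
    then show "br_form (- Z) (0\<^sub>m n 0) (0\<^sub>m 0 n) (0\<^sub>m 0 0) 1 x w < 0"
      by (simp add: br_form_def vec_distribs ip_simps) (simp add: ip_def)
  qed blast
  define X' where "X' = Z + q \<cdot>\<^sub>m (B21 * mat_adjoint B21)"
  have X': "X' \<in> carrier_mat n n" by (rule carrier_matI) (simp_all add: X'_def)
  note [simp] = carrier_matD[OF X']
  have X'v: "X' *\<^sub>v x = Z *\<^sub>v x + q \<cdot>\<^sub>v (B21 *\<^sub>v (mat_adjoint B21 *\<^sub>v x))" if "x \<in> carrier_vec n" for x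
    using that by (simp add: X'_def vec_distribs)
  have pX': "pos_def X'"
  proof -
    have "ip (X' *\<^sub>v x) x > 0" if x: "x \<in> carrier_vec n" "x \<noteq> 0\<^sub>v n" for x
    proof -
      note [simp] = carrier_vecD[OF x(1)]
      have "br_form (- Z - q \<cdot>\<^sub>m (B21 * mat_adjoint B21)) (0\<^sub>m n 0) (0\<^sub>m 0 n) (0\<^sub>m 0 0) 1 x (0\<^sub>v 0) < 0"
        using q x unfolding br_lmi_def by auto
      then have "ip x (X' *\<^sub>v x) > 0"
        by (simp add: br_form_def vec_distribs ip_simps X'v x) (simp add: ip_def)
      then show ?thesis using ip_real_commute[of "X' *\<^sub>v x" x] by simp
    qed
    moreover have "mat_adjoint X' = X'"
      unfolding X'_def using Zh by (simp add: mat_adjoint_add mat_adjoint_smult mat_adjoint_mult)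
    ultimately show ?thesis by (simp add: pos_def_def)
  qed
  define M where "M = A * X' + B22 * V2"
  define N where "N = C1 * X' + D12hat * V2"
  have MN: "M \<in> carrier_mat n n" "N \<in> carrier_mat p n"
    by (auto intro!: carrier_matI simp: M_def N_def)
  note [simp] = carrier_matD[OF MN(1)] carrier_matD[OF MN(2)]
  obtain \<rho> where \<rho>: "br_lmi (M - \<rho> \<cdot>\<^sub>m (B21 * mat_adjoint B21)) B1 N D11 (g\<^sup>2)"
  proof (rule finsler[OF MN(1) B1 MN(2) D11 B21, of "g\<^sup>2"])
    fix x w :: "real vec" assume x: "x \<in> carrier_vec n" and w: "w \<in> carrier_vec m" and nz: "x \<noteq> 0\<^sub>v n \<or> w \<noteq> 0\<^sub>v m"
      and Ex: "mat_adjoint B21 *\<^sub>v x = 0\<^sub>v r"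
    note [simp] = carrier_vecD[OF x] carrier_vecD[OF w]
    have Vc: "V1 *\<^sub>v x \<in> carrier_vec r" "V2 *\<^sub>v x \<in> carrier_vec k" by (auto intro: carrier_vecI)
    let ?M = "A * X + append_cols ((A + \<alpha> \<cdot>\<^sub>m 1\<^sub>m n) * B21) B22 * V"
    let ?N = "C1 * X + append_cols (C1 * B21) D12hat * V"
    have X'x: "X' *\<^sub>v x = X *\<^sub>v x + B21 *\<^sub>v (V1 *\<^sub>v x)"
      using x by (simp add: X'v Zv Ex vec_distribs, auto simp: vec_eq_iff simp del: index_mult_mat_vec)
    have Nx: "?N *\<^sub>v x = N *\<^sub>v x"
      by (simp add: vec_distribs N_def X'x Vv[OF x] append_cols_mult_append[OF differentiator_carriers(2) D12hat Vc],
          auto simp: vec_eq_iff simp del: index_mult_mat_vec)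
    \<comment> \<open>The leftover \<open>\<alpha> B21 V1 x\<close> is orthogonal to
      \<open>x\<close> on this kernel, and the form sees \<open>M x\<close> only through its inner
      product with \<open>x\<close>.\<close>
    have Mx: "?M *\<^sub>v x = M *\<^sub>v x + \<alpha> \<cdot>\<^sub>v (B21 *\<^sub>v (V1 *\<^sub>v x))"
      by (simp add: vec_distribs M_def X'x Vv[OF x] append_cols_mult_append[OF differentiator_carriers(1) B22 Vc],
          auto simp: vec_eq_iff simp del: index_mult_mat_vec)
    have "br_form ?M B1 ?N D11 (g\<^sup>2) x w = br_form M B1 N D11 (g\<^sup>2) x w"
      unfolding br_form_def Nx Mx using Eip[OF x Vc(1) Ex] by (simp add: ip_simps)
    then show "br_form M B1 N D11 (g\<^sup>2) x w < 0"
      using br_lmiD[OF lmi B1 x w nz] by simp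
  qed blast
  \<comment> \<open>The zero block hides the first rows of \<open>Y\<close> from \<open>z\<close>,
    so they are free to supply the Finsler term while \<open>N\<close> stays unchanged.\<close>
  define Y where "Y = ((- \<rho>) \<cdot>\<^sub>m mat_adjoint B21) @\<^sub>r V2"
  have Y1: "(- \<rho>) \<cdot>\<^sub>m mat_adjoint B21 \<in> carrier_mat r n" by (rule carrier_matI) simp_all
  have Y: "Y \<in> carrier_mat (r + k) n" unfolding Y_def by (rule carrier_append_rows[OF Y1 V12(2)])
  note [simp] = carrier_matD[OF Y]
  have "br_lmi (A * X' + append_cols B21 B22 * Y) B1 (C1 * X' + append_cols (0\<^sub>m p r) D12hat * Y) D11 (g\<^sup>2)"
  proof (rule br_lmi_cong[OF \<rho> B1])
    fix x :: "real vec" assume x: "x \<in> carrier_vec n"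
    note [simp] = carrier_vecD[OF x]
    have Yx: "Y *\<^sub>v x = ((- \<rho>) \<cdot>\<^sub>v (mat_adjoint B21 *\<^sub>v x)) @\<^sub>v (V2 *\<^sub>v x)"
      unfolding Y_def mat_mult_append[OF Y1 V12(2) x] by (simp add: vec_distribs)
    have Yc: "(- \<rho>) \<cdot>\<^sub>v (mat_adjoint B21 *\<^sub>v x) \<in> carrier_vec r" "V2 *\<^sub>v x \<in> carrier_vec k"
      by (auto intro: carrier_vecI)
    show "(M - \<rho> \<cdot>\<^sub>m (B21 * mat_adjoint B21)) *\<^sub>v x = (A * X' + append_cols B21 B22 * Y) *\<^sub>v x"
      by (simp add: vec_distribs Yx append_cols_mult_append[OF B21 B22 Yc] M_def,
          auto simp: vec_eq_iff simp del: index_mult_mat_vec)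
    show "N *\<^sub>v x = (C1 * X' + append_cols (0\<^sub>m p r) D12hat * Y) *\<^sub>v x"
      by (simp add: vec_distribs Yx append_cols_mult_append[OF _ D12hat Yc] N_def,
          auto simp: vec_eq_iff simp del: index_mult_mat_vec)
  qed
  then show ?thesis unfolding lmi_feasible_def using X' pX' Y by auto
qed

end

theorem mainTheorem6:
  fixes n m1 m2 p1 r :: nat
    and A B1 C1 D11 D12 D12hat B2 B21 B22 :: "real mat"
    and \<alpha> :: real
  assumes "1 \<le> r" and "r \<le> m2"
    and "A \<in> carrier_mat n n"
    and "B1 \<in> carrier_mat n m1"
    and "C1 \<in> carrier_mat p1 n"
    and "D11 \<in> carrier_mat p1 m1"
    and "D12hat \<in> carrier_mat p1 (m2 - r)" and "full_column_rank D12hat"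
    and "D12 = append_cols (0\<^sub>m p1 r) D12hat"
    and "B21 \<in> carrier_mat n r" and "full_column_rank B21"
    and "B22 \<in> carrier_mat n (m2 - r)"
    and "B2 = append_cols B21 B22"
    and "\<alpha> > 0"
  shows "opt_perf_index A B1 B2 C1 D11 D12 =
         opt_perf_index A B1 (append_cols ((A + \<alpha> \<cdot>\<^sub>m 1\<^sub>m n) * B21) B22)
           C1 D11 (append_cols (C1 * B21) D12hat)"
proof (rule antisym)
  note c = assms(3-7,10,12,14)
  note carr = append_cols_carriers[OF c]
  have B2: "B2 \<in> carrier_mat n (r + (m2 - r))" and D12: "D12 \<in> carrier_mat p1 (r + (m2 - r))"
    unfolding assms(9,13) by (fact carr)+
  show "opt_perf_index A B1 B2 C1 D11 D12 \<le> opt_perf_index A B1 (append_cols ((A + \<alpha> \<cdot>\<^sub>m 1\<^sub>m n) * B21) B22)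
           C1 D11 (append_cols (C1 * B21) D12hat)"
    by (rule opt_perf_index_mono[OF c(1,2,3,4) carr(3,4) B2 D12])
       (use lmi_feasible_of_differentiator[OF c] assms in simp)
  show "opt_perf_index A B1 (append_cols ((A + \<alpha> \<cdot>\<^sub>m 1\<^sub>m n) * B21) B22)
           C1 D11 (append_cols (C1 * B21) D12hat) \<le> opt_perf_index A B1 B2 C1 D11 D12"
    by (rule opt_perf_index_mono[OF c(1,2,3,4) B2 D12 carr(3,4)])
       (use lmi_feasible_differentiator[OF c] assms in simp)
qed

end
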